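(* There are $h_0>0$ and a number $r<1$ independent of $h$ such that for all $0<h\le h_0$ the following hold. The operators $\mathcal A$ and $\mathcal B$ on $\mathcal F(\Gamma_h^1)$ with the inner product $(\cdot,\cdot)$ are symmetric. In the operator norm induced by the norm $\|\psi\|=(\psi,\psi)^{1/2}$, one has $\|\mathcal B\|\le r$, so that $\mathcal A=I+\mathcal B$ is invertible with $\|\mathcal A^{-1}\|\le(1-r)^{-1}$. The spectrum of $\mathcal A$ is contained in the interval $1-r\le\lambda\le1$.
   Context: **Domain and grid.** Let $d\in\{2,3\}$ and let $\Omega^+\subset\mathbb R^d$ be a bounded domain with $C^2$ boundary $\Gamma$; put $\Omega^-=\mathbb R^d\setminus\overline{\Omega^+}$. Both $\Omega^+$ and $\Omega^-$ are connected. Fix an open rectangular box $B$ with faces parallel to the coordinate hyperplanes and $\overline{\Omega^+}\subseteq B$. Grid points are the points of $h\mathbb Z^d$; only grid sizes $h>0$ for which the faces of $B$ lie in grid hyperplanes are considered. Let $B_h=h\mathbb Z^d\cap\overline{B}$, $\partial B_h=B_h\cap\partial B$, $\Omega_h^+=\Omega^+\cap B_h$, $\Omega_h^-=B_h\setminus\Omega^+$ (so grid points on $\Gamma$ belong to $\Omega_h^-$). With $e_1,\dots,e_d$ the standard basis, a grid interval of direction $\nu$ is a segment $I=[x,x+he_\nu]$ with both endpoints in $B_h$. $\mathcal I_h^+$ (resp. $\mathcal I_h^-$) is the set of grid intervals with both endpoints in $\Omega_h^+$ (resp. $\Omega_h^-$); $\mathcal I_h^c$ is the set of cut intervals, having one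 endpoint in each. $\Delta_h$ is the standard $(2d+1)$-point discrete Laplacian, $\Delta_hu(x)=h^{-2}\sum_\nu(u(x+he_\nu)+u(x-he_\nu)-2u(x))$; equations for $\Delta_h$ are imposed at grid points not in $\partial B_h$. **Discrete functions.** Fix $\delta\in(0,\tfrac12]$ independent of $h$. $\Gamma_h^1$ is a set consisting of one chosen point $x_I^1\in I$ for each $I\in\mathcal I_h^c$, at distance at least $\delta h$ from both endpoints of $I$ (not necessarily on $\Gamma$). $\mathcal F(\Gamma_h^1)$ is the space of real functions on $\Gamma_h^1$ (equivalently, on $\mathcal I_h^c$). $\mathcal F(\overline{\Omega_h^+})$ is the space of functions $u$ consisting of one value $u(x)$ for each $x\in\Omega_h^+$ together with, for each $I\in\mathcal I_h^c$, an extended value at the endpoint of $I$ in $\Omega_h^-$ (different intervals with the same endpoint may have different extended values there). $\mathcal F(\overline{\Omega_h^-})$ is defined in the same way with $\Omega_h^+,\Omega_h^-$ interchanged, with the additional requirement that functions vanish on $\partial B_h$. In any difference or formula involving a cut interval $I$ the extended value is the one belonging to $I$; in particular in $\Delta_hu(x)$ the value at a neighbour $y$ of $x$ across $\Gamma$ is that belonging to $[x,y]$. For $I=[x,x+he_\nu]$ write $(D_\nu u)_I=(u(x+he_\nu)-u(x))/h$. If $I\in\mathcal I_h^c$ and $x_I^1=x+she_\nu$, put $(Mu)_I=(1-s)u(x)+s\,u(x+he_\nu)$, so $Mu\in\mathcal F(\Gamma_h^1)$, and $\xi^\nu_I=s$ if $x\in\Omega_h^+$, $\xi_I^\nu=1-s$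 if $x+he_\nu\in\Omega_h^+$; $\xi^\nu=1$ on $\mathcal I_h^+$ and $\xi^\nu=0$ on $\mathcal I_h^-$. **Inner product on $\mathcal F(\Gamma_h^1)$** ($h$ sufficiently small). For $\psi\in\mathcal F(\Gamma_h^1)$ the single layer $S\psi=v^\pm$ is the unique pair $v^\pm\in\mathcal F(\overline{\Omega_h^\pm})$ with $\Delta_hv^+=0$ on $\Omega_h^+$, $\Delta_hv^-=0$ on $\Omega_h^-\setminus\partial B_h$, and $Mv^+=Mv^-=\psi$. If $v^\pm=S\psi$, $z^\pm=S\zeta$, then $$(\psi,\zeta)=\sum_{I\in\mathcal I_h^+\cup\mathcal I_h^c}(D_\nu v^+)_I(D_\nu z^+)_I\,\xi_I^\nu h^d+\sum_{I\in\mathcal I_h^-\cup\mathcal I_h^c}(D_\nu v^-)_I(D_\nu z^-)_I(1-\xi_I^\nu)h^d,$$ $\nu$ being the direction of $I$. **The operators $\mathcal A,\mathcal B$** ($h$ sufficiently small). For $\varphi\in\mathcal F(\Gamma_h^1)$ the discrete double layer potential is the unique pair $u^+\in\mathcal F(\overline{\Omega_h^+})$, $u^-\in\mathcal F(\overline{\Omega_h^-})$ with $\Delta_hu^+=0$ on $\Omega_h^+$, $\Delta_hu^-=0$ on $\Omega_h^-\setminus\partial B_h$, $Mu^+-Mu^-=\varphi$ on $\Gamma_h^1$, and $(D_\nu u^+)_I=(D_\nu u^-)_I$ for every $I\in\mathcal I_h^c$ (and $u^-=0$ on $\partial B_h$). Define $\mathcal A\varphi=Mu^+$ and $\mathcal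 B\varphi=Mu^-$. *)

theory Defs
  imports "HOL-Analysis.Analysis"
begin

section \<open>Domains with \<open>C\<^sup>2\<close> boundary\<close>

definition C2_function :: "(real^'n \<Rightarrow> real) \<Rightarrow> bool" where
  "C2_function f \<longleftrightarrow>
     (\<exists>(g :: real^'n \<Rightarrow> real^'n) (H :: real^'n \<Rightarrow> real^'n^'n).
        (\<forall>x. (f has_derivative (\<lambda>v. g x \<bullet> v)) (at x)) \<and>
        (\<forall>x. (g has_derivative (\<lambda>v. H x *v v)) (at x)) \<and>
        continuous_on UNIV H)"

text \<open>Near each boundary point the open set is, up to relabelling and reflecting the coordinate
  axes, the region above the graph of a \<open>C\<^sup>2\<close> function of the other \<open>d - 1\<close> coordinates. Such a
  function is encoded as a function on the whole space that does not depend on coordinate \<open>k\<close>.\<close>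

definition C2_boundary :: "(real^'n) set \<Rightarrow> bool" where
  "C2_boundary S \<longleftrightarrow>
     (\<forall>p \<in> frontier S. \<exists>\<rho>>0. \<exists>k. \<exists>\<sigma>\<in>{1, -1}. \<exists>\<gamma>.
        C2_function \<gamma> \<and> (\<forall>x t. \<gamma> (x + t *\<^sub>R axis k 1) = \<gamma> x) \<and>
        S \<inter> ball p \<rho> = {x \<in> ball p \<rho>. \<sigma> * x $ k > \<gamma> x})"


section \<open>Grid and discrete functions\<close>

text \<open>The pair \<open>(x, \<nu>)\<close> stands for the segment from \<open>x\<close> to \<open>x + h e\<^sub>\<nu>\<close>.\<close>
type_synonym 'n grid_interval = "(real^'n) \<times> 'n"

text \<open>A discrete function on one side of the interface: its values at the grid points of that side,
  and for each cut interval the extended value at the endpoint lying on the other side.\<close>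
type_synonym 'n side_function = "(real^'n \<Rightarrow> real) \<times> ('n grid_interval \<Rightarrow> real)"

definition admissible_grid_size :: "real^'n \<Rightarrow> real^'n \<Rightarrow> real \<Rightarrow> bool" where
  "admissible_grid_size a b h \<longleftrightarrow> 0 < h \<and> (\<forall>i. a $ i / h \<in> \<int> \<and> b $ i / h \<in> \<int>)"

text \<open>\<open>\<Omega>\<close> is the inner domain \<open>\<Omega>\<^sup>+\<close>, \<open>B\<close> the open box, and \<open>X I\<close> the point chosen on the cut
  interval \<open>I\<close>. The locale carries no assumptions, so the definitions below are unconditional.\<close>

locale interface_grid =
  fixes \<Omega> B :: "(real^'n::finite) set" and h :: real and X :: "'n grid_interval \<Rightarrow> real^'n"
begin

definition grid_pts :: "(real^'n) set" where
  "grid_pts = (\<lambda>z. h *\<^sub>R z) ` {z. \<forall>i. z $ i \<in> \<int>} \<inter> closure B"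

definition bdry_pts :: "(real^'n) set" where
  "bdry_pts = grid_pts \<inter> frontier B"

definition pts_plus :: "(real^'n) set" where
  "pts_plus = \<Omega> \<inter> grid_pts"

definition pts_minus :: "(real^'n) set" where
  "pts_minus = grid_pts - \<Omega>"

definition lower :: "'n grid_interval \<Rightarrow> real^'n" where
  "lower I = fst I"

definition upper :: "'n grid_interval \<Rightarrow> real^'n" where
  "upper I = fst I + h *\<^sub>R axis (snd I) 1"

definition intervals_plus :: "'n grid_interval set" where
  "intervals_plus = {I. lower I \<in> pts_plus \<and> upper I \<in> pts_plus}"

definition intervals_minus :: "'n grid_interval set" where
  "intervals_minus = {I. lower I \<in> pts_minus \<and> upper I \<in> pts_minus}"

definition intervals_cut :: "'n grid_interval set" where
  "intervals_cut = {I. lower I \<in> pts_plus \<and> upper I \<in> pts_minus \<or>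
                       lower I \<in> pts_minus \<and> upper I \<in> pts_plus}"

definition chosen_points_ok :: "real \<Rightarrow> bool" where
  "chosen_points_ok \<delta> \<longleftrightarrow>
     (\<forall>I\<in>intervals_cut. X I \<in> closed_segment (lower I) (upper I) \<and>
        dist (X I) (lower I) \<ge> \<delta> * h \<and> dist (X I) (upper I) \<ge> \<delta> * h)"

text \<open>Functions on a finite index set are represented by functions vanishing outside that set.\<close>

definition F_gamma :: "('n grid_interval \<Rightarrow> real) set" where
  "F_gamma = {\<psi>. \<forall>I. I \<notin> intervals_cut \<longrightarrow> \<psi> I = 0}"

definition F_plus :: "'n side_function set" where
  "F_plus = {(u, e). (\<forall>x. x \<notin> pts_plus \<longrightarrow> u x = 0) \<and> e \<in> F_gamma}"

definition F_minus :: "'n side_function set" where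
  "F_minus = {(u, e). (\<forall>x. x \<notin> pts_minus \<longrightarrow> u x = 0) \<and> e \<in> F_gamma \<and>
                      (\<forall>x\<in>bdry_pts. u x = 0)}"

text \<open>The value at the endpoint \<open>y\<close> of the interval \<open>I\<close>, for a function \<open>u\<close> living on the side whose
  grid points are \<open>P\<close>: across the interface it is the extended value belonging to \<open>I\<close>.\<close>

definition end_value :: "(real^'n) set \<Rightarrow> 'n side_function \<Rightarrow> 'n grid_interval \<Rightarrow> real^'n \<Rightarrow> real" where
  "end_value P u I y = (if y \<in> P then fst u y else snd u I)"

definition lap :: "(real^'n) set \<Rightarrow> 'n side_function \<Rightarrow> real^'n \<Rightarrow> real" where
  "lap P u x = (\<Sum>\<nu>\<in>UNIV.
       end_value P u (x, \<nu>) (x + h *\<^sub>R axis \<nu> 1)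
     + end_value P u (x - h *\<^sub>R axis \<nu> 1, \<nu>) (x - h *\<^sub>R axis \<nu> 1)
     - 2 * fst u x) / h\<^sup>2"

definition D :: "(real^'n) set \<Rightarrow> 'n side_function \<Rightarrow> 'n grid_interval \<Rightarrow> real" where
  "D P u I = (end_value P u I (upper I) - end_value P u I (lower I)) / h"

text \<open>The \<open>s\<close> with \<open>X I = x + s h e\<^sub>\<nu>\<close>.\<close>

definition frac_pos :: "'n grid_interval \<Rightarrow> real" where
  "frac_pos I = (X I $ snd I - lower I $ snd I) / h"

definition M :: "(real^'n) set \<Rightarrow> 'n side_function \<Rightarrow> 'n grid_interval \<Rightarrow> real" where
  "M P u I = (if I \<in> intervals_cut
     then (1 - frac_pos I) * end_value P u I (lower I) + frac_pos I * end_value P u I (upper I)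
     else 0)"

definition xi :: "'n grid_interval \<Rightarrow> real" where
  "xi I = (if I \<in> intervals_plus then 1
           else if I \<in> intervals_minus then 0
           else if lower I \<in> pts_plus then frac_pos I
           else 1 - frac_pos I)"

definition discrete_harmonic_pair :: "'n side_function \<times> 'n side_function \<Rightarrow> bool" where
  "discrete_harmonic_pair = (\<lambda>(u, v). u \<in> F_plus \<and> v \<in> F_minus \<and>
     (\<forall>x\<in>pts_plus. lap pts_plus u x = 0) \<and>
     (\<forall>x\<in>pts_minus - bdry_pts. lap pts_minus v x = 0))"


section \<open>Single layer and inner product\<close>

definition is_single_layer ::
    "('n grid_interval \<Rightarrow> real) \<Rightarrow> 'n side_function \<times> 'n side_function \<Rightarrow> bool" where
  "is_single_layer \<psi> = (\<lambda>(u, v). discrete_harmonic_pair (u, v) \<and>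
     M pts_plus u = \<psi> \<and> M pts_minus v = \<psi>)"

definition single_layer ::
    "('n grid_interval \<Rightarrow> real) \<Rightarrow> 'n side_function \<times> 'n side_function" where
  "single_layer \<psi> = (THE p. is_single_layer \<psi> p)"

definition ip :: "('n grid_interval \<Rightarrow> real) \<Rightarrow> ('n grid_interval \<Rightarrow> real) \<Rightarrow> real" where
  "ip \<psi> \<zeta> = (let (vp, vm) = single_layer \<psi>; (zp, zm) = single_layer \<zeta> in
     (\<Sum>I\<in>intervals_plus \<union> intervals_cut.
        D pts_plus vp I * D pts_plus zp I * xi I * h ^ CARD('n)) +
     (\<Sum>I\<in>intervals_minus \<union> intervals_cut.
        D pts_minus vm I * D pts_minus zm I * (1 - xi I) * h ^ CARD('n)))"

definition nrm :: "('n grid_interval \<Rightarrow> real) \<Rightarrow> real" where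
  "nrm \<psi> = sqrt (ip \<psi> \<psi>)"


section \<open>Double layer and the operators \<open>\<A>\<close>, \<open>\<B>\<close>\<close>

definition is_double_layer ::
    "('n grid_interval \<Rightarrow> real) \<Rightarrow> 'n side_function \<times> 'n side_function \<Rightarrow> bool" where
  "is_double_layer \<phi> = (\<lambda>(u, v). discrete_harmonic_pair (u, v) \<and>
     (\<forall>I\<in>intervals_cut. M pts_plus u I - M pts_minus v I = \<phi> I) \<and>
     (\<forall>I\<in>intervals_cut. D pts_plus u I = D pts_minus v I))"

definition double_layer ::
    "('n grid_interval \<Rightarrow> real) \<Rightarrow> 'n side_function \<times> 'n side_function" where
  "double_layer \<phi> = (THE p. is_double_layer \<phi> p)"

definition calA :: "('n grid_interval \<Rightarrow> real) \<Rightarrow> 'n grid_interval \<Rightarrow> real" where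
  "calA \<phi> = M pts_plus (fst (double_layer \<phi>))"

definition calB :: "('n grid_interval \<Rightarrow> real) \<Rightarrow> 'n grid_interval \<Rightarrow> real" where
  "calB \<phi> = M pts_minus (snd (double_layer \<phi>))"


section \<open>Operators on \<open>\<F>(\<Gamma>\<^sub>h\<^sup>1)\<close>\<close>

definition symmetric_op ::
    "(('n grid_interval \<Rightarrow> real) \<Rightarrow> 'n grid_interval \<Rightarrow> real) \<Rightarrow> bool" where
  "symmetric_op T \<longleftrightarrow> (\<forall>\<psi>\<in>F_gamma. \<forall>\<zeta>\<in>F_gamma. ip (T \<psi>) \<zeta> = ip \<psi> (T \<zeta>))"

text \<open>The supremum is taken in the extended reals so that it is meaningful without knowing
  boundedness beforehand.\<close>

definition op_norm ::
    "(('n grid_interval \<Rightarrow> real) \<Rightarrow> 'n grid_interval \<Rightarrow> real) \<Rightarrow> ereal" where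
  "op_norm T = (SUP \<psi>\<in>{\<psi> \<in> F_gamma. nrm \<psi> \<le> 1}. ereal (nrm (T \<psi>)))"

definition op_spectrum ::
    "(('n grid_interval \<Rightarrow> real) \<Rightarrow> 'n grid_interval \<Rightarrow> real) \<Rightarrow> real set" where
  "op_spectrum T = {\<mu>. \<not> bij_betw (\<lambda>\<psi> I. T \<psi> I - \<mu> * \<psi> I) F_gamma F_gamma}"

end

end

theory Submission
  imports Defs "HOL-Library.Function_Algebras"
begin

text \<open>
  Let \<open>e\<^sub>+\<close> and \<open>e\<^sub>-\<close> be the Dirichlet forms of the two components of the single layer, so that the
  inner product is \<open>e\<^sub>+ + e\<^sub>-\<close> up to a power of \<open>h\<close>. By Green's identity each is represented by a
  symmetric Dirichlet-to-Neumann map \<open>N\<^sub>\<plusminus>\<close> (\<open>dtn\<close> below), and the double layer satisfies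
  \<open>(N\<^sub>+ + N\<^sub>-) \<B> \<phi> = - N\<^sub>+ \<phi>\<close>. Hence \<open>(\<B> \<phi>, \<zeta>) = - e\<^sub>+(\<phi>, \<zeta>)\<close>, and by Cauchy-Schwarz for \<open>e\<^sub>+\<close> all claims
  follow from \<open>e\<^sub>+ \<le> C e\<^sub>-\<close> with \<open>C\<close> independent of \<open>h\<close>.

  By the Dirichlet principle that estimate reduces to extending a grid function from outside
  \<open>\<Omega>\<close> to the whole grid with control of the energy. Near a boundary point the grid
  function is reflected along the coordinate axis over which the boundary is a graph; cutoff
  functions reduce the general case to this one, at the cost of a discrete Poincare inequality.
  The latter is spread through the connected exterior, starting outside the box, by translations
  along the axes.
\<close>

section \<open>Linear algebra on finitely supported functions\<close>

text \<open>The comparison goes in one direction only. Constants on the interface have zero interior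
  energy, so in general no bound of \<open>e\<^sub>-\<close> by \<open>e\<^sub>+\<close> exists, and
  1 is the natural upper end of the spectrum; in the exterior, the zero values on the boundary of
  the box make a Poincare inequality available. From \<open>e\<^sub>+ \<le> C e\<^sub>-\<close> one
  gets \<open>e\<^sub>+ \<le> r (e\<^sub>+ + e\<^sub>-)\<close> with \<open>r = C / (1 + C)\<close>.

  The obstacle is uniformity in \<open>h\<close>: the interface is not aligned with the lattice, and
  a smooth map flattening the boundary does not send lattice points to lattice points. Every move is
  therefore a whole number of steps along one axis. In each column the reflection is rounded to the
  lattice; mirror images of neighbouring columns may then lie at different depths, but the Lipschitz
  constant of the boundary graph bounds the mismatch by a number of edges independent of
  \<open>h\<close>. The position of the chosen points on the cut intervals enters the comparison
  only through the lower bound \<delta> for the interpolation weights.\<close>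

lemma finite_support_linear_surj:
  fixes T :: "('a \<Rightarrow> real) \<Rightarrow> 'a \<Rightarrow> real"
  assumes fin: "finite S"
    and lin: "\<And>c f g i. T (\<lambda>x. c * f x + g x) i = c * T f i + T g i"
    and inj: "\<And>f. (\<And>i. i \<notin> S \<Longrightarrow> f i = 0) \<Longrightarrow> (\<And>i. i \<in> S \<Longrightarrow> T f i = 0) \<Longrightarrow> f = (\<lambda>_. 0)"
  shows "\<exists>f. (\<forall>i. i \<notin> S \<longrightarrow> f i = 0) \<and> (\<forall>i\<in>S. T f i = b i)"
proof -
  define sc :: "real \<Rightarrow> ('a \<Rightarrow> real) \<Rightarrow> 'a \<Rightarrow> real" where "sc = (\<lambda>c f x. c * f x)"
  interpret V: vector_space sc
    by unfold_locales (auto simp: sc_def plus_fun_def algebra_simps)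
  interpret VV: vector_space_pair sc sc ..
  define e :: "'a \<Rightarrow> 'a \<Rightarrow> real" where "e = (\<lambda>i j. if j = i then 1 else 0)"
  \<comment> \<open>Only the values of \<open>T f\<close> on \<open>S\<close> are prescribed, so
    truncation turns \<open>T\<close> into an endomorphism of the span of the unit functions at
    \<open>S\<close>, where injectivity gives surjectivity by counting dimensions.\<close>
  define U where "U f = (\<lambda>i. if i \<in> S then T f i else 0)" for f
  have T0: "T (\<lambda>_. 0) i = 0" for i
    using lin[of 1 "\<lambda>_. 0" "\<lambda>_. 0" i] by simp
  have linU: "Vector_Spaces.linear sc sc U"
  proof -
    have "U (f + g) = U f + U g" for f g
      using lin[of 1 f g] by (auto simp: U_def plus_fun_def)
    moreover have "U (sc c f) = sc c (U f)" for c f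
      using lin[of c f "\<lambda>_. 0"] T0 by (auto simp: U_def sc_def)
    ultimately show ?thesis
      unfolding Vector_Spaces.linear_iff using V.vector_space_axioms by blast
  qed
  have span: "f \<in> V.span (e ` S)" if "\<And>i. i \<notin> S \<Longrightarrow> f i = 0" for f
  proof -
    have "f = (\<Sum>i\<in>S. sc (f i) (e i))"
    proof
      fix x
      have "(\<Sum>i\<in>S. sc (f i) (e i)) x = (\<Sum>i\<in>S. f i * e i x)"
        using fin by (induction S rule: finite_induct) (auto simp: sc_def)
      also have "\<dots> = (\<Sum>i\<in>S. if i = x then f i else 0)"
        by (intro sum.cong) (auto simp: e_def)
      also have "\<dots> = f x" using fin that[of x] by (auto simp: sum.delta)
      finally show "f x = (\<Sum>i\<in>S. sc (f i) (e i)) x" ..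
    qed
    moreover have "(\<Sum>i\<in>S. sc (f i) (e i)) \<in> V.span (e ` S)"
      by (intro V.span_sum V.span_scale V.span_base) auto
    ultimately show ?thesis by simp
  qed
  have supp: "f i = 0" if "f \<in> V.span (e ` S)" "i \<notin> S" for f i
  proof -
    have "V.subspace {f. f i = 0}"
      unfolding V.subspace_def by (auto simp: sc_def)
    moreover have "e ` S \<subseteq> {f. f i = 0}" using that(2) by (auto simp: e_def)
    ultimately show ?thesis using V.span_minimal that(1) by blast
  qed
  have injU: "inj_on U (V.span (e ` S))"
  proof (subst VV.linear_inj_on_iff_eq_0[OF linU])
    show "V.subspace (V.span (e ` S))" by (rule V.subspace_span)
    show "\<forall>x\<in>V.span (e ` S). U x = 0 \<longrightarrow> x = 0"
    proof (intro ballI impI)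
      fix f assume f: "f \<in> V.span (e ` S)" "U f = 0"
      have "T f i = 0" if "i \<in> S" for i
        using fun_cong[OF f(2), of i] that by (simp add: U_def)
      with inj[of f] supp[OF f(1)] show "f = 0" by (auto simp: fun_eq_iff)
    qed
  qed
  have inje: "inj_on e S" by (auto simp: inj_on_def e_def fun_eq_iff split: if_splits)
  have indep: "V.independent (e ` S)"
    unfolding V.independent_explicit_finite_subsets
  proof (intro allI impI ballI)
    fix A u v assume A: "A \<subseteq> e ` S" "finite A" "(\<Sum>v\<in>A. sc (u v) v) = 0" "v \<in> A"
    then obtain i where i: "i \<in> S" "v = e i" by auto
    have "(\<Sum>w\<in>A. sc (u w) w) i = (\<Sum>w\<in>A. u w * w i)"
      using A(2) by (induction A rule: finite_induct) (auto simp: sc_def)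
    also have "\<dots> = (\<Sum>w\<in>A. if w = v then u w else 0)"
    proof (intro sum.cong refl)
      fix w assume "w \<in> A"
      then obtain j where "w = e j" using A(1) by auto
      then show "u w * w i = (if w = v then u w else 0)"
        using i(2) by (cases "i = j") (auto simp: e_def fun_eq_iff)
    qed
    also have "\<dots> = u v" using A by simp
    finally show "u v = 0" using A(3) by simp
  qed
  have indU: "V.independent (U ` e ` S)"
    by (rule VV.linear_independent_injective_image[OF linU indep injU])
  have cardU: "card (U ` e ` S) = card (e ` S)"
    by (rule card_image) (meson injU inj_on_subset V.span_superset)
  define b' where "b' = (\<lambda>i. if i \<in> S then b i else 0)"
  have b': "b' \<in> V.span (U ` e ` S)"
  proof (rule ccontr)
    assume n: "b' \<notin> V.span (U ` e ` S)"
    then have "V.independent (insert b' (U ` e ` S))"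
      using indU V.independent_insert by (metis V.span_base)
    moreover have "insert b' (U ` e ` S) \<subseteq> V.span (e ` S)"
      by (auto intro!: span simp: b'_def U_def)
    ultimately have "card (insert b' (U ` e ` S)) \<le> card (e ` S)"
      using V.independent_span_bound[of "e ` S"] fin by auto
    moreover have "b' \<notin> U ` e ` S" using n V.span_superset[of "U ` e ` S"] by auto
    ultimately show False using fin cardU by simp
  qed
  then obtain f where f: "f \<in> V.span (e ` S)" "b' = U f"
    using VV.linear_span_image[OF linU, of "e ` S"] by auto
  have "T f i = b i" if "i \<in> S" for i
    using fun_cong[OF f(2), of i] that by (simp add: b'_def U_def)
  with supp[OF f(1)] show ?thesis by blast
qed

section \<open>A discrete Poincare inequality outside the domain\<close>

text \<open>The full lattice, not cut off by the box: translations and reflections must not run out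
  of it.\<close>

definition grid_lattice :: "real \<Rightarrow> (real^'n) set" where
  "grid_lattice h = (\<lambda>z. h *\<^sub>R z) ` {z. \<forall>i. z $ i \<in> \<int>}"

definition edges :: "real \<Rightarrow> (real^'n) set \<Rightarrow> ((real^'n) \<times> 'n) set" where
  "edges h S = {(x, i). x \<in> grid_lattice h \<and> x \<in> S \<and> x + h *\<^sub>R axis i 1 \<in> S}"

definition dsq :: "real \<Rightarrow> (real^'n \<Rightarrow> real) \<Rightarrow> (real^'n) \<times> 'n \<Rightarrow> real" where
  "dsq h v I = (v (fst I + h *\<^sub>R axis (snd I) 1) - v (fst I))\<^sup>2"

text \<open>The sets in question, \<open>- \<Omega>\<close> and \<open>UNIV\<close>, contain
  infinitely many lattice points; bounding all finite partial sums avoids questions of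
  summability.\<close>

definition energy_le :: "real \<Rightarrow> (real^'n) set \<Rightarrow> (real^'n \<Rightarrow> real) \<Rightarrow> real \<Rightarrow> bool" where
  "energy_le h S v K \<longleftrightarrow> (\<forall>J. finite J \<longrightarrow> J \<subseteq> edges h S \<longrightarrow> (\<Sum>I\<in>J. dsq h v I) \<le> K)"

definition mass_le :: "real \<Rightarrow> (real^'n) set \<Rightarrow> (real^'n \<Rightarrow> real) \<Rightarrow> real \<Rightarrow> bool" where
  "mass_le h S v K \<longleftrightarrow> (\<forall>Y. finite Y \<longrightarrow> Y \<subseteq> grid_lattice h \<inter> S \<longrightarrow> (\<Sum>y\<in>Y. (v y)\<^sup>2) \<le> K)"

lemma energy_leD: "energy_le h S v K \<Longrightarrow> finite J \<Longrightarrow> J \<subseteq> edges h S \<Longrightarrow> (\<Sum>I\<in>J. dsq h v I) \<le> K"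
  by (auto simp: energy_le_def)

lemma mass_leD: "mass_le h S v K \<Longrightarrow> finite Y \<Longrightarrow> Y \<subseteq> grid_lattice h \<inter> S \<Longrightarrow> (\<Sum>y\<in>Y. (v y)\<^sup>2) \<le> K"
  by (auto simp: mass_le_def)

lemma energy_le_nonneg: "energy_le h S v K \<Longrightarrow> 0 \<le> K"
  using energy_leD[of h S v K "{}"] by simp

lemma mass_le_mono: "mass_le h S v K \<Longrightarrow> T \<subseteq> S \<Longrightarrow> K \<le> L \<Longrightarrow> mass_le h T v L"
  unfolding mass_le_def by (meson Int_mono order.refl order_trans)

lemma energy_le_mono: "energy_le h S v K \<Longrightarrow> K \<le> L \<Longrightarrow> energy_le h S v L"
  unfolding energy_le_def by (meson order_trans)

lemma dsq_nonneg [simp]: "0 \<le> dsq h v I"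
  by (simp add: dsq_def)

section \<open>Lattice translations and chains of edges\<close>

lemma grid_lattice_shift:
  assumes "x \<in> grid_lattice h"
  shows "x + (of_int m * h) *\<^sub>R axis i 1 \<in> grid_lattice h"
proof -
  obtain z where z: "x = h *\<^sub>R z" "\<forall>i. z $ i \<in> \<int>" using assms by (auto simp: grid_lattice_def)
  have "x + (of_int m * h) *\<^sub>R axis i 1 = h *\<^sub>R (z + of_int m *\<^sub>R axis i 1)"
    by (simp add: z(1) algebra_simps)
  moreover have "\<forall>j. (z + of_int m *\<^sub>R axis i 1) $ j \<in> \<int>"
    using z(2) by (auto simp: axis_def)
  ultimately show ?thesis by (auto simp: grid_lattice_def)
qed

lemma grid_lattice_shift_nat:
  assumes "x \<in> grid_lattice h" "s \<in> {1, -1::real}"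
  shows "x + (s * real m * h) *\<^sub>R axis i 1 \<in> grid_lattice h"
  using grid_lattice_shift[OF assms(1), of "int m" i] grid_lattice_shift[OF assms(1), of "- int m" i] assms(2)
  by auto

lemma grid_lattice_step:
  assumes "x \<in> grid_lattice h"
  shows "x + h *\<^sub>R axis i 1 \<in> grid_lattice h" "x - h *\<^sub>R axis i 1 \<in> grid_lattice h"
  using grid_lattice_shift[OF assms, of 1 i] grid_lattice_shift[OF assms, of "-1" i] by auto

lemma telescope_sq:
  fixes a :: "nat \<Rightarrow> real"
  shows "(a m - a 0)\<^sup>2 \<le> real m * (\<Sum>j<m. (a (Suc j) - a j)\<^sup>2)"
proof -
  have "(a m - a 0)\<^sup>2 = (\<Sum>j<m. a (Suc j) - a j)\<^sup>2"
    by (simp add: sum_lessThan_telescope)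
  also have "\<dots> \<le> (\<Sum>j<m. 1\<^sup>2) * (\<Sum>j<m. (a (Suc j) - a j)\<^sup>2)"
    using Cauchy_Schwarz_ineq_sum[of "\<lambda>_. 1" "\<lambda>j. a (Suc j) - a j" "{..<m}"] by simp
  finally show ?thesis by simp
qed

lemma sq_sum2_le: "((x::real) + y)\<^sup>2 \<le> 2 * x\<^sup>2 + 2 * y\<^sup>2"
  using sum_squares_bound[of x y] by (simp add: power2_sum)

text \<open>Each \<open>y\<close> is compared with its translate along a chain of \<open>m\<close>
  edges. One factor \<open>m\<close> comes from Cauchy-Schwarz on the chain, the other from the
  number of steps, each of which costs at most \<open>K\<close> in total.\<close>

lemma translate_mass:
  fixes v :: "real^'n \<Rightarrow> real"
  assumes E: "energy_le h S v K" and fin: "finite Y" and Y: "Y \<subseteq> grid_lattice h" and s: "s \<in> {1, -1}"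
    and path: "\<And>y j. y \<in> Y \<Longrightarrow> j \<le> m \<Longrightarrow> y + (s * real j * h) *\<^sub>R axis i 1 \<in> S"
  shows "(\<Sum>y\<in>Y. (v y)\<^sup>2) \<le>
    2 * (\<Sum>y\<in>Y. (v (y + (s * real m * h) *\<^sub>R axis i 1))\<^sup>2) + 2 * (real m)\<^sup>2 * K"
proof -
  define p where "p y j = y + (s * real j * h) *\<^sub>R axis i 1" for y :: "real^'n" and j
  \<comment> \<open>An edge is named by its lower endpoint, which is the newly reached point when
    walking in the negative direction.\<close>
  define I where "I j y = (if s = 1 then (p y j, i) else (p y (Suc j), i))" for y j
  have I: "I j y \<in> edges h S" "dsq h v (I j y) = (v (p y (Suc j)) - v (p y j))\<^sup>2"
    if "y \<in> Y" "j < m" for y j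
  proof -
    have L: "p y k \<in> grid_lattice h" for k
      using grid_lattice_shift_nat[of y h s k i] that Y s unfolding p_def by auto
    have S: "p y j \<in> S" "p y (Suc j) \<in> S"
      using path[of y j] path[of y "Suc j"] that by (auto simp: p_def)
    have st: "s = 1 \<Longrightarrow> p y j + h *\<^sub>R axis i 1 = p y (Suc j)"
      "s = -1 \<Longrightarrow> p y (Suc j) + h *\<^sub>R axis i 1 = p y j"
      by (auto simp: p_def algebra_simps)
    show "I j y \<in> edges h S" "dsq h v (I j y) = (v (p y (Suc j)) - v (p y j))\<^sup>2"
      using L S st s by (auto simp: I_def edges_def dsq_def power2_commute)
  qed
  \<comment> \<open>At a fixed step different starting points use different edges, so one step
    counts each edge at most once.\<close>
  have inj: "inj_on (I j) Y" for j
    by (auto simp: inj_on_def I_def p_def)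
  have step: "(\<Sum>y\<in>Y. (v (p y (Suc j)) - v (p y j))\<^sup>2) \<le> K" if "j < m" for j
  proof -
    have "(\<Sum>y\<in>Y. (v (p y (Suc j)) - v (p y j))\<^sup>2) = (\<Sum>J\<in>I j ` Y. dsq h v J)"
      using I(2) that by (simp add: sum.reindex[OF inj])
    also have "\<dots> \<le> K" using I(1) that fin by (intro energy_leD[OF E]) auto
    finally show ?thesis .
  qed
  have "(\<Sum>y\<in>Y. (v y)\<^sup>2) \<le> (\<Sum>y\<in>Y. 2 * (v (p y m))\<^sup>2 + 2 * (real m * (\<Sum>j<m. (v (p y (Suc j)) - v (p y j))\<^sup>2)))"
  proof (rule sum_mono)
    fix y
    have "(v y)\<^sup>2 = (v (p y m) + (v (p y 0) - v (p y m)))\<^sup>2" by (simp add: p_def)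
    also have "\<dots> \<le> 2 * (v (p y m))\<^sup>2 + 2 * (v (p y 0) - v (p y m))\<^sup>2" by (rule sq_sum2_le)
    also have "(v (p y 0) - v (p y m))\<^sup>2 \<le> real m * (\<Sum>j<m. (v (p y (Suc j)) - v (p y j))\<^sup>2)"
      using telescope_sq[of "\<lambda>j. v (p y j)" m] by (simp add: power2_commute)
    finally show "(v y)\<^sup>2 \<le> 2 * (v (p y m))\<^sup>2 + 2 * (real m * (\<Sum>j<m. (v (p y (Suc j)) - v (p y j))\<^sup>2))" by simp
  qed
  also have "\<dots> = 2 * (\<Sum>y\<in>Y. (v (p y m))\<^sup>2) + 2 * real m * (\<Sum>j<m. \<Sum>y\<in>Y. (v (p y (Suc j)) - v (p y j))\<^sup>2)"
    by (subst sum.swap) (simp add: sum.distrib sum_distrib_left mult.assoc)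
  also have "(\<Sum>j<m. \<Sum>y\<in>Y. (v (p y (Suc j)) - v (p y j))\<^sup>2) \<le> (\<Sum>j<m. K)"
    by (intro sum_mono step) auto
  finally show ?thesis by (simp add: p_def power2_eq_square mult_left_mono mult.assoc)
qed

text \<open>\<open>Q\<close> will be the closed box, off which the functions vanish. The constants
  may depend on \<open>p\<close>; compactness makes them uniform later. The factor
  \<open>1 / h\<^sup>2\<close> compensates for differences that are not divided by
  \<open>h\<close>.\<close>

definition poincare_near :: "(real^'n) set \<Rightarrow> (real^'n) set \<Rightarrow> real^'n \<Rightarrow> bool" where
  "poincare_near \<Omega> Q p \<longleftrightarrow> (\<exists>\<rho>>0. \<exists>C\<ge>0. \<exists>h0>0. \<forall>h v K. 0 < h \<longrightarrow> h \<le> h0 \<longrightarrow>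
     (\<forall>x. x \<notin> Q \<longrightarrow> v x = 0) \<longrightarrow> energy_le h (- \<Omega>) v K \<longrightarrow>
     mass_le h (ball p \<rho> - \<Omega>) v (C * K / h\<^sup>2))"

text \<open>A neighbourhood of \<open>p\<close> is carried along one axis into the good ball. The
  hypothesis \<open>path\<close> keeps the continuous segments outside \<Omega>, hence also the
  lattice chains on them.\<close>

lemma poincare_near_translate:
  fixes p :: "real^'n"
  assumes good: "poincare_near \<Omega> Q (p + t *\<^sub>R axis i 1)" and "\<rho>0 > 0"
    and path: "\<And>y \<tau>. y \<in> ball p \<rho>0 - \<Omega> \<Longrightarrow> 0 \<le> \<tau> \<Longrightarrow> \<tau> \<le> 1 \<Longrightarrow> y + (\<tau> * t) *\<^sub>R axis i 1 \<notin> \<Omega>"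
  shows "poincare_near \<Omega> Q p"
proof -
  obtain \<rho> C h0 where pos: "\<rho> > 0" "C \<ge> 0" "h0 > 0"
    and g: "\<And>h v K. 0 < h \<Longrightarrow> h \<le> h0 \<Longrightarrow> (\<forall>x. x \<notin> Q \<longrightarrow> v x = 0) \<Longrightarrow> energy_le h (- \<Omega>) v K \<Longrightarrow>
     mass_le h (ball (p + t *\<^sub>R axis i 1) \<rho> - \<Omega>) v (C * K / h\<^sup>2)"
    using good unfolding poincare_near_def by blast
  \<comment> \<open>Rounding the shift to whole steps displaces a point by less than
    \<open>h\<close>; half of the radius is reserved for this error.\<close>
  define \<rho>' where "\<rho>' = min \<rho>0 (\<rho>/2)"
  define h0' where "h0' = min h0 (\<rho>/2)"
  define s :: real where "s = (if t < 0 then -1 else 1)"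
  have s: "s \<in> {1, -1}" "s * \<bar>t\<bar> = t" "\<bar>s\<bar> = 1" by (auto simp: s_def)
  show ?thesis unfolding poincare_near_def
  proof (rule exI[of _ \<rho>'], rule conjI[rotated], rule exI[of _ "2 * C + 2 * t\<^sup>2"], rule conjI[rotated], rule exI[of _ h0'], rule conjI[rotated],
      intro conjI allI impI)
    show "\<rho>' > 0" "2 * C + 2 * t\<^sup>2 \<ge> 0" "h0' > 0"
      using pos \<open>\<rho>0 > 0\<close> by (auto simp: \<rho>'_def h0'_def)
    fix h v K
    assume h: "0 < h" "h \<le> h0'" and v: "\<forall>x. x \<notin> Q \<longrightarrow> v x = 0" and E: "energy_le h (- \<Omega>) v K"
    have "h \<le> h0" "h \<le> \<rho>/2" using h by (auto simp: h0'_def)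
    note g' = g[OF h(1) this(1) v E]
    \<comment> \<open>Rounding down keeps the chain inside the segment on which \<open>path\<close>
      is known.\<close>
    define m where "m = nat \<lfloor>\<bar>t\<bar> / h\<rfloor>"
    have "real m \<le> \<bar>t\<bar> / h" "\<bar>t\<bar> / h < real m + 1"
      using h(1) unfolding m_def by auto
    then have m: "real m * h \<le> \<bar>t\<bar>" "\<bar>t\<bar> - real m * h < h"
      using h(1) by (auto simp: field_simps)
    have K: "0 \<le> K" using E by (rule energy_le_nonneg)
    have m2: "(real m)\<^sup>2 \<le> t\<^sup>2 / h\<^sup>2"
    proof -
      have "(real m)\<^sup>2 \<le> (\<bar>t\<bar> / h)\<^sup>2"
        using \<open>real m \<le> \<bar>t\<bar> / h\<close> by (intro power_mono) auto
      then show ?thesis by (simp add: power_divide)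
    qed
    show "mass_le h (ball p \<rho>' - \<Omega>) v ((2 * C + 2 * t\<^sup>2) * K / h\<^sup>2)"
      unfolding mass_le_def
    proof (intro allI impI)
      fix Y assume Y: "finite Y" "Y \<subseteq> grid_lattice h \<inter> (ball p \<rho>' - \<Omega>)"
      define f where "f y = y + (s * real m * h) *\<^sub>R axis i 1" for y :: "real^'n"
      have pathj: "y + (s * real j * h) *\<^sub>R axis i 1 \<in> - \<Omega>" if "y \<in> Y" "j \<le> m" for y j
      proof (cases "t = 0")
        case True
        then have "m = 0" by (simp add: m_def)
        then show ?thesis using that Y(2) by auto
      next
        case False
        define \<tau> where "\<tau> = real j * h / \<bar>t\<bar>"
        have "real j * h \<le> \<bar>t\<bar>"
          using m(1) that(2) h(1) by (smt (verit) mult_right_mono of_nat_mono)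
        then have "0 \<le> \<tau>" "\<tau> \<le> 1" using False h(1) by (auto simp: \<tau>_def)
        moreover have "\<tau> * t = s * real j * h"
          using False s(2) by (auto simp: \<tau>_def s_def)
        ultimately show ?thesis using path[of y \<tau>] Y(2) that(1) by (auto simp: \<rho>'_def)
      qed
      have fin: "f ` Y \<subseteq> grid_lattice h \<inter> (ball (p + t *\<^sub>R axis i 1) \<rho> - \<Omega>)"
      proof safe
        fix y assume y: "y \<in> Y"
        show "f y \<in> grid_lattice h" using grid_lattice_shift_nat[of y h s m i] s y Y(2) by (auto simp: f_def)
        have "dist (p + t *\<^sub>R axis i 1) (f y) = norm ((p - y) + (t - s * real m * h) *\<^sub>R axis i (1::real))"
          by (simp add: f_def dist_norm algebra_simps)
        also have "\<dots> \<le> norm (p - y) + norm ((t - s * real m * h) *\<^sub>R axis i (1::real) :: real^'n)"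
          by (rule norm_triangle_ineq)
        also have "norm ((t - s * real m * h) *\<^sub>R axis i (1::real) :: real^'n) = \<bar>s * (\<bar>t\<bar> - real m * h)\<bar>"
          unfolding norm_scaleR using s(2) by (simp add: algebra_simps)
        also have "\<dots> < h" using m s(3) by (simp add: abs_mult)
        also have "norm (p - y) < \<rho>/2" using y Y(2) by (auto simp: \<rho>'_def dist_norm)
        finally show "f y \<in> ball (p + t *\<^sub>R axis i 1) \<rho>" using \<open>h \<le> \<rho>/2\<close> by simp
        assume "f y \<in> \<Omega>"
        then show False using pathj[OF y, of m] by (simp add: f_def)
      qed
      have "(\<Sum>y\<in>Y. (v y)\<^sup>2) \<le> 2 * (\<Sum>y\<in>Y. (v (f y))\<^sup>2) + 2 * (real m)\<^sup>2 * K"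
        unfolding f_def using Y by (intro translate_mass[OF E] s pathj) auto
      also have "(\<Sum>y\<in>Y. (v (f y))\<^sup>2) = (\<Sum>z\<in>f ` Y. (v z)\<^sup>2)"
        by (subst sum.reindex) (auto simp: inj_on_def f_def)
      also have "\<dots> \<le> C * K / h\<^sup>2" using Y(1) fin by (intro mass_leD[OF g']) auto
      also have "2 * (real m)\<^sup>2 * K \<le> 2 * (t\<^sup>2 / h\<^sup>2) * K"
        using m2 K by (intro mult_right_mono) auto
      finally show "(\<Sum>y\<in>Y. (v y)\<^sup>2) \<le> (2 * C + 2 * t\<^sup>2) * K / h\<^sup>2"
        using h(1) by (simp add: field_simps)
    qed
  qed
qed

text \<open>Part of the radius can be spent on moving the centre; this is the openness needed for
  the connectedness argument.\<close>

lemma poincare_near_open: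
  assumes "poincare_near \<Omega> Q p"
  shows "\<exists>\<rho>>0. \<forall>q\<in>ball p \<rho>. poincare_near \<Omega> Q q"
proof -
  obtain \<rho> C h0 where pos: "\<rho> > 0" "C \<ge> 0" "h0 > 0"
    and g: "\<And>h v K. 0 < h \<Longrightarrow> h \<le> h0 \<Longrightarrow> (\<forall>x. x \<notin> Q \<longrightarrow> v x = 0) \<Longrightarrow> energy_le h (- \<Omega>) v K \<Longrightarrow>
     mass_le h (ball p \<rho> - \<Omega>) v (C * K / h\<^sup>2)"
    using assms unfolding poincare_near_def by blast
  have "poincare_near \<Omega> Q q" if q: "q \<in> ball p \<rho>" for q
  proof -
    have sub: "ball q (\<rho> - dist p q) \<subseteq> ball p \<rho>"
      by (rule subsetI) (smt (verit) dist_triangle mem_ball)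
    show ?thesis unfolding poincare_near_def
    proof (rule exI[of _ "\<rho> - dist p q"], rule conjI[rotated], rule exI[of _ C], rule conjI[rotated], rule exI[of _ h0], rule conjI[rotated],
      intro conjI allI impI)
      fix h v K assume "0 < h" "h \<le> h0" "\<forall>x. x \<notin> Q \<longrightarrow> v x = 0" "energy_le h (- \<Omega>) v K"
      from g[OF this] show "mass_le h (ball q (\<rho> - dist p q) - \<Omega>) v (C * K / h\<^sup>2)"
        by (rule mass_le_mono) (use sub in auto)
    qed (use q pos in auto)
  qed
  then show ?thesis using pos(1) by blast
qed

text \<open>The coordinates of \<open>q\<close> are replaced by those of \<open>c\<close> one at a
  time. The mixed points \<open>z S\<close> are no farther from \<open>c\<close> than
  \<open>q\<close>, so they stay in the ball, and each move runs along one axis.\<close>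

lemma poincare_near_ball:
  fixes c q :: "real^'n"
  assumes sub: "ball c r \<subseteq> - \<Omega>" and q: "q \<in> ball c r" "poincare_near \<Omega> Q q"
  shows "poincare_near \<Omega> Q c"
proof -
  define z :: "'n set \<Rightarrow> real^'n" where "z S = (\<chi> i. if i \<in> S then c $ i else q $ i)" for S
  have zin: "z S \<in> ball c r" for S
  proof -
    have "norm (c - z S) \<le> norm (c - q)"
      by (rule norm_le_componentwise_cart) (auto simp: z_def)
    then show ?thesis using q(1) by (auto simp: dist_norm)
  qed
  have "poincare_near \<Omega> Q (z S)" for S
  proof (induction S rule: finite_induct[OF finite])
    case 1
    have "z {} = q" by (simp add: z_def vec_eq_iff)
    then show ?case using q(2) by simp
  next
    case (2 i S)
    define t where "t = q $ i - c $ i"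
    have zt: "z (insert i S) + t *\<^sub>R axis i 1 = z S"
      using 2(2) by (auto simp: z_def t_def vec_eq_iff axis_def)
    \<comment> \<open>With this radius the balls around both ends of the move lie in
      \<open>ball c r\<close>, and by convexity so do the segments between them.\<close>
    define \<rho> where "\<rho> = min (r - dist c (z S)) (r - dist c (z (insert i S)))"
    show ?case
    proof (rule poincare_near_translate)
      show "poincare_near \<Omega> Q (z (insert i S) + t *\<^sub>R axis i 1)" using 2(3) zt by simp
      show "\<rho> > 0" using zin[of S] zin[of "insert i S"] by (auto simp: \<rho>_def)
      fix y \<tau> assume y: "y \<in> ball (z (insert i S)) \<rho> - \<Omega>" and \<tau>: "0 \<le> \<tau>" "\<tau> \<le> (1::real)"
      define w where "w = y - z (insert i S)"
      have w: "norm w < \<rho>" using y by (auto simp: w_def dist_norm norm_minus_commute)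
      have 1: "z (insert i S) + w \<in> ball c r"
        using w norm_triangle_ineq[of "z (insert i S) - c" w]
        by (auto simp: \<rho>_def dist_norm norm_minus_commute algebra_simps)
      have 2: "z S + w \<in> ball c r"
        using w norm_triangle_ineq[of "z S - c" w]
        by (auto simp: \<rho>_def dist_norm norm_minus_commute algebra_simps)
      have "y + (\<tau> * t) *\<^sub>R axis i 1 = (1 - \<tau>) *\<^sub>R (z (insert i S) + w) + \<tau> *\<^sub>R (z S + w)"
        unfolding zt[symmetric] by (simp add: w_def algebra_simps)
      also have "\<dots> \<in> ball c r"
        using convex_ball[of c r] 1 2 \<tau> by (auto simp: convex_alt)
      finally show "y + (\<tau> * t) *\<^sub>R axis i 1 \<notin> \<Omega>" using sub by auto
    qed
  qed
  from this[of UNIV] show ?thesis by (simp add: z_def)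
qed

text \<open>Connectedness: the good points form an open set, and by
  \<open>poincare_near_ball\<close> the bad exterior points do too, so one good point makes the
  whole exterior good.\<close>

lemma poincare_near_exterior:
  fixes \<Omega> :: "(real^'n) set"
  assumes "connected (- closure \<Omega>)" "closure \<Omega> \<subseteq> Q" "compact Q" "p \<notin> closure \<Omega>"
  shows "poincare_near \<Omega> Q p"
proof -
  define G where "G = {p. poincare_near \<Omega> Q p}"
  have "open G" unfolding open_contains_ball G_def using poincare_near_open by blast
  have oW: "open (- closure \<Omega>)" by auto
  have "open (- closure \<Omega> - G)" unfolding open_contains_ball
  proof
    fix c assume c: "c \<in> - closure \<Omega> - G"
    then obtain r where r: "r > 0" "ball c r \<subseteq> - closure \<Omega>"
      using oW open_contains_ball by (metis Diff_iff)
    have "q \<notin> G" if "q \<in> ball c r" for q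
      using poincare_near_ball[of c r \<Omega> q Q] r that c closure_subset[of \<Omega>] by (auto simp: G_def)
    then show "\<exists>e>0. ball c e \<subseteq> - closure \<Omega> - G" using r by blast
  qed
  have "bounded Q" using \<open>compact Q\<close> by (rule compact_imp_bounded)
  then obtain c where c: "c \<notin> Q"
    using not_bounded_UNIV by (metis UNIV_eq_I)
  have "open (- Q)" using \<open>compact Q\<close> by (simp add: compact_imp_closed open_Compl)
  then obtain r where r: "r > 0" "ball c r \<subseteq> - Q"
    using c open_contains_ball by (metis ComplI)
  \<comment> \<open>Outside \<open>Q\<close> the functions vanish and the constant 0 works; this is
    where the zero boundary values enter.\<close>
  have "poincare_near \<Omega> Q c" unfolding poincare_near_def
  proof (rule exI[of _ r], rule conjI[rotated], rule exI[of _ 0], rule conjI[rotated], rule exI[of _ 1], rule conjI[rotated],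
      intro conjI allI impI)
    fix h v K assume v: "\<forall>x. x \<notin> Q \<longrightarrow> v x = (0::real)"
    show "mass_le h (ball c r - \<Omega>) v (0 * K / h\<^sup>2)"
      unfolding mass_le_def using v r(2) by (auto intro!: sum_nonpos)
  qed (use r in auto)
  then have "c \<in> G" "c \<in> - closure \<Omega>" using c assms(2) by (auto simp: G_def)
  have "p \<in> G"
  proof (rule ccontr)
    assume "p \<notin> G"
    have "- closure \<Omega> \<inter> G = {} \<or> - closure \<Omega> \<inter> (- closure \<Omega> - G) = {}"
      using connectedD[OF assms(1) \<open>open G\<close> \<open>open (- closure \<Omega> - G)\<close>] by blast
    then show False using \<open>c \<in> G\<close> \<open>c \<in> - closure \<Omega>\<close> \<open>p \<notin> G\<close> assms(4) by blast
  qed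
  then show ?thesis by (simp add: G_def)
qed

section \<open>Boundary points and graph charts\<close>

lemma C2_function_continuous:
  fixes \<gamma> :: "real^'n \<Rightarrow> real"
  shows "C2_function \<gamma> \<Longrightarrow> continuous_on UNIV \<gamma>"
  unfolding C2_function_def
  by (metis UNIV_I continuous_at_imp_continuous_on has_derivative_continuous)

lemma below_chart_not_closure:
  fixes \<gamma> :: "real^'n \<Rightarrow> real"
  assumes cont: "continuous_on UNIV \<gamma>"
    and chart: "\<Omega> \<inter> ball p \<rho> = {x \<in> ball p \<rho>. \<sigma> * x $ k > \<gamma> x}"
    and q: "q \<in> ball p \<rho>" "\<sigma> * q $ k < \<gamma> q"
  shows "q \<notin> closure \<Omega>"
proof -
  define U where "U = ball p \<rho> \<inter> {x. \<sigma> * x $ k < \<gamma> x}"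
  have "open U" unfolding U_def
    by (intro open_Int open_ball open_Collect_less continuous_intros cont)
  moreover have "q \<in> U" using q by (simp add: U_def)
  moreover have "U \<inter> \<Omega> = {}"
    using chart by (auto simp: U_def set_eq_iff) (smt (verit) mem_ball)
  ultimately show ?thesis by (metis disjoint_iff open_Int_closure_eq_empty)
qed

lemma C2_boundaryE:
  fixes \<Omega> :: "(real^'n) set"
  assumes "C2_boundary \<Omega>" "p \<in> frontier \<Omega>"
  obtains \<rho> \<sigma> \<gamma> k where "\<rho> > 0" "\<sigma> \<in> {1, -1}" "C2_function \<gamma>"
    "\<And>x t. \<gamma> (x + t *\<^sub>R axis k 1) = \<gamma> x"
    "\<Omega> \<inter> ball p \<rho> = {x \<in> ball p \<rho>. \<sigma> * x $ k > \<gamma> x}"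
proof -
  from assms have "\<exists>\<rho>>0. \<exists>k. \<exists>\<sigma>\<in>{1, -1}. \<exists>\<gamma>.
        C2_function \<gamma> \<and> (\<forall>x t. \<gamma> (x + t *\<^sub>R axis k 1) = \<gamma> x) \<and>
        \<Omega> \<inter> ball p \<rho> = {x \<in> ball p \<rho>. \<sigma> * x $ k > \<gamma> x}"
    unfolding C2_boundary_def by (rule bspec)
  then show thesis using that by blast
qed

text \<open>Boundary points are not reached by the connectedness argument, so they are pushed into
  the exterior along the chart axis. Since \<gamma> does not depend on that coordinate, moving away
  from \<Omega> along it never enters \<Omega>.\<close>

lemma poincare_near_frontier:
  fixes \<Omega> :: "(real^'n) set"
  assumes "open \<Omega>" "C2_boundary \<Omega>" "connected (- closure \<Omega>)" "closure \<Omega> \<subseteq> Q" "compact Q" "p \<in> frontier \<Omega>"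
  shows "poincare_near \<Omega> Q p"
proof -
  obtain \<rho> \<sigma> \<gamma> k where \<rho>: "\<rho> > 0" and \<sigma>: "\<sigma> \<in> {1, -1}" and C2: "C2_function \<gamma>"
    and inv: "\<And>x t. \<gamma> (x + t *\<^sub>R axis k 1) = \<gamma> x"
    and chart: "\<Omega> \<inter> ball p \<rho> = {x \<in> ball p \<rho>. \<sigma> * x $ k > \<gamma> x}"
    by (rule C2_boundaryE[OF assms(2,6)]) blast
  have cont: "continuous_on UNIV \<gamma>" by (rule C2_function_continuous[OF C2])
  have pO: "p \<notin> \<Omega>" using assms(1,6) by (simp add: frontier_def interior_open)
  then have gp: "\<sigma> * p $ k \<le> \<gamma> p" using chart \<rho> by (metis (mono_tags, lifting) Int_iff centre_in_ball linorder_not_le mem_Collect_eq)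
  \<comment> \<open>The sign makes the move point away from \<Omega>; half the chart radius leaves
    room for all points within \<open>\<rho>/2\<close> of \<open>p\<close>.\<close>
  define t where "t = - (\<sigma> * \<rho> / 2)"
  have \<sigma>t: "\<sigma> * t = - (\<rho>/2)" "\<bar>t\<bar> = \<rho>/2" using \<sigma> \<rho> by (auto simp: t_def)
  define q where "q = p + t *\<^sub>R axis k 1"
  have "q \<in> ball p \<rho>" "\<sigma> * q $ k < \<gamma> q"
    using \<rho> \<sigma>t gp inv by (auto simp: q_def dist_norm algebra_simps)
  then have "q \<notin> closure \<Omega>" by (rule below_chart_not_closure[OF cont chart])
  then have "poincare_near \<Omega> Q (p + t *\<^sub>R axis k 1)"
    using poincare_near_exterior[OF assms(3-5)] by (simp add: q_def)
  then show ?thesis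
  proof (rule poincare_near_translate)
    show "\<rho>/2 > 0" using \<rho> by simp
    fix y \<tau> assume y: "y \<in> ball p (\<rho>/2) - \<Omega>" and \<tau>: "0 \<le> \<tau>" "\<tau> \<le> (1::real)"
    have "y \<in> ball p \<rho>" using y \<rho> by auto
    then have yg: "\<sigma> * y $ k \<le> \<gamma> y" using chart y by (metis (mono_tags, lifting) DiffD2 Int_iff linorder_not_le mem_Collect_eq)
    define z where "z = y + (\<tau> * t) *\<^sub>R axis k 1"
    have "\<bar>\<tau> * t\<bar> \<le> \<rho>/2" using \<tau>(1,2) \<rho> mult_right_mono[of \<tau> 1 "\<rho>/2"] unfolding abs_mult \<sigma>t(2) by simp
    then have "dist y z \<le> \<rho>/2" by (simp add: z_def dist_norm)
    then have "z \<in> ball p \<rho>" using y dist_triangle[of p z y] by auto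
    moreover have "\<sigma> * z $ k \<le> \<gamma> z"
    proof -
      have "\<sigma> * z $ k = \<sigma> * y $ k - \<tau> * (\<rho>/2)"
      proof -
        have "\<sigma> * z $ k = \<sigma> * y $ k + \<tau> * (\<sigma> * t)" by (simp add: z_def algebra_simps)
        then show ?thesis unfolding \<sigma>t(1) by simp
      qed
      also have "\<dots> \<le> \<sigma> * y $ k" using \<tau> \<rho> by simp
      also have "\<dots> \<le> \<gamma> z" using yg inv by (simp add: z_def)
      finally show ?thesis .
    qed
    ultimately show "z \<notin> \<Omega>" using chart by (metis (mono_tags, lifting) Int_iff linorder_not_le mem_Collect_eq)
  qed
qed

text \<open>Compactness of \<open>Q - \<Omega>\<close> leaves finitely many local estimates, whose
  constants add up. Points off \<open>Q\<close> carry no mass.\<close>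

lemma discrete_poincare:
  fixes \<Omega> :: "(real^'n) set"
  assumes "open \<Omega>" "C2_boundary \<Omega>" "connected (- closure \<Omega>)" "closure \<Omega> \<subseteq> Q" "compact Q"
  shows "\<exists>C\<ge>0. \<exists>h0>0. \<forall>h v K. 0 < h \<longrightarrow> h \<le> h0 \<longrightarrow>
     (\<forall>x. x \<notin> Q \<longrightarrow> v x = 0) \<longrightarrow> energy_le h (- \<Omega>) v K \<longrightarrow> mass_le h (- \<Omega>) v (C * K / h\<^sup>2)"
proof -
  define P where "P T \<longleftrightarrow> (\<exists>C\<ge>0. \<exists>h0>0. \<forall>h v K. 0 < h \<longrightarrow> h \<le> h0 \<longrightarrow>
     (\<forall>x. x \<notin> Q \<longrightarrow> v x = 0) \<longrightarrow> energy_le h (- \<Omega>) v K \<longrightarrow> mass_le h (T - \<Omega>) v (C * K / h\<^sup>2))" for T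
  have un: "P (S \<union> T)" if "P S" "P T" for S T
  proof -
    obtain C h0 where pos: "C \<ge> 0" "h0 > 0"
     and g: "\<And>h v K. 0 < h \<Longrightarrow> h \<le> h0 \<Longrightarrow> (\<forall>x. x \<notin> Q \<longrightarrow> v x = 0) \<Longrightarrow> energy_le h (- \<Omega>) v K \<Longrightarrow>
       mass_le h (S - \<Omega>) v (C * K / h\<^sup>2)"
      using \<open>P S\<close> unfolding P_def by blast
    obtain C' h0' where pos': "C' \<ge> 0" "h0' > 0"
     and g': "\<And>h v K. 0 < h \<Longrightarrow> h \<le> h0' \<Longrightarrow> (\<forall>x. x \<notin> Q \<longrightarrow> v x = 0) \<Longrightarrow> energy_le h (- \<Omega>) v K \<Longrightarrow>
       mass_le h (T - \<Omega>) v (C' * K / h\<^sup>2)"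
      using \<open>P T\<close> unfolding P_def by blast
    show ?thesis unfolding P_def
    proof (rule exI[of _ "C + C'"], rule conjI[rotated], rule exI[of _ "min h0 h0'"], rule conjI[rotated],
      intro conjI allI impI)
      fix h v K assume h: "0 < h" "h \<le> min h0 h0'" and a: "\<forall>x. x \<notin> Q \<longrightarrow> v x = 0" "energy_le h (- \<Omega>) v K"
      show "mass_le h (S \<union> T - \<Omega>) v ((C + C') * K / h\<^sup>2)"
        unfolding mass_le_def
      proof (intro allI impI)
        fix Y assume Y: "finite Y" "Y \<subseteq> grid_lattice h \<inter> (S \<union> T - \<Omega>)"
        have "(\<Sum>y\<in>Y. (v y)\<^sup>2) = (\<Sum>y\<in>Y \<inter> S. (v y)\<^sup>2) + (\<Sum>y\<in>Y - S. (v y)\<^sup>2)"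
          using Y(1) by (metis sum.Int_Diff)
        also have "\<dots> \<le> C * K / h\<^sup>2 + C' * K / h\<^sup>2"
          using Y h by (intro add_mono mass_leD[OF g[OF _ _ a]] mass_leD[OF g'[OF _ _ a]]) auto
        finally show "(\<Sum>y\<in>Y. (v y)\<^sup>2) \<le> (C + C') * K / h\<^sup>2" by (simp add: algebra_simps add_divide_distrib)
      qed
    qed (use pos pos' in auto)
  qed
  have "\<exists>\<rho>>0. P (ball p \<rho>)" if "p \<in> Q - \<Omega>" for p
  proof -
    have "poincare_near \<Omega> Q p"
    proof (cases "p \<in> closure \<Omega>")
      case True
      then have "p \<in> frontier \<Omega>" using that assms(1) by (simp add: frontier_def interior_open)
      then show ?thesis by (rule poincare_near_frontier[OF assms])
    qed (rule poincare_near_exterior[OF assms(3-5)])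
    then show ?thesis unfolding poincare_near_def P_def by blast
  qed
  then obtain \<rho> where \<rho>: "\<And>p. p \<in> Q - \<Omega> \<Longrightarrow> \<rho> p > 0 \<and> P (ball p (\<rho> p))" by metis
  have cpt: "compact (Q - \<Omega>)" using assms(1,5) by (rule compact_diff[rotated])
  have cov: "Q - \<Omega> \<subseteq> (\<Union>p\<in>Q - \<Omega>. ball p (\<rho> p))" using \<rho> by force
  obtain D where D: "D \<subseteq> Q - \<Omega>" "finite D" "Q - \<Omega> \<subseteq> (\<Union>p\<in>D. ball p (\<rho> p))"
    by (rule compactE_image[OF cpt _ cov]) auto
  have P0: "P {}" unfolding P_def by (rule exI[of _ 0]) (auto simp: mass_le_def intro!: exI[of _ 1])
  have "P (\<Union>p\<in>D. ball p (\<rho> p))" using D(2,1)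
  proof (induction D rule: finite_induct)
    case (insert x F)
    then show ?case using un[of "ball x (\<rho> x)" "\<Union>p\<in>F. ball p (\<rho> p)"] \<rho>[of x] by auto
  qed (use P0 in auto)
  then obtain C h0 where pos: "C \<ge> 0" "h0 > 0"
    and g: "\<And>h v K. 0 < h \<Longrightarrow> h \<le> h0 \<Longrightarrow> (\<forall>x. x \<notin> Q \<longrightarrow> v x = 0) \<Longrightarrow> energy_le h (- \<Omega>) v K \<Longrightarrow>
       mass_le h ((\<Union>p\<in>D. ball p (\<rho> p)) - \<Omega>) v (C * K / h\<^sup>2)"
    unfolding P_def by metis
  show ?thesis
  proof (rule exI[of _ C], rule conjI[rotated], rule exI[of _ h0], rule conjI[rotated],
      intro conjI allI impI)
    fix h v K assume h: "0 < h" "h \<le> h0" and v: "\<forall>x. x \<notin> Q \<longrightarrow> v x = 0" and E: "energy_le h (- \<Omega>) v K"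
    show "mass_le h (- \<Omega>) v (C * K / h\<^sup>2)" unfolding mass_le_def
    proof (intro allI impI)
      fix Y assume Y: "finite Y" "Y \<subseteq> grid_lattice h \<inter> - \<Omega>"
      have "(\<Sum>y\<in>Y. (v y)\<^sup>2) = (\<Sum>y\<in>Y \<inter> Q. (v y)\<^sup>2)"
        using v Y(1) by (intro sum.mono_neutral_right) auto
      also have "\<dots> \<le> C * K / h\<^sup>2"
        using Y D(3) by (intro mass_leD[OF g[OF h v E]]) auto
      finally show "(\<Sum>y\<in>Y. (v y)\<^sup>2) \<le> C * K / h\<^sup>2" .
    qed
  qed (use pos in auto)
qed

section \<open>Extension by reflection in a boundary chart\<close>

text \<open>The gradient is continuous, hence bounded on the closed ball, and the ball is convex.
  All constants of the reflection derive from this Lipschitz constant.\<close>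

lemma C2_function_lipschitz_ball:
  fixes \<gamma> :: "real^'n \<Rightarrow> real"
  assumes "C2_function \<gamma>"
  obtains L where "L \<ge> 0" "\<And>x y. x \<in> ball p \<rho> \<Longrightarrow> y \<in> ball p \<rho> \<Longrightarrow> \<bar>\<gamma> x - \<gamma> y\<bar> \<le> L * dist x y"
proof -
  obtain g :: "real^'n \<Rightarrow> real^'n" and H :: "real^'n \<Rightarrow> real^'n^'n"
    where g: "\<And>x. (\<gamma> has_derivative (\<lambda>v. g x \<bullet> v)) (at x)"
    and H: "\<And>x. (g has_derivative (\<lambda>v. H x *v v)) (at x)"
    using assms unfolding C2_function_def by blast
  have "continuous_on (cball p \<rho>) g"
    by (rule continuous_at_imp_continuous_on) (use H has_derivative_continuous in blast)
  then have "bounded (g ` cball p \<rho>)"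
    by (intro compact_imp_bounded compact_continuous_image) auto
  then obtain L where L: "L > 0" "\<And>x. x \<in> cball p \<rho> \<Longrightarrow> norm (g x) \<le> L"
    unfolding bounded_pos by auto
  have "\<bar>\<gamma> x - \<gamma> y\<bar> \<le> L * dist x y" if "x \<in> ball p \<rho>" "y \<in> ball p \<rho>" for x y
  proof -
    have "norm (\<gamma> x - \<gamma> y) \<le> L * norm (x - y)"
    proof (rule differentiable_bound[of "ball p \<rho>" \<gamma> "\<lambda>x v. g x \<bullet> v"])
      fix z assume z: "z \<in> ball p \<rho>"
      show "onorm (\<lambda>v. g z \<bullet> v) \<le> L"
      proof (rule onorm_le)
        fix v
        have "norm (g z \<bullet> v) \<le> norm (g z) * norm v" by (simp add: Cauchy_Schwarz_ineq2)
        also have "\<dots> \<le> L * norm v" using L(2)[of z] z by (intro mult_right_mono) auto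
        finally show "norm (g z \<bullet> v) \<le> L * norm v" .
      qed
    qed (use that has_derivative_at_withinI[OF g] in auto)
    then show ?thesis by (simp add: dist_norm)
  qed
  with L(1) show thesis using that[of L] by simp
qed

text \<open>A frontier point is not above the graph because \<Omega> is open, and a point strictly
  below it has a neighbourhood that misses \<Omega>.\<close>

lemma chart_centre:
  fixes \<gamma> :: "real^'n \<Rightarrow> real"
  assumes "open \<Omega>" "p \<in> frontier \<Omega>" "\<rho> > 0" "continuous_on UNIV \<gamma>"
    and chart: "\<Omega> \<inter> ball p \<rho> = {x \<in> ball p \<rho>. \<sigma> * x $ k > \<gamma> x}"
  shows "\<gamma> p = \<sigma> * p $ k"
proof (rule antisym)
  show "\<gamma> p \<le> \<sigma> * p $ k"
    using below_chart_not_closure[OF assms(4) chart, of p] assms(2,3) by (force simp: frontier_def)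
  have "p \<notin> \<Omega>" using assms(1,2) by (simp add: frontier_def interior_open)
  then show "\<sigma> * p $ k \<le> \<gamma> p" using chart assms(3)
    by (metis (mono_tags, lifting) Int_iff centre_in_ball linorder_not_le mem_Collect_eq)
qed

text \<open>Origin of \<open>2 * L + 5\<close>: let \<open>r\<close> be the radius in
  \<open>supp\<close>. A mirror image in \<open>ball p r\<close> is at most
  \<open>(L + 1) * r\<close> below the graph, so the reflection has moved its point by at most
  \<open>2 * (L + 1) * r + h\<close>, which is at most \<open>(2 * L + 3) * r\<close>. The point is
  then within \<open>(2 * L + 4) * r = \<rho> - r\<close> of \<open>p\<close>, and the remaining
  \<open>r\<close> keeps its lattice neighbours in the chart.\<close>

locale reflection =
  fixes \<Omega> :: "(real^'n) set" and p :: "real^'n" and \<rho> \<sigma> L h K :: real and k :: 'n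
    and \<gamma> v :: "real^'n \<Rightarrow> real"
  assumes \<sigma>: "\<sigma> \<in> {1, -1}"
    and inv: "\<And>x t. \<gamma> (x + t *\<^sub>R axis k 1) = \<gamma> x"
    and chart: "\<And>x. x \<in> ball p \<rho> \<Longrightarrow> x \<in> \<Omega> \<longleftrightarrow> \<gamma> x < \<sigma> * x $ k"
    and centre: "\<gamma> p = \<sigma> * p $ k"
    and L0: "L \<ge> 0"
    and lip: "\<And>x y. x \<in> ball p \<rho> \<Longrightarrow> y \<in> ball p \<rho> \<Longrightarrow> \<bar>\<gamma> x - \<gamma> y\<bar> \<le> L * dist x y"
    and h0: "0 < h" and hr: "h \<le> \<rho> / (2 * L + 5)"
    and energy: "energy_le h (- \<Omega>) v K"
    and supp: "\<And>x. x \<in> grid_lattice h \<Longrightarrow> x \<notin> \<Omega> \<Longrightarrow> v x \<noteq> 0 \<Longrightarrow> x \<in> ball p (\<rho> / (2 * L + 5))"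
begin

definition r where "r = \<rho> / (2 * L + 5)"

text \<open>Between neighbouring columns the graph changes by at most \<open>L * h\<close>, so the
  step counts \<open>n\<close> differ by at most \<open>L + 1\<close>; doubling bounds the
  difference of \<open>a\<close>.\<close>

definition M where "M = nat \<lceil>2 * L + 2\<rceil>"

text \<open>The number of steps that lead weakly below the graph, 0 if already there. The mirror
  sits half a step above the first point below, whence the odd number
  \<open>2 * n x - 1\<close>.\<close>

definition n where "n x = nat \<lceil>(\<sigma> * x $ k - \<gamma> x) / h\<rceil>" for x :: "real^'n"

text \<open>\<open>a x\<close> is the number of grid steps down to the mirror image; truncated subtraction makes it
  \<open>0\<close> below the graph.\<close>

definition a where "a x = 2 * n x - 1" for x

definition pt where "pt x t = x - (real t * h * \<sigma>) *\<^sub>R axis k 1" for x :: "real^'n" and t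

definition R where "R x = pt x (a x)" for x

text \<open>A mirror image may fall outside the chart, where being below the graph of \<gamma> no
  longer means being outside \<Omega>; the truncation makes the function vanish there.\<close>

definition u where "u y = (if y \<in> ball p r \<and> y \<notin> \<Omega> then v y else 0)" for y

text \<open>The inequality is weak because points on the interface count as exterior.\<close>

definition below where "below x \<longleftrightarrow> \<sigma> * x $ k \<le> \<gamma> x" for x :: "real^'n"

text \<open>Extended by zero off the edges with controlled energy, so that a sum over any finite set
  of edges is at most \<open>K\<close>.\<close>

definition f where "f I = (if I \<in> edges h (- \<Omega>) then dsq h v I else 0)" for I

text \<open>The \<open>t\<close>-th edge below \<open>z\<close> in its column. The lower endpoint,
  which names the edge, is the deeper one precisely when \<open>\<sigma> = 1\<close>.\<close>

definition VE where "VE z t = (if \<sigma> = 1 then (pt z (Suc t), k) else (pt z t, k))" for z t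

section \<open>Geometry of the mirror images\<close>

lemma r: "(2 * L + 5) * r = \<rho>" "h \<le> r" "0 < r"
  using L0 h0 hr by (auto simp: r_def)

lemma M: "2 * L + 2 \<le> real M" "1 \<le> M"
  using L0 unfolding M_def by linarith+

lemma f_nonneg: "0 \<le> f I" by (simp add: f_def)

lemma pt_nth [simp]: "\<sigma> * pt x t $ k = \<sigma> * x $ k - real t * h"
  using \<sigma> by (auto simp: pt_def algebra_simps)

lemma \<gamma>_pt [simp]: "\<gamma> (pt x t) = \<gamma> x"
  using inv[of x "- (real t * h * \<sigma>)"] by (simp add: pt_def)

lemma pt_pt [simp]: "pt (pt x s) t = pt x (s + t)"
  by (simp add: pt_def algebra_simps)

lemma pt_0 [simp]: "pt x 0 = x" by (simp add: pt_def)

lemma pt_lattice: "x \<in> grid_lattice h \<Longrightarrow> pt x t \<in> grid_lattice h"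
  using grid_lattice_shift_nat[of x h "-\<sigma>" t k] \<sigma> by (auto simp: pt_def)

lemma below_n: "below x \<longleftrightarrow> n x = 0"
proof -
  have "below x \<longleftrightarrow> (\<sigma> * x $ k - \<gamma> x) / h \<le> 0"
    using h0 by (simp add: below_def divide_le_0_iff)
  then show ?thesis by (simp add: n_def ceiling_le_zero)
qed

lemma n_upper: "\<sigma> * x $ k - \<gamma> x \<le> real (n x) * h"
proof -
  have "(\<sigma> * x $ k - \<gamma> x) / h \<le> real (n x)" unfolding n_def by linarith
  then show ?thesis using h0 by (simp add: field_simps)
qed

lemma below_pt: "a x \<le> c \<Longrightarrow> below (pt x c)"
proof -
  assume "a x \<le> c"
  then have "n x \<le> c" by (auto simp: a_def)
  then have "real (n x) * h \<le> real c * h" using h0 by (intro mult_right_mono) auto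
  then show ?thesis using n_upper[of x] by (simp add: below_def)
qed

lemma below_R: "below (R x)"
  by (simp add: R_def below_pt)

lemma below_pt': "below x \<Longrightarrow> below (pt x c)"
  by (rule below_pt) (simp add: below_n a_def)

lemma R_near:
  assumes "R x \<in> ball p r"
  shows "dist x p < \<rho> - r"
proof -
  define z where "z = R x"
  have zr: "dist p z < r" using assms by (simp add: z_def)
  have z\<rho>: "z \<in> ball p \<rho>" "p \<in> ball p \<rho>"
    using zr r L0 by (auto simp: algebra_simps) (smt (verit) mult_nonneg_nonneg)+
  have ah: "real (a x) * h \<le> (2 * L + 3) * r"
  proof (cases "n x = 0")
    case True
    then show ?thesis using r L0 by (simp add: a_def)
  next
    case False
    then have a: "real (a x) = 2 * real (n x) - 1" by (auto simp: a_def)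
    \<comment> \<open>The image lies at least \<open>n x - 1\<close> steps below the graph.
      Comparing with \<open>p\<close>, which is on the graph, bounds this depth and thereby
      \<open>n x\<close>.\<close>
    have "\<gamma> z - \<sigma> * z $ k \<ge> (real (n x) - 1) * h"
      using n_upper[of x] by (simp add: z_def R_def a algebra_simps)
    moreover have "\<gamma> z \<le> \<gamma> p + L * r"
    proof -
      have "\<bar>\<gamma> z - \<gamma> p\<bar> \<le> L * dist z p" using z\<rho> by (rule lip)
      also have "\<dots> \<le> L * r" using zr L0 by (intro mult_left_mono) (auto simp: dist_commute)
      finally show ?thesis by linarith
    qed
    moreover have "\<sigma> * p $ k - \<sigma> * z $ k \<le> r"
    proof -
      have "\<bar>(p - z) $ k\<bar> \<le> norm (p - z)" by (rule component_le_norm_cart)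
      then have "\<bar>p $ k - z $ k\<bar> \<le> r" using zr by (simp add: dist_norm)
      then show ?thesis using \<sigma> by auto
    qed
    ultimately have "(real (n x) - 1) * h \<le> (L + 1) * r"
      using centre by (simp add: algebra_simps)
    then have "real (a x) * h \<le> 2 * ((L + 1) * r) + h" by (simp add: a algebra_simps)
    also have "\<dots> \<le> (2 * L + 3) * r" using r by (simp add: algebra_simps)
    finally show ?thesis .
  qed
  have "dist x z = real (a x) * h"
    using \<sigma> h0 by (auto simp: z_def R_def pt_def dist_norm)
  then have "dist x p \<le> real (a x) * h + dist z p" using dist_triangle[of x p z] by simp
  also have "\<dots> < (2 * L + 3) * r + r" using ah zr by (simp add: dist_commute)
  finally show ?thesis using r(1) by (simp add: algebra_simps)
qed

lemma u_eq:
  assumes "z \<in> grid_lattice h" "z \<in> ball p \<rho>" "below z"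
  shows "z \<notin> \<Omega>" "u z = v z"
proof -
  show "z \<notin> \<Omega>" using chart[OF assms(2)] assms(3) by (simp add: below_def)
  then show "u z = v z" using supp[OF assms(1)] by (auto simp: u_def r_def)
qed

text \<open>If one end carries a nonzero value, both ends lie in the chart because
  \<open>r + h \<le> \<rho>\<close>, and there \<open>u\<close> agrees with \<open>v\<close>: the
  truncation creates no new differences.\<close>

lemma dsq_u_le:
  assumes z: "z \<in> grid_lattice h" "below z" "below (z + h *\<^sub>R axis i 1)"
  shows "dsq h u (z, i) \<le> f (z, i)"
proof (cases "u z = 0 \<and> u (z + h *\<^sub>R axis i 1) = 0")
  case True
  then show ?thesis by (simp add: dsq_def f_nonneg)
next
  case False
  define y where "y = z + h *\<^sub>R axis i (1::real)"
  have zy: "dist z y = h" using h0 by (simp add: y_def dist_norm)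
  have "z \<in> ball p r \<or> y \<in> ball p r" using False by (auto simp: u_def y_def split: if_splits)
  then have "dist p z < r + h" "dist p y < r + h"
    using zy h0 dist_triangle[of p z y] dist_triangle[of p y z] by (auto simp: dist_commute)
  moreover have "r + h \<le> \<rho>" using r L0 by (auto simp: algebra_simps) (smt (verit) mult_nonneg_nonneg)
  ultimately have b: "z \<in> ball p \<rho>" "y \<in> ball p \<rho>" by auto
  have yl: "y \<in> grid_lattice h" using grid_lattice_step(1)[OF z(1)] by (simp add: y_def)
  have uz: "z \<notin> \<Omega>" "u z = v z" using u_eq[OF z(1) b(1) z(2)] by auto
  have uy: "y \<notin> \<Omega>" "u y = v y" using u_eq[OF yl b(2)] z(3) by (auto simp: y_def)
  have "(z, i) \<in> edges h (- \<Omega>)" using z(1) uz(1) uy(1) by (auto simp: edges_def y_def)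
  then show ?thesis using uz uy by (simp add: f_def dsq_def y_def)
qed

lemma sum_f_le:
  assumes "finite E"
  shows "(\<Sum>I\<in>E. f I) \<le> K"
proof -
  have "(\<Sum>I\<in>E. f I) = (\<Sum>I\<in>E \<inter> edges h (- \<Omega>). dsq h v I)"
    using assms by (simp add: f_def sum.inter_restrict)
  also have "\<dots> \<le> K" using assms by (intro energy_leD[OF energy]) auto
  finally show ?thesis .
qed

text \<open>Equal images force the same column, so the heights differ by \<open>a x - a y\<close>
  whole steps, and so do \<open>n x\<close> and \<open>n y\<close>. As \<open>a\<close> is
  \<open>2 * n - 1\<close>, that integer equals its own double.\<close>

lemma inj_R: "inj_on R {x. n x \<noteq> 0}"
proof (rule inj_onI)
  fix x y assume xy: "x \<in> {x. n x \<noteq> 0}" "y \<in> {x. n x \<noteq> 0}" "R x = R y"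
  have "\<gamma> (R x) = \<gamma> (R y)" "\<sigma> * R x $ k = \<sigma> * R y $ k" using xy(3) by auto
  then have "\<gamma> x = \<gamma> y" and d: "\<sigma> * x $ k - real (a x) * h = \<sigma> * y $ k - real (a y) * h"
    by (auto simp: R_def)
  then have "(\<sigma> * x $ k - \<gamma> x) / h = (\<sigma> * y $ k - \<gamma> y) / h + of_int (int (a x) - int (a y))"
    using h0 by (simp add: field_simps)
  then have "\<lceil>(\<sigma> * x $ k - \<gamma> x) / h\<rceil> = \<lceil>(\<sigma> * y $ k - \<gamma> y) / h\<rceil> + (int (a x) - int (a y))"
    by (metis ceiling_add_of_int)
  moreover have "\<lceil>(\<sigma> * x $ k - \<gamma> x) / h\<rceil> = int (n x)" "\<lceil>(\<sigma> * y $ k - \<gamma> y) / h\<rceil> = int (n y)"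
    using xy(1,2) by (auto simp: n_def)
  moreover have "int (a x) = 2 * int (n x) - 1" "int (a y) = 2 * int (n y) - 1"
    using xy(1,2) by (auto simp: a_def)
  ultimately have "a x = a y" by simp
  then show "x = y" using xy(3) by (simp add: R_def pt_def)
qed

text \<open>\<open>R\<close> fixes the points below the graph and is injective on those above, so
  each edge is met at most twice.\<close>

lemma sum_R_le:
  assumes Y: "finite Y" and g: "inj g"
  shows "(\<Sum>y\<in>Y. f (g (R y))) \<le> 2 * K"
proof -
  have R0: "R y = y" if "n y = 0" for y using that by (simp add: R_def a_def)
  have 1: "inj_on (\<lambda>y. g (R y)) (Y \<inter> {y. n y = 0})"
    using g R0 by (auto simp: inj_on_def)
  have 2: "inj_on (\<lambda>y. g (R y)) (Y - {y. n y = 0})"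
    using g inj_R by (auto simp: inj_on_def)
  have "(\<Sum>y\<in>Y. f (g (R y))) = (\<Sum>y\<in>Y \<inter> {y. n y = 0}. f (g (R y))) + (\<Sum>y\<in>Y - {y. n y = 0}. f (g (R y)))"
    using Y by (rule sum.Int_Diff)
  also have "\<dots> = (\<Sum>I\<in>(\<lambda>y. g (R y)) ` (Y \<inter> {y. n y = 0}). f I) + (\<Sum>I\<in>(\<lambda>y. g (R y)) ` (Y - {y. n y = 0}). f I)"
    by (simp add: sum.reindex[OF 1] sum.reindex[OF 2])
  also have "\<dots> \<le> K + K" using Y by (intro add_mono sum_f_le) auto
  finally show ?thesis by simp
qed

section \<open>Differences of the reflected function, vertically and horizontally\<close>

lemma pt_Suc_pos: "\<sigma> = 1 \<Longrightarrow> pt z (Suc t) + h *\<^sub>R axis k 1 = pt z t"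
  unfolding pt_def by (simp add: algebra_simps)

lemma pt_Suc_neg: "\<sigma> \<noteq> 1 \<Longrightarrow> pt z t + h *\<^sub>R axis k 1 = pt z (Suc t)"
  using \<sigma> unfolding pt_def by (auto simp: algebra_simps)

lemma VE_pos: "\<sigma> = 1 \<Longrightarrow> VE z t = (pt z (Suc t), k)"
  unfolding VE_def by (rule if_P)

lemma VE_neg: "\<sigma> \<noteq> 1 \<Longrightarrow> VE z t = (pt z t, k)"
  unfolding VE_def by (rule if_not_P)

lemma dsq_VE: "dsq h w (VE z t) = (w (pt z (Suc t)) - w (pt z t))\<^sup>2"
proof (cases "\<sigma> = 1")
  case True
  show ?thesis unfolding VE_pos[OF True] dsq_def fst_conv snd_conv pt_Suc_pos[OF True]
    by (rule power2_commute)
next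
  case False
  show ?thesis unfolding VE_neg[OF False] dsq_def fst_conv snd_conv pt_Suc_neg[OF False] ..
qed

lemma inj_VE: "inj (\<lambda>z. VE z t)"
  unfolding inj_def VE_def pt_def by auto

lemma column_step:
  assumes "z \<in> grid_lattice h" "below z"
  shows "(u (pt z (Suc t)) - u (pt z t))\<^sup>2 \<le> f (VE z t)"
proof -
  have "\<exists>y. VE z t = (y, k) \<and> y \<in> grid_lattice h \<and> below y \<and> below (y + h *\<^sub>R axis k 1)"
  proof (cases "\<sigma> = 1")
    case True
    show ?thesis unfolding VE_pos[OF True]
      by (intro exI[of _ "pt z (Suc t)"])
        (simp only: pt_Suc_pos[OF True] pt_lattice[OF assms(1)] below_pt'[OF assms(2)] simp_thms)
  next
    case False
    show ?thesis unfolding VE_neg[OF False]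
      by (intro exI[of _ "pt z t"])
        (simp only: pt_Suc_neg[OF False] pt_lattice[OF assms(1)] below_pt'[OF assms(2)] simp_thms)
  qed
  then show ?thesis unfolding dsq_VE[symmetric] using dsq_u_le by fastforce
qed

lemma column:
  assumes "z \<in> grid_lattice h" "below z" "d \<le> M"
  shows "(u (pt z d) - u z)\<^sup>2 \<le> real M * (\<Sum>t<M. f (VE z t))"
proof -
  have "(u (pt z d) - u z)\<^sup>2 \<le> real d * (\<Sum>t<d. (u (pt z (Suc t)) - u (pt z t))\<^sup>2)"
    using telescope_sq[of "\<lambda>t. u (pt z t)" d] by simp
  also have "\<dots> \<le> real d * (\<Sum>t<d. f (VE z t))"
    by (intro mult_left_mono sum_mono column_step assms) auto
  also have "\<dots> \<le> real M * (\<Sum>t<M. f (VE z t))"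
    using assms(3) by (intro mult_mono sum_mono2 sum_nonneg f_nonneg) auto
  finally show ?thesis .
qed

text \<open>Here \<open>y\<close> has the shallower mirror image. Both columns are compared at the
  depth of the deeper one, where \<open>B\<close> bounds the horizontal difference; at most
  \<open>M\<close> vertical edges lead from there back to \<open>R y\<close>.\<close>

lemma cross:
  assumes y: "y \<in> grid_lattice h" "a y \<le> a x" "a x \<le> a y + M"
    and B: "(u (pt y (a x)) - u (pt x (a x)))\<^sup>2 \<le> B"
  shows "(u (R y) - u (R x))\<^sup>2 \<le> 2 * B + 2 * real M * (\<Sum>t<M. f (VE (R y) t))"
proof -
  have c: "(u (pt (R y) (a x - a y)) - u (R y))\<^sup>2 \<le> real M * (\<Sum>t<M. f (VE (R y) t))"
    by (rule column) (use y in \<open>auto simp: below_pt R_def intro: pt_lattice\<close>)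
  have e: "pt (R y) (a x - a y) = pt y (a x)" using y(2) by (simp add: R_def)
  have "(u (R y) - u (R x))\<^sup>2 = ((u (pt y (a x)) - u (R x)) + (u (R y) - u (pt y (a x))))\<^sup>2"
    by simp
  also have "\<dots> \<le> 2 * (u (pt y (a x)) - u (R x))\<^sup>2 + 2 * (u (R y) - u (pt y (a x)))\<^sup>2"
    by (rule sq_sum2_le)
  also have "(u (R y) - u (pt y (a x)))\<^sup>2 \<le> real M * (\<Sum>t<M. f (VE (R y) t))"
    using c unfolding e by (simp add: power2_commute)
  also have "(u (pt y (a x)) - u (R x))\<^sup>2 \<le> B" using B by (simp add: R_def)
  finally show ?thesis by simp
qed

lemma a_diff:
  assumes "x \<in> ball p \<rho>" "y \<in> ball p \<rho>" "dist x y = h" "x $ k = y $ k"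
  shows "a x \<le> a y + M"
proof -
  have "\<bar>\<gamma> x - \<gamma> y\<bar> \<le> L * h" using lip[OF assms(1,2)] assms(3) by simp
  then have "(\<sigma> * x $ k - \<gamma> x) / h \<le> (\<sigma> * y $ k - \<gamma> y) / h + L"
  proof -
    have "\<sigma> * x $ k - \<gamma> x \<le> (\<sigma> * y $ k - \<gamma> y) + L * h"
      using \<open>\<bar>\<gamma> x - \<gamma> y\<bar> \<le> L * h\<close> assms(4) by simp
    then have "(\<sigma> * x $ k - \<gamma> x) / h \<le> ((\<sigma> * y $ k - \<gamma> y) + L * h) / h"
      using h0 by (intro divide_right_mono) auto
    then show ?thesis using h0 by (simp add: add_divide_distrib)
  qed
  then have "real (n x) \<le> real (n y) + L + 1"
    using L0 unfolding n_def by linarith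
  then have "real (a x) \<le> real (a y) + (2 * L + 2)" using L0 by (cases "n x"; cases "n y") (auto simp: a_def)
  then show ?thesis using M(1) by linarith
qed

text \<open>Above the graph, one step down lowers \<open>n\<close> by one and \<open>a\<close> by
  two, so the mirror image moves one step up; when \<open>n x = 1\<close> both points have the same
  image.\<close>

lemma vertical:
  assumes "x \<in> grid_lattice h"
  shows "(u (R x) - u (R (pt x 1)))\<^sup>2 \<le> f (VE (R x) 0) + f (VE (R (pt x 1)) 0)"
proof -
  have "(\<sigma> * pt x 1 $ k - \<gamma> (pt x 1)) / h = (\<sigma> * x $ k - \<gamma> x) / h - 1"
    using h0 by (simp add: field_simps)
  then have n1: "n (pt x 1) = n x - 1" unfolding n_def by simp
  have R': "R (pt x 1) = pt x (Suc (a (pt x 1)))" by (simp add: R_def)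
  consider "n x = 0" | "n x = 1" | m where "n x = Suc (Suc m)" by (metis One_nat_def not0_implies_Suc)
  then show ?thesis
  proof cases
    case 1
    then have "R x = x" "R (pt x 1) = pt x 1" using n1 by (auto simp: R_def a_def)
    then show ?thesis using column_step[of x 0] assms 1 below_n f_nonneg[of "VE (pt x 1) 0"]
      by (simp add: power2_commute)
  next
    case 2
    then have "R x = R (pt x 1)" using n1 by (simp add: R_def a_def)
    then show ?thesis by (simp add: f_nonneg)
  next
    case 3
    then have "R x = pt (R (pt x 1)) 1" using n1 by (simp add: R_def a_def)
    moreover have "R (pt x 1) \<in> grid_lattice h" unfolding R_def by (intro pt_lattice assms)
    ultimately show ?thesis using column_step[of "R (pt x 1)" 0] below_R f_nonneg[of "VE (R x) 0"]
      by simp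
  qed
qed

definition F where "F z = (\<Sum>t<M. f (VE z t))" for z

lemma F_nonneg: "0 \<le> F z" by (auto simp: F_def intro: sum_nonneg f_nonneg)

lemma VE_le_F: "f (VE z 0) \<le> F z"
  unfolding F_def using M(2) by (intro member_le_sum f_nonneg) auto

text \<open>The two horizontal terms belong to two cases: the connecting edge lies at the depth of
  the deeper image, and if that is \<open>R (y i)\<close>, the edge starts one step before it. The
  vertical edges in \<open>F\<close> pay for the difference in depth.\<close>

lemma dsq_reflected_le:
  fixes x :: "real^'n"
  assumes x: "x \<in> grid_lattice h"
  defines "y i \<equiv> x + h *\<^sub>R axis i 1"
  shows "dsq h (\<lambda>x. u (R x)) (x, i) \<le>
    2 * (f (R x, i) + f (R (y i) - h *\<^sub>R axis i 1, i)) + 2 * real M * (F (R x) + F (R (y i)))"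
proof -
  have d: "dsq h (\<lambda>x. u (R x)) (x, i) = (u (R (y i)) - u (R x))\<^sup>2" by (simp add: dsq_def y_def)
  have yl: "y i \<in> grid_lattice h" using grid_lattice_step(1)[OF x] by (simp add: y_def)
  have "0 \<le> real M * F z" for z by (simp add: F_nonneg)
  note nn = this[of "R x"] this[of "R (y i)"] f_nonneg[of "(R x, i)"] f_nonneg[of "(R (y i) - h *\<^sub>R axis i 1, i)"]
    F_nonneg[of "R x"] F_nonneg[of "R (y i)"]
  show ?thesis
  proof (cases "i = k")
    case True
    have "(u (R (y i)) - u (R x))\<^sup>2 \<le> F (R x) + F (R (y i))"
    proof (cases "\<sigma> = 1")
      case s: True
      have "pt (y i) 1 = x" using pt_Suc_pos[OF s, of x 0] s True unfolding pt_def y_def by simp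
      then show ?thesis using vertical[OF yl] VE_le_F[of "R x"] VE_le_F[of "R (y i)"] by simp
    next
      case False
      then have "pt x 1 = y i" using True pt_Suc_neg[of x 0] by (simp add: y_def)
      then show ?thesis using vertical[OF x] VE_le_F[of "R x"] VE_le_F[of "R (y i)"]
        by (simp add: power2_commute)
    qed
    also have "\<dots> \<le> 2 * real M * (F (R x) + F (R (y i)))"
      using mult_right_mono[of 1 "2 * real M" "F (R x) + F (R (y i))"] M(2) nn by simp
    finally show ?thesis using nn d by simp
  next
    case False
    have comm: "pt (y i) c = pt x c + h *\<^sub>R axis i 1" for c by (simp add: pt_def y_def)
    have xk: "x $ k = y i $ k" using False by (simp add: y_def axis_def)
    have dist: "dist x (y i) = h" using h0 by (simp add: y_def dist_norm)
    show ?thesis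
    proof (cases "R x \<in> ball p r \<or> R (y i) \<in> ball p r")
      case far: False
      then show ?thesis using nn unfolding d by (simp add: u_def)
    next
      case True
      \<comment> \<open>An image in the small ball places its point so well inside the chart that
        the neighbour at distance \<open>h \<le> r\<close> is in the chart too; only then are the
        depths comparable.\<close>
      then have "dist x p < \<rho> - r \<or> dist (y i) p < \<rho> - r" using R_near by blast
      then have b: "x \<in> ball p \<rho>" "y i \<in> ball p \<rho>"
        using dist r(2,3) dist_triangle[of x p "y i"] dist_triangle[of "y i" p x]
        by (auto simp: dist_commute)
      have 1: "a x \<le> a (y i) + M" using b dist xk by (rule a_diff)
      have 2: "a (y i) \<le> a x + M" using a_diff[OF b(2,1)] dist xk by (simp add: dist_commute)
      show ?thesis
      proof (cases "a (y i) \<le> a x")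
        case True
        have "dsq h u (pt x (a x), i) \<le> f (pt x (a x), i)"
          using True by (intro dsq_u_le) (auto simp: comm[symmetric] x pt_lattice below_pt)
        then have "(u (pt (y i) (a x)) - u (pt x (a x)))\<^sup>2 \<le> f (R x, i)"
          by (simp add: dsq_def comm R_def)
        from cross[OF yl True 1 this] show ?thesis using nn unfolding d F_def[symmetric] ring_distribs
          by linarith
      next
        case f: False
        then have le: "a x \<le> a (y i)" by simp
        have "dsq h u (pt x (a (y i)), i) \<le> f (pt x (a (y i)), i)"
          using le by (intro dsq_u_le) (auto simp: comm[symmetric] x pt_lattice below_pt)
        moreover have "R (y i) - h *\<^sub>R axis i 1 = pt x (a (y i))"
          by (simp add: R_def comm)
        ultimately have "(u (pt x (a (y i))) - u (pt (y i) (a (y i))))\<^sup>2 \<le> f (R (y i) - h *\<^sub>R axis i 1, i)"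
          by (simp add: dsq_def comm power2_commute)
        from cross[OF x le 2 this] show ?thesis
          using nn unfolding d F_def[symmetric] ring_distribs power2_commute[of "u (R x)"] by linarith
      qed
    qed
  qed
qed

lemma sum_F_R_le: "finite Y \<Longrightarrow> (\<Sum>y\<in>Y. F (R y)) \<le> 2 * real M * K"
proof -
  assume Y: "finite Y"
  have "(\<Sum>y\<in>Y. F (R y)) = (\<Sum>t<M. \<Sum>y\<in>Y. f (VE (R y) t))"
    unfolding F_def by (rule sum.swap)
  also have "\<dots> \<le> (\<Sum>t<M. 2 * K)" using Y by (intro sum_mono sum_R_le inj_VE)
  finally show ?thesis by simp
qed

text \<open>For each direction the two horizontal sums are at most \<open>2 * K\<close> each and the
  two sums of \<open>F\<close> at most \<open>2 * real M * K\<close> each, the 2 counting how often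
  \<open>R\<close> meets an edge; the pointwise factors 2 and \<open>2 * real M\<close> give the
  constant.\<close>

lemma reflected_energy: "energy_le h UNIV (\<lambda>x. u (R x)) (real CARD('n) * (8 + 8 * (real M)\<^sup>2) * K)"
  unfolding energy_le_def
proof (intro allI impI)
  fix J :: "((real^'n) \<times> 'n) set" assume J: "finite J" "J \<subseteq> edges h UNIV"
  define Y where "Y = fst ` J"
  have Y: "finite Y" "Y \<subseteq> grid_lattice h" using J by (auto simp: Y_def edges_def)
  define s where "s i x = x + h *\<^sub>R axis i (1::real)" for i and x :: "real^'n"
  have sinj: "inj_on (s i) Y" for i by (auto simp: inj_on_def s_def)
  have "(\<Sum>I\<in>J. dsq h (\<lambda>x. u (R x)) I) \<le> (\<Sum>I\<in>UNIV \<times> Y. dsq h (\<lambda>x. u (R x)) (snd I, fst I))"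
  proof -
    have "(\<Sum>I\<in>J. dsq h (\<lambda>x. u (R x)) I) = (\<Sum>I\<in>prod.swap ` J. dsq h (\<lambda>x. u (R x)) (snd I, fst I))"
      by (subst sum.reindex) (auto simp: inj_on_def)
    also have "\<dots> \<le> (\<Sum>I\<in>UNIV \<times> Y. dsq h (\<lambda>x. u (R x)) (snd I, fst I))"
      using Y(1) by (intro sum_mono2) (auto simp: Y_def intro: rev_image_eqI)
    finally show ?thesis .
  qed
  also have "\<dots> = (\<Sum>i\<in>UNIV. \<Sum>x\<in>Y. dsq h (\<lambda>x. u (R x)) (x, i))"
    by (simp add: sum.cartesian_product split_def)
  also have "\<dots> \<le> (\<Sum>i\<in>(UNIV::'n set). (8 + 8 * (real M)\<^sup>2) * K)"
  proof (rule sum_mono)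
    fix i :: 'n
    have "(\<Sum>x\<in>Y. dsq h (\<lambda>x. u (R x)) (x, i)) \<le> (\<Sum>x\<in>Y.
      2 * (f (R x, i) + f (R (s i x) - h *\<^sub>R axis i 1, i)) + 2 * real M * (F (R x) + F (R (s i x))))"
      unfolding s_def using Y(2) by (intro sum_mono dsq_reflected_le) auto
    also have "\<dots> = 2 * ((\<Sum>x\<in>Y. f (R x, i)) + (\<Sum>x\<in>Y. f (R (s i x) - h *\<^sub>R axis i 1, i)))
       + 2 * real M * ((\<Sum>x\<in>Y. F (R x)) + (\<Sum>x\<in>Y. F (R (s i x))))"
      by (simp add: sum.distrib sum_distrib_left algebra_simps)
    also have "(\<Sum>x\<in>Y. f (R (s i x) - h *\<^sub>R axis i 1, i)) = (\<Sum>y\<in>s i ` Y. f (R y - h *\<^sub>R axis i 1, i))"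
      by (simp add: sum.reindex[OF sinj])
    also have "(\<Sum>x\<in>Y. F (R (s i x))) = (\<Sum>y\<in>s i ` Y. F (R y))"
      by (simp add: sum.reindex[OF sinj])
    also have "2 * ((\<Sum>x\<in>Y. f (R x, i)) + (\<Sum>y\<in>s i ` Y. f (R y - h *\<^sub>R axis i 1, i)))
       + 2 * real M * ((\<Sum>x\<in>Y. F (R x)) + (\<Sum>y\<in>s i ` Y. F (R y)))
       \<le> 2 * (2 * K + 2 * K) + 2 * real M * (2 * real M * K + 2 * real M * K)"
      using Y(1) by (intro add_mono mult_left_mono sum_F_R_le sum_R_le[of _ "\<lambda>z. (z, i)"]
        sum_R_le[of _ "\<lambda>z. (z - h *\<^sub>R axis i 1, i)"]) (auto simp: inj_def)
    also have "\<dots> = (8 + 8 * (real M)\<^sup>2) * K" by (simp add: algebra_simps power2_eq_square)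
    finally show "(\<Sum>x\<in>Y. dsq h (\<lambda>x. u (R x)) (x, i)) \<le> (8 + 8 * (real M)\<^sup>2) * K" .
  qed
  also have "\<dots> = real CARD('n) * (8 + 8 * (real M)\<^sup>2) * K" by simp
  finally show "(\<Sum>I\<in>J. dsq h (\<lambda>x. u (R x)) I) \<le> real CARD('n) * (8 + 8 * (real M)\<^sup>2) * K" .
qed

text \<open>In the chart and off \<Omega>, \<open>R\<close> is the identity. Outside the chart,
  \<open>R_near\<close> keeps the image away from the small ball, so both sides vanish.\<close>

lemma reflected_eq:
  assumes "x \<in> grid_lattice h" "x \<notin> \<Omega>"
  shows "u (R x) = v x"
proof (cases "x \<in> ball p \<rho>")
  case True
  then have b: "below x" using chart assms(2) by (simp add: below_def)
  then have "R x = x" by (simp add: R_def a_def below_n)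
  then show ?thesis using u_eq(2)[OF assms(1) True b] by simp
next
  case False
  then have "R x \<notin> ball p r" using R_near[of x] r(3) by (auto simp: dist_commute)
  moreover have "v x = 0"
  proof (rule ccontr)
    assume "v x \<noteq> 0"
    then have "x \<in> ball p r" using supp[OF assms] by (simp add: r_def)
    moreover have "r \<le> \<rho>" using r L0 by (auto simp: algebra_simps) (smt (verit) mult_nonneg_nonneg)
    ultimately show False using False by auto
  qed
  ultimately show ?thesis by (simp add: u_def)
qed

end

definition extendable :: "(real^'n) set \<Rightarrow> real^'n \<Rightarrow> real \<Rightarrow> bool" where
  "extendable \<Omega> p r \<longleftrightarrow> (\<exists>C\<ge>0. \<exists>h0>0. \<forall>h v K. 0 < h \<longrightarrow> h \<le> h0 \<longrightarrow> energy_le h (- \<Omega>) v K \<longrightarrow>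
     (\<forall>x\<in>grid_lattice h - \<Omega>. v x \<noteq> 0 \<longrightarrow> x \<in> ball p r) \<longrightarrow>
     (\<exists>w. (\<forall>x\<in>grid_lattice h - \<Omega>. w x = v x) \<and> energy_le h UNIV w (C * K)))"

lemma frontier_extendable:
  fixes \<Omega> :: "(real^'n) set"
  assumes "open \<Omega>" "C2_boundary \<Omega>" "p \<in> frontier \<Omega>"
  shows "\<exists>r>0. extendable \<Omega> p r"
proof -
  obtain \<rho> \<sigma> \<gamma> k where \<rho>: "\<rho> > 0" and \<sigma>: "\<sigma> \<in> {1, -1}" and C2: "C2_function \<gamma>"
    and inv: "\<And>x t. \<gamma> (x + t *\<^sub>R axis k 1) = \<gamma> x"
    and chart: "\<Omega> \<inter> ball p \<rho> = {x \<in> ball p \<rho>. \<sigma> * x $ k > \<gamma> x}"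
    by (rule C2_boundaryE[OF assms(2,3)]) blast
  obtain L where L: "L \<ge> 0" "\<And>x y. x \<in> ball p \<rho> \<Longrightarrow> y \<in> ball p \<rho> \<Longrightarrow> \<bar>\<gamma> x - \<gamma> y\<bar> \<le> L * dist x y"
    by (rule C2_function_lipschitz_ball[OF C2, of p \<rho>]) blast
  have centre: "\<gamma> p = \<sigma> * p $ k"
    by (rule chart_centre[OF assms(1,3) \<rho> C2_function_continuous[OF C2] chart])
  define r where "r = \<rho> / (2 * L + 5)"
  have r: "r > 0" using \<rho> L(1) by (simp add: r_def)
  define C where "C = real CARD('n) * (8 + 8 * (real (nat \<lceil>2 * L + 2\<rceil>))\<^sup>2)"
  have "extendable \<Omega> p r" unfolding extendable_def
  proof (rule exI[of _ C], rule conjI[rotated], rule exI[of _ r], rule conjI[rotated],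
      intro allI impI)
    fix h v K assume h: "0 < h" "h \<le> r" and E: "energy_le h (- \<Omega>) v K"
      and s: "\<forall>x\<in>grid_lattice h - \<Omega>. v x \<noteq> 0 \<longrightarrow> x \<in> ball p r"
    interpret reflection \<Omega> p \<rho> \<sigma> L h K k \<gamma> v
      by unfold_locales (use \<sigma> inv chart centre L h E s in \<open>auto simp: r_def set_eq_iff\<close>)
    show "\<exists>w. (\<forall>x\<in>grid_lattice h - \<Omega>. w x = v x) \<and> energy_le h UNIV w (C * K)"
      using reflected_eq reflected_energy unfolding C_def M_def by (intro exI[of _ "\<lambda>x. u (R x)"]) auto
  qed (use r in \<open>auto simp: C_def\<close>)
  then show ?thesis using r by blast
qed

section \<open>Extension to the whole grid\<close>

lemma energy_le_add:
  assumes "energy_le h S v K" "energy_le h S w L"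
  shows "energy_le h S (\<lambda>x. v x + w x) (2 * K + 2 * L)"
  unfolding energy_le_def
proof (intro allI impI)
  fix J assume J: "finite J" "J \<subseteq> edges h S"
  have "(\<Sum>I\<in>J. dsq h (\<lambda>x. v x + w x) I) \<le> (\<Sum>I\<in>J. 2 * dsq h v I + 2 * dsq h w I)"
  proof (rule sum_mono)
    fix I
    show "dsq h (\<lambda>x. v x + w x) I \<le> 2 * dsq h v I + 2 * dsq h w I"
      using sq_sum2_le[of "v (fst I + h *\<^sub>R axis (snd I) 1) - v (fst I)" "w (fst I + h *\<^sub>R axis (snd I) 1) - w (fst I)"]
      by (simp add: dsq_def algebra_simps)
  qed
  also have "\<dots> = 2 * (\<Sum>I\<in>J. dsq h v I) + 2 * (\<Sum>I\<in>J. dsq h w I)"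
    by (simp add: sum.distrib sum_distrib_left)
  also have "\<dots> \<le> 2 * K + 2 * L"
    using energy_leD[OF assms(1) J] energy_leD[OF assms(2) J] by simp
  finally show "(\<Sum>I\<in>J. dsq h (\<lambda>x. v x + w x) I) \<le> 2 * K + 2 * L" .
qed

lemma cutoff_mass:
  assumes "mass_le h S v K" "\<And>x. 0 \<le> \<theta> x" "\<And>x. \<theta> x \<le> (1::real)"
  shows "mass_le h S (\<lambda>x. \<theta> x * v x) K"
  unfolding mass_le_def
proof (intro allI impI)
  fix Y assume Y: "finite Y" "Y \<subseteq> grid_lattice h \<inter> S"
  have "(\<Sum>y\<in>Y. (\<theta> y * v y)\<^sup>2) \<le> (\<Sum>y\<in>Y. (v y)\<^sup>2)"
  proof (rule sum_mono)
    fix y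
    have "(\<theta> y)\<^sup>2 * (v y)\<^sup>2 \<le> 1 * (v y)\<^sup>2"
      using assms(2,3)[of y] by (intro mult_right_mono) (auto simp: power_le_one)
    then show "(\<theta> y * v y)\<^sup>2 \<le> (v y)\<^sup>2" by (simp add: power_mult_distrib)
  qed
  also have "\<dots> \<le> K" by (rule mass_leD[OF assms(1) Y])
  finally show "(\<Sum>y\<in>Y. (\<theta> y * v y)\<^sup>2) \<le> K" .
qed

text \<open>Product rule for differences. The cutoff varies by at most \<open>c * h\<close> along an
  edge, and the resulting term with \<open>c\<^sup>2 * h\<^sup>2\<close> is absorbed by the mass
  bound; here the Poincare inequality is consumed.\<close>

lemma cutoff_energy:
  fixes v \<theta> :: "real^'n \<Rightarrow> real"
  assumes h: "0 < h" and E: "energy_le h S v K" and m: "mass_le h S v (K / h\<^sup>2)"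
    and \<theta>: "\<And>x. 0 \<le> \<theta> x" "\<And>x. \<theta> x \<le> 1" "\<And>x y. \<bar>\<theta> x - \<theta> y\<bar> \<le> c * dist x y"
  shows "energy_le h S (\<lambda>x. \<theta> x * v x) ((2 + 2 * real CARD('n) * c\<^sup>2) * K)"
  unfolding energy_le_def
proof (intro allI impI)
  fix J :: "((real^'n) \<times> 'n) set" assume J: "finite J" "J \<subseteq> edges h S"
  have pointwise: "dsq h (\<lambda>x. \<theta> x * v x) I \<le> 2 * dsq h v I + 2 * (c\<^sup>2 * h\<^sup>2 * (v (fst I))\<^sup>2)" for I :: "(real^'n) \<times> 'n"
  proof -
    define x where "x = fst I"
    define y where "y = x + h *\<^sub>R axis (snd I) 1"
    have "\<bar>\<theta> y - \<theta> x\<bar> \<le> c * h" using \<theta>(3)[of y x] h by (simp add: y_def dist_norm)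
    then have lip: "(\<theta> y - \<theta> x)\<^sup>2 \<le> c\<^sup>2 * h\<^sup>2"
      by (metis abs_ge_zero power2_abs power_mono power_mult_distrib)
    have "dsq h (\<lambda>x. \<theta> x * v x) I = (\<theta> y * (v y - v x) + (\<theta> y - \<theta> x) * v x)\<^sup>2"
      by (simp add: dsq_def x_def y_def algebra_simps)
    also have "\<dots> \<le> 2 * (\<theta> y * (v y - v x))\<^sup>2 + 2 * ((\<theta> y - \<theta> x) * v x)\<^sup>2" by (rule sq_sum2_le)
    also have "(\<theta> y * (v y - v x))\<^sup>2 \<le> 1 * (v y - v x)\<^sup>2"
      unfolding power_mult_distrib using \<theta>(1,2)[of y] by (intro mult_right_mono) (auto simp: power_le_one)
    also have "((\<theta> y - \<theta> x) * v x)\<^sup>2 \<le> c\<^sup>2 * h\<^sup>2 * (v x)\<^sup>2"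
      unfolding power_mult_distrib[of _ "v x"] using lip by (intro mult_right_mono) auto
    finally show ?thesis by (simp add: dsq_def x_def y_def)
  qed
  have "(\<Sum>I\<in>J. (v (fst I))\<^sup>2) \<le> (\<Sum>I\<in>fst ` J \<times> (UNIV :: 'n set). (v (fst I))\<^sup>2)"
    using J(1) by (intro sum_mono2) (auto intro: rev_image_eqI)
  also have "\<dots> = real CARD('n) * (\<Sum>x\<in>fst ` J. (v x)\<^sup>2)"
    using sum.cartesian_product[of "\<lambda>x i. (v x)\<^sup>2" "UNIV :: 'n set" "fst ` J", symmetric]
    by (simp add: split_def sum_distrib_left)
  also have "\<dots> \<le> real CARD('n) * (K / h\<^sup>2)"
    using J by (intro mult_left_mono mass_leD[OF m]) (auto simp: edges_def)
  finally have ms: "(\<Sum>I\<in>J. (v (fst I))\<^sup>2) \<le> real CARD('n) * (K / h\<^sup>2)" .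
  have "(\<Sum>I\<in>J. dsq h (\<lambda>x. \<theta> x * v x) I) \<le> (\<Sum>I\<in>J. 2 * dsq h v I + 2 * (c\<^sup>2 * h\<^sup>2 * (v (fst I))\<^sup>2))"
    by (intro sum_mono pointwise)
  also have "\<dots> = 2 * (\<Sum>I\<in>J. dsq h v I) + 2 * (c\<^sup>2 * h\<^sup>2 * (\<Sum>I\<in>J. (v (fst I))\<^sup>2))"
    by (simp add: sum.distrib sum_distrib_left)
  also have "\<dots> \<le> 2 * K + 2 * (c\<^sup>2 * h\<^sup>2 * (real CARD('n) * (K / h\<^sup>2)))"
    by (intro add_mono mult_left_mono energy_leD[OF E J] ms) auto
  also have "\<dots> = (2 + 2 * real CARD('n) * c\<^sup>2) * K" using h by (simp add: algebra_simps)
  finally show "(\<Sum>I\<in>J. dsq h (\<lambda>x. \<theta> x * v x) I) \<le> (2 + 2 * real CARD('n) * c\<^sup>2) * K" .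
qed

lemma frontier_between:
  fixes x y :: "'a::euclidean_space"
  assumes "x \<in> \<Omega>" "y \<notin> \<Omega>"
  shows "\<exists>z\<in>frontier \<Omega>. dist z y \<le> dist x y"
proof -
  have "closed_segment x y \<inter> frontier \<Omega> \<noteq> {}"
    using assms by (intro connected_Int_frontier) auto
  then obtain z where "z \<in> closed_segment x y" "z \<in> frontier \<Omega>" by auto
  then show ?thesis using dist_in_closed_segment[of z x y] by (auto simp: dist_commute)
qed

text \<open>An edge with one end in \<Omega> and one outside has a frontier point within
  \<open>h < \<eta>\<close> of its outer end, so \<open>v\<close> vanishes at that end.\<close>

lemma zero_extension:
  fixes v :: "real^'n \<Rightarrow> real"
  assumes "0 < h" "h < \<eta>" and E: "energy_le h (- \<Omega>) v K"
    and v: "\<And>x z. x \<in> grid_lattice h - \<Omega> \<Longrightarrow> z \<in> frontier \<Omega> \<Longrightarrow> dist z x < \<eta> \<Longrightarrow> v x = 0"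
  shows "energy_le h UNIV (\<lambda>x. if x \<in> \<Omega> then 0 else v x) K"
  unfolding energy_le_def
proof (intro allI impI)
  fix J :: "((real^'n) \<times> 'n) set" assume J: "finite J" "J \<subseteq> edges h UNIV"
  let ?w = "\<lambda>x. if x \<in> \<Omega> then 0 else v x"
  have "dsq h ?w I = (if I \<in> edges h (- \<Omega>) then dsq h v I else 0)" if "I \<in> J" for I
  proof -
    obtain x i where I: "I = (x, i)" by fastforce
    define y where "y = x + h *\<^sub>R axis i 1"
    have l: "x \<in> grid_lattice h" "y \<in> grid_lattice h" using that J(2) grid_lattice_step(1)[of x h i] I
      by (auto simp: edges_def y_def)
    have "dist x y = h" using assms(1) by (simp add: y_def dist_norm)
    then have "y \<notin> \<Omega> \<Longrightarrow> x \<in> \<Omega> \<Longrightarrow> v y = 0" "x \<notin> \<Omega> \<Longrightarrow> y \<in> \<Omega> \<Longrightarrow> v x = 0"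
      using frontier_between[of x \<Omega> y] frontier_between[of y \<Omega> x] v l assms(2)
      by (fastforce simp: dist_commute)+
    then show ?thesis using l by (auto simp: I dsq_def edges_def y_def)
  qed
  then have "(\<Sum>I\<in>J. dsq h ?w I) = (\<Sum>I\<in>J \<inter> edges h (- \<Omega>). dsq h v I)"
    using J(1) by (simp add: sum.inter_restrict)
  also have "\<dots> \<le> K" using J(1) by (intro energy_leD[OF E]) auto
  finally show "(\<Sum>I\<in>J. dsq h ?w I) \<le> K" .
qed

text \<open>A partition of unity produced by peeling off one ball at a time:
  \<open>\<theta> x * v x\<close> lives in the ball and is extended locally, while the rest vanishes
  on the half ball and is left to the remaining list. When the list is empty, \<open>v\<close>
  vanishes near the frontier and extension by zero suffices.\<close>

lemma extension_cover:
  fixes \<Omega> :: "(real^'n) set"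
  assumes "\<forall>(p, r) \<in> set ps. r > 0 \<and> extendable \<Omega> p r" and "\<eta> > 0"
  shows "\<exists>C\<ge>0. \<exists>h0>0. \<forall>h v K. 0 < h \<longrightarrow> h \<le> h0 \<longrightarrow>
     energy_le h (- \<Omega>) v K \<longrightarrow> mass_le h (- \<Omega>) v (K / h\<^sup>2) \<longrightarrow>
     (\<forall>x\<in>grid_lattice h - \<Omega>. v x \<noteq> 0 \<longrightarrow> (\<exists>z\<in>frontier \<Omega>. dist z x < \<eta>) \<longrightarrow> (\<exists>(p, r) \<in> set ps. x \<in> ball p (r/2))) \<longrightarrow>
     (\<exists>w. (\<forall>x\<in>grid_lattice h - \<Omega>. w x = v x) \<and> energy_le h UNIV w (C * K))"
  using assms(1)
proof (induction ps)
  case Nil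
  show ?case
  proof (rule exI[of _ 1], rule conjI[rotated], rule exI[of _ "\<eta>/2"], rule conjI[rotated],
      intro allI impI)
    fix h v K assume h: "0 < h" "h \<le> \<eta>/2" and E: "energy_le h (- \<Omega>) v K"
      and v: "\<forall>x\<in>grid_lattice h - \<Omega>. v x \<noteq> 0 \<longrightarrow> (\<exists>z\<in>frontier \<Omega>. dist z x < \<eta>) \<longrightarrow> (\<exists>(p, r) \<in> set []. x \<in> ball p (r/2))"
    have "energy_le h UNIV (\<lambda>x. if x \<in> \<Omega> then 0 else v x) K"
      using h v assms(2) by (intro zero_extension[OF _ _ E, of \<eta>]) auto
    then show "\<exists>w. (\<forall>x\<in>grid_lattice h - \<Omega>. w x = v x) \<and> energy_le h UNIV w (1 * K)"
      by (intro exI[of _ "\<lambda>x. if x \<in> \<Omega> then 0 else v x"]) auto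
  qed (use assms(2) in auto)
next
  case (Cons pr ps)
  obtain p r where pr: "pr = (p, r)" by fastforce
  have r: "r > 0" "extendable \<Omega> p r" using Cons.prems pr by auto
  obtain C1 h1 where p1: "C1 \<ge> 0" "h1 > 0"
    and e1: "\<And>h v K. 0 < h \<Longrightarrow> h \<le> h1 \<Longrightarrow> energy_le h (- \<Omega>) v K \<Longrightarrow>
     (\<forall>x\<in>grid_lattice h - \<Omega>. v x \<noteq> 0 \<longrightarrow> x \<in> ball p r) \<Longrightarrow>
     (\<exists>w. (\<forall>x\<in>grid_lattice h - \<Omega>. w x = v x) \<and> energy_le h UNIV w (C1 * K))"
    using r(2) unfolding extendable_def by blast
  have "\<forall>(p, r) \<in> set ps. r > 0 \<and> extendable \<Omega> p r" using Cons.prems by auto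
  note IH = Cons.IH[OF this]
  obtain C2 h2 where p2: "C2 \<ge> 0" "h2 > 0"
    and e2: "\<And>h v K. 0 < h \<Longrightarrow> h \<le> h2 \<Longrightarrow>
     energy_le h (- \<Omega>) v K \<Longrightarrow> mass_le h (- \<Omega>) v (K / h\<^sup>2) \<Longrightarrow>
     (\<forall>x\<in>grid_lattice h - \<Omega>. v x \<noteq> 0 \<longrightarrow> (\<exists>z\<in>frontier \<Omega>. dist z x < \<eta>) \<longrightarrow> (\<exists>(p, r) \<in> set ps. x \<in> ball p (r/2))) \<Longrightarrow>
     (\<exists>w. (\<forall>x\<in>grid_lattice h - \<Omega>. w x = v x) \<and> energy_le h UNIV w (C2 * K))"
    using IH by blast
  define \<theta> where "\<theta> x = min 1 (max 0 (2 - 2 * dist p x / r))" for x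
  have \<theta>: "0 \<le> \<theta> x" "\<theta> x \<le> 1" "\<theta> x \<noteq> 0 \<Longrightarrow> x \<in> ball p r" "x \<in> ball p (r/2) \<Longrightarrow> \<theta> x = 1" for x
    using r(1) by (auto simp: \<theta>_def min_def max_def field_simps split: if_splits)
  have lip: "\<bar>\<theta> x - \<theta> y\<bar> \<le> 2 / r * dist x y" for x y
  proof -
    have "\<bar>\<theta> x - \<theta> y\<bar> \<le> \<bar>2 * dist p x / r - 2 * dist p y / r\<bar>" by (auto simp: \<theta>_def min_def max_def)
    also have "\<dots> = 2 / r * \<bar>dist p x - dist p y\<bar>" using r(1) by (auto simp: abs_if field_simps)
    also have "\<dots> \<le> 2 / r * dist x y"
      using r(1) abs_dist_diff_le[of x p y] by (intro mult_left_mono) (auto simp: dist_commute)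
    finally show ?thesis .
  qed
  have lip': "\<bar>(1 - \<theta> x) - (1 - \<theta> y)\<bar> \<le> 2 / r * dist x y" for x y
    using lip[of x y] by simp
  \<comment> \<open>The energy factor of a cutoff with Lipschitz constant \<open>2 / r\<close>. As
    \<open>c \<ge> 1\<close>, the enlarged \<open>c * K\<close> serves for the mass as well, which
    the induction hypothesis requires.\<close>
  define c where "c = 2 + 2 * real CARD('n) * (2 / r)\<^sup>2"
  have c: "c \<ge> 1" by (simp add: c_def)
  show ?case
  proof (rule exI[of _ "2 * (C1 * c) + 2 * (C2 * c)"], rule conjI[rotated], rule exI[of _ "min h1 h2"], rule conjI[rotated],
      intro allI impI)
    fix h v K assume h: "0 < h" "h \<le> min h1 h2" and E: "energy_le h (- \<Omega>) v K" and m: "mass_le h (- \<Omega>) v (K / h\<^sup>2)"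
      and v: "\<forall>x\<in>grid_lattice h - \<Omega>. v x \<noteq> 0 \<longrightarrow> (\<exists>z\<in>frontier \<Omega>. dist z x < \<eta>) \<longrightarrow> (\<exists>(p, r) \<in> set (pr # ps). x \<in> ball p (r/2))"
    have h12: "h \<le> h1" "h \<le> h2" using h by auto
    have "K / h\<^sup>2 \<le> c * K / h\<^sup>2"
      using mult_right_mono[OF c energy_le_nonneg[OF E]] by (intro divide_right_mono) auto
    note m' = mass_le_mono[OF _ order.refl this]
    have E1: "energy_le h (- \<Omega>) (\<lambda>x. \<theta> x * v x) (c * K)"
      unfolding c_def by (rule cutoff_energy[OF h(1) E m \<theta>(1,2) lip])
    have E2: "energy_le h (- \<Omega>) (\<lambda>x. (1 - \<theta> x) * v x) (c * K)"
      unfolding c_def by (rule cutoff_energy[OF h(1) E m _ _ lip']) (use \<theta> in auto)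
    have M2: "mass_le h (- \<Omega>) (\<lambda>x. (1 - \<theta> x) * v x) (c * K / h\<^sup>2)"
      by (rule m', rule cutoff_mass[OF m]) (use \<theta> in auto)
    obtain w1 where w1: "\<forall>x\<in>grid_lattice h - \<Omega>. w1 x = \<theta> x * v x" "energy_le h UNIV w1 (C1 * (c * K))"
      using e1[OF h(1) h12(1) E1] \<theta>(3) by auto
    have "\<forall>x\<in>grid_lattice h - \<Omega>. (1 - \<theta> x) * v x \<noteq> 0 \<longrightarrow> (\<exists>z\<in>frontier \<Omega>. dist z x < \<eta>) \<longrightarrow> (\<exists>(p, r) \<in> set ps. x \<in> ball p (r/2))"
    proof (intro ballI impI)
      fix x assume x: "x \<in> grid_lattice h - \<Omega>" "(1 - \<theta> x) * v x \<noteq> 0" "\<exists>z\<in>frontier \<Omega>. dist z x < \<eta>"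
      then have "x \<notin> ball p (r/2)" using \<theta>(4)[of x] by auto
      moreover have "\<exists>(p, r) \<in> set (pr # ps). x \<in> ball p (r/2)" using v x by auto
      ultimately show "\<exists>(p, r) \<in> set ps. x \<in> ball p (r/2)" using pr by auto
    qed
    from e2[OF h(1) h12(2) E2 M2 this]
    obtain w2 where w2: "\<forall>x\<in>grid_lattice h - \<Omega>. w2 x = (1 - \<theta> x) * v x" "energy_le h UNIV w2 (C2 * (c * K))"
      by auto
    show "\<exists>w. (\<forall>x\<in>grid_lattice h - \<Omega>. w x = v x) \<and> energy_le h UNIV w ((2 * (C1 * c) + 2 * (C2 * c)) * K)"
      using energy_le_add[OF w1(2) w2(2)] w1(1) w2(1)
      by (intro exI[of _ "\<lambda>x. w1 x + w2 x"]) (auto simp: algebra_simps)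
  qed (use p1 p2 c in auto)
qed

lemma discrete_extension:
  fixes \<Omega> Q :: "(real^'n) set"
  assumes "open \<Omega>" "C2_boundary \<Omega>" "connected (- closure \<Omega>)" "closure \<Omega> \<subseteq> Q" "compact Q"
  shows "\<exists>C\<ge>0. \<exists>h0>0. \<forall>h v K. 0 < h \<longrightarrow> h \<le> h0 \<longrightarrow>
     (\<forall>x. x \<notin> Q \<longrightarrow> v x = 0) \<longrightarrow> energy_le h (- \<Omega>) v K \<longrightarrow>
     (\<exists>w. (\<forall>x\<in>grid_lattice h - \<Omega>. w x = v x) \<and> energy_le h UNIV w (C * K))"
proof -
  obtain Cp hp where pp: "Cp \<ge> 0" "hp > 0"
    and poincare: "\<And>h v K. 0 < h \<Longrightarrow> h \<le> hp \<Longrightarrow> (\<forall>x. x \<notin> Q \<longrightarrow> v x = 0) \<Longrightarrow>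
      energy_le h (- \<Omega>) v K \<Longrightarrow> mass_le h (- \<Omega>) v (Cp * K / h\<^sup>2)"
    using discrete_poincare[OF assms] by blast
  obtain r where r: "\<And>p. p \<in> frontier \<Omega> \<Longrightarrow> r p > 0 \<and> extendable \<Omega> p (r p)"
    using frontier_extendable[OF assms(1,2)] by metis
  have "bounded \<Omega>" using assms(4,5) closure_subset[of \<Omega>]
    by (meson bounded_subset compact_imp_bounded)
  then have cpt: "compact (frontier \<Omega>)" by (rule compact_frontier_bounded)
  have cov: "frontier \<Omega> \<subseteq> (\<Union>p\<in>frontier \<Omega>. ball p (r p / 2))" using r by force
  obtain D where D: "D \<subseteq> frontier \<Omega>" "finite D" "frontier \<Omega> \<subseteq> (\<Union>p\<in>D. ball p (r p / 2))"
    by (rule compactE_image[OF cpt _ cov]) auto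
  \<comment> \<open>The half balls cover a whole neighbourhood of the compact frontier; its width is
    the scale at which extension by zero takes over.\<close>
  obtain \<eta> where \<eta>: "\<eta> > 0" "(\<Union>z\<in>frontier \<Omega>. ball z \<eta>) \<subseteq> (\<Union>p\<in>D. ball p (r p / 2))"
    by (rule compact_subset_open_imp_ball_epsilon_subset[OF cpt _ D(3)]) auto
  obtain ps where ps: "set ps = D" using D(2) finite_list by blast
  define qs where "qs = map (\<lambda>p. (p, r p)) ps"
  have "\<forall>(p, r) \<in> set qs. r > 0 \<and> extendable \<Omega> p r" using r D(1) ps by (auto simp: qs_def)
  from extension_cover[OF this \<eta>(1)]
  obtain C h0 where C: "C \<ge> 0" "h0 > 0"
    and e: "\<And>h v K. 0 < h \<Longrightarrow> h \<le> h0 \<Longrightarrow>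
     energy_le h (- \<Omega>) v K \<Longrightarrow> mass_le h (- \<Omega>) v (K / h\<^sup>2) \<Longrightarrow>
     (\<forall>x\<in>grid_lattice h - \<Omega>. v x \<noteq> 0 \<longrightarrow> (\<exists>z\<in>frontier \<Omega>. dist z x < \<eta>) \<longrightarrow> (\<exists>(p, r) \<in> set qs. x \<in> ball p (r/2))) \<Longrightarrow>
     (\<exists>w. (\<forall>x\<in>grid_lattice h - \<Omega>. w x = v x) \<and> energy_le h UNIV w (C * K))"
    by blast
  show ?thesis
  proof (rule exI[of _ "C * (1 + Cp)"], rule conjI[rotated], rule exI[of _ "min h0 hp"], rule conjI[rotated],
      intro allI impI)
    fix h v K assume h: "0 < h" "h \<le> min h0 hp" and v: "\<forall>x. x \<notin> Q \<longrightarrow> v x = 0" and E: "energy_le h (- \<Omega>) v K"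
    have K: "0 \<le> K" "0 \<le> Cp * K" using energy_le_nonneg[OF E] pp by auto
    have h12: "h \<le> h0" "h \<le> hp" using h by auto
    have "Cp * K / h\<^sup>2 \<le> (1 + Cp) * K / h\<^sup>2" using K by (intro divide_right_mono) (auto simp: algebra_simps)
    from mass_le_mono[OF poincare[OF h(1) h12(2) v E] order.refl this]
    have m: "mass_le h (- \<Omega>) v ((1 + Cp) * K / h\<^sup>2)" .
    \<comment> \<open>The covering lemma shares one constant between energy and mass, so the energy
      bound is weakened to match the Poincare bound.\<close>
    have E': "energy_le h (- \<Omega>) v ((1 + Cp) * K)"
      by (rule energy_le_mono[OF E]) (use K in \<open>auto simp: algebra_simps\<close>)
    have "\<forall>x\<in>grid_lattice h - \<Omega>. v x \<noteq> 0 \<longrightarrow> (\<exists>z\<in>frontier \<Omega>. dist z x < \<eta>) \<longrightarrow> (\<exists>(p, r) \<in> set qs. x \<in> ball p (r/2))"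
      using \<eta>(2) by (fastforce simp: qs_def ps)
    from e[OF h(1) h12(1) E' m this]
    show "\<exists>w. (\<forall>x\<in>grid_lattice h - \<Omega>. w x = v x) \<and> energy_le h UNIV w (C * (1 + Cp) * K)"
      by (simp add: mult.assoc)
  qed (use C pp in auto)
qed

section \<open>Dirichlet problems on one side of the interface\<close>

locale interface_setup = interface_grid \<Omega> "box a b" h X
  for \<Omega> :: "(real^'n::finite) set" and a b :: "real^'n" and h X +
  fixes \<delta> :: real
  assumes adm: "admissible_grid_size a b h" and nonempty: "\<Omega> \<noteq> {}" and sub_box: "\<Omega> \<subseteq> box a b"
    and \<delta>: "0 < \<delta>" and chosen: "chosen_points_ok \<delta>"
begin

section \<open>Geometry of the grid in the box\<close>

lemma h_pos: "0 < h" using adm by (simp add: admissible_grid_size_def)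

lemma closure_box_ab: "closure (box a b) = cbox a b"
  using nonempty sub_box by (intro closure_box) auto

lemma grid_pts_eq: "grid_pts = grid_lattice h \<inter> cbox a b"
  by (simp add: grid_pts_def grid_lattice_def closure_box_ab)

lemma bdry_pts_eq: "bdry_pts = grid_pts - box a b"
  unfolding bdry_pts_def frontier_def closure_box_ab grid_pts_eq interior_open[OF open_box] by auto

lemma pts_minus_eq: "pts_minus = grid_pts - pts_plus"
  by (auto simp: pts_minus_def pts_plus_def)

lemma plus_not_bdry: "pts_plus \<inter> bdry_pts = {}"
  using sub_box by (auto simp: pts_plus_def bdry_pts_eq)

lemma bdry_minus: "bdry_pts \<subseteq> pts_minus"
  using plus_not_bdry by (auto simp: pts_minus_eq bdry_pts_eq)

lemma grid_lattice_nth: "x \<in> grid_lattice h \<Longrightarrow> x $ i / h \<in> \<int>"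
  using h_pos by (auto simp: grid_lattice_def)

lemma finite_grid: "finite grid_pts"
proof -
  define S where "S = (\<Pi>\<^sub>E i\<in>(UNIV::'n set). {\<lfloor>a $ i / h\<rfloor>..\<lfloor>b $ i / h\<rfloor>})"
  have "finite S" unfolding S_def by (intro finite_PiE) auto
  moreover have "grid_pts \<subseteq> (\<lambda>g. \<chi> i. h * of_int (g i)) ` S"
  proof
    fix x assume x: "x \<in> grid_pts"
    have "a $ i \<le> x $ i" "x $ i \<le> b $ i" for i using x by (auto simp: grid_pts_eq mem_box_cart)
    then have "\<lfloor>a $ i / h\<rfloor> \<le> \<lfloor>x $ i / h\<rfloor>" "\<lfloor>x $ i / h\<rfloor> \<le> \<lfloor>b $ i / h\<rfloor>" for i
      using h_pos by (auto intro!: floor_mono divide_right_mono)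
    then have "(\<lambda>i. \<lfloor>x $ i / h\<rfloor>) \<in> S" by (auto simp: S_def)
    moreover have "x = (\<chi> i. h * of_int \<lfloor>x $ i / h\<rfloor>)"
      using grid_lattice_nth[of x] x h_pos by (simp add: vec_eq_iff grid_pts_eq of_int_floor)
    ultimately show "x \<in> (\<lambda>g. \<chi> i. h * of_int (g i)) ` S"
      unfolding image_iff by (intro bexI[of _ "\<lambda>i. \<lfloor>x $ i / h\<rfloor>"])
  qed
  ultimately show ?thesis by (rule finite_surj)
qed

lemma integral_step:
  assumes "x / h \<in> \<int>" "y / h \<in> \<int>" "x < y"
  shows "x + h \<le> y"
proof -
  obtain k m where "x / h = of_int k" "y / h = of_int m" using assms(1,2) by (auto elim!: Ints_cases)
  then have xy: "x = of_int k * h" "y = of_int m * h" using h_pos by (auto simp: field_simps)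
  then have "k < m" using assms(3) h_pos by simp
  then have "of_int (k + 1) * h \<le> of_int m * h" using h_pos by (intro mult_right_mono) linarith+
  then show ?thesis by (simp add: xy algebra_simps)
qed

text \<open>The faces of the box lie in grid hyperplanes, so a grid point in the open box is at
  least one full step away from every face.\<close>

lemma neighbour_grid:
  assumes "x \<in> grid_pts - bdry_pts"
  shows "x + h *\<^sub>R axis i 1 \<in> grid_pts" "x - h *\<^sub>R axis i 1 \<in> grid_pts"
proof -
  have x: "x \<in> grid_lattice h" "x \<in> box a b" using assms by (auto simp: grid_pts_eq bdry_pts_eq)
  have l: "x $ j / h \<in> \<int>" for j using grid_lattice_nth[OF x(1)] .
  have ab: "a $ j / h \<in> \<int>" "b $ j / h \<in> \<int>" for j using adm by (auto simp: admissible_grid_size_def)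
  have lt: "a $ j < x $ j" "x $ j < b $ j" for j using x(2) by (auto simp: mem_box_cart)
  have le: "a $ j + h \<le> x $ j" "x $ j + h \<le> b $ j" for j
    using integral_step[OF ab(1) l lt(1)] integral_step[OF l ab(2) lt(2)] by auto
  have le': "a $ j \<le> x $ j" "x $ j \<le> b $ j" "a $ j \<le> x $ j + h" "x $ j - h \<le> b $ j" for j
    using le[of j] h_pos by linarith+
  show "x + h *\<^sub>R axis i 1 \<in> grid_pts" "x - h *\<^sub>R axis i 1 \<in> grid_pts"
    using grid_lattice_step[OF x(1)] le le' by (auto simp: grid_pts_eq mem_box_cart axis_def algebra_simps)
qed

lemma frac_bounds:
  assumes "I \<in> intervals_cut"
  shows "\<delta> \<le> frac_pos I" "\<delta> \<le> 1 - frac_pos I"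
proof -
  have I: "X I \<in> closed_segment (lower I) (upper I)" "\<delta> * h \<le> dist (X I) (lower I)" "\<delta> * h \<le> dist (X I) (upper I)"
    using chosen assms by (auto simp: chosen_points_ok_def)
  obtain t where t: "0 \<le> t" "t \<le> 1" "X I = (1 - t) *\<^sub>R lower I + t *\<^sub>R upper I"
    using I(1) by (auto simp: closed_segment_def)
  then have X: "X I = lower I + (t * h) *\<^sub>R axis (snd I) 1"
    by (simp add: lower_def upper_def algebra_simps)
  have "frac_pos I = t" using h_pos by (simp add: frac_pos_def X)
  moreover have "dist (X I) (lower I) = t * h" unfolding X using h_pos t(1) by (simp add: dist_norm)
  moreover have "dist (X I) (upper I) = (1 - t) * h"
  proof -
    have "X I - upper I = - ((1 - t) * h) *\<^sub>R axis (snd I) 1"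
      by (simp add: X upper_def lower_def algebra_simps)
    then show ?thesis using h_pos t by (simp add: dist_norm)
  qed
  ultimately show "\<delta> \<le> frac_pos I" "\<delta> \<le> 1 - frac_pos I" using I h_pos by auto
qed

lemma upper_lower: "upper I = lower I + h *\<^sub>R axis (snd I) 1"
  by (simp add: upper_def lower_def)

section \<open>Linear structure of one-sided functions\<close>

definition comb :: "real \<Rightarrow> 'n side_function \<Rightarrow> 'n side_function \<Rightarrow> 'n side_function" where
  "comb c u w = (\<lambda>x. c * fst u x + fst w x, \<lambda>I. c * snd u I + snd w I)"

lemma end_value_comb: "end_value P (comb c u w) I y = c * end_value P u I y + end_value P w I y"
  by (simp add: end_value_def comb_def)

lemma D_comb: "D P (comb c u w) I = c * D P u I + D P w I"
  using h_pos by (simp add: D_def end_value_comb field_simps)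

lemma M_comb: "M P (comb c u w) I = c * M P u I + M P w I"
  by (simp add: M_def end_value_comb algebra_simps)

lemma lap_comb: "lap P (comb c u w) x = c * lap P u x + lap P w x"
proof -
  have "lap P (comb c u w) x = (\<Sum>\<nu>\<in>UNIV.
     c * (end_value P u (x, \<nu>) (x + h *\<^sub>R axis \<nu> 1) + end_value P u (x - h *\<^sub>R axis \<nu> 1, \<nu>) (x - h *\<^sub>R axis \<nu> 1) - 2 * fst u x)
     + (end_value P w (x, \<nu>) (x + h *\<^sub>R axis \<nu> 1) + end_value P w (x - h *\<^sub>R axis \<nu> 1, \<nu>) (x - h *\<^sub>R axis \<nu> 1) - 2 * fst w x)) / h\<^sup>2"
    unfolding lap_def end_value_comb by (simp add: comb_def algebra_simps)
  then show ?thesis by (simp add: lap_def sum.distrib sum_distrib_left add_divide_distrib)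
qed

lemma F_gamma_comb: "\<psi> \<in> F_gamma \<Longrightarrow> \<zeta> \<in> F_gamma \<Longrightarrow> (\<lambda>I. c * \<psi> I + \<zeta> I) \<in> F_gamma"
  by (auto simp: F_gamma_def)

lemma zero_F_gamma: "(\<lambda>_. 0) \<in> F_gamma"
  by (auto simp: F_gamma_def)

lemma M_F_gamma: "M P u \<in> F_gamma"
  by (auto simp: F_gamma_def M_def)

text \<open>Any fixed coordinate direction serves to march towards the boundary of the box.\<close>

definition steps :: "real^'n \<Rightarrow> nat" where
  "steps x = nat \<lceil>(b $ undefined - x $ undefined) / h\<rceil>"

lemma steps_less:
  assumes "x \<in> grid_pts - bdry_pts"
  shows "steps (x + h *\<^sub>R axis undefined 1) < steps x"
proof -
  have "x $ undefined < b $ undefined" using assms by (auto simp: grid_pts_eq bdry_pts_eq mem_box_cart)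
  then have pos: "(b $ undefined - x $ undefined) / h > 0" using h_pos by simp
  have "(b $ undefined - (x + h *\<^sub>R axis undefined 1) $ undefined) / h = (b $ undefined - x $ undefined) / h - 1"
    using h_pos by (simp add: field_simps)
  then show ?thesis using pos unfolding steps_def by simp
qed

text \<open>Every grid line in the chosen direction reaches the boundary of the box, from where a
  property can be pulled back point by point. This turns vanishing differences into vanishing
  values.\<close>

lemma march_induct [consumes 1, case_names bdry step]:
  assumes "x \<in> grid_pts"
    and "\<And>x. x \<in> bdry_pts \<Longrightarrow> Q x"
    and "\<And>x. x \<in> grid_pts - bdry_pts \<Longrightarrow> x + h *\<^sub>R axis undefined 1 \<in> grid_pts \<Longrightarrow>
      Q (x + h *\<^sub>R axis undefined 1) \<Longrightarrow> Q x"
  shows "Q x"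
  using assms(1)
proof (induction "steps x" arbitrary: x rule: less_induct)
  case less
  show ?case
  proof (cases "x \<in> bdry_pts")
    case False
    then have x: "x \<in> grid_pts - bdry_pts" using less(2) by auto
    show ?thesis using assms(3)[OF x neighbour_grid(1)[OF x] less(1)[OF steps_less[OF x] neighbour_grid(1)[OF x]]] .
  qed (rule assms(2))
qed

end

text \<open>Both sides are instances. \<open>N\<close> collects the points where the Laplace
  equation is imposed and the values are free; on the outer side this leaves out the boundary of the
  box.\<close>

locale one_side = interface_setup \<Omega> a b h X \<delta>
  for \<Omega> :: "(real^'n::finite) set" and a b :: "real^'n" and h X \<delta> +
  fixes P :: "(real^'n) set"
  assumes P_cases: "P = pts_plus \<or> P = pts_minus"
begin

definition N where "N = P - bdry_pts"
definition ivs where "ivs = {I. lower I \<in> P \<and> upper I \<in> P}"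
definition E where "E = ivs \<union> intervals_cut"
text \<open>On a cut interval this is the fraction between the end in \<open>P\<close> and the
  chosen point: \<open>xi\<close> for the inner side, \<open>1 - xi\<close> for the outer
  one.\<close>

definition wt where "wt I = (if I \<in> ivs then 1 else if lower I \<in> P then frac_pos I else 1 - frac_pos I)"
text \<open>Orientation of a cut interval as seen from \<open>P\<close>, so that
  \<open>sg I * D P u I\<close> is the outward difference quotient.\<close>

definition sg :: "'n grid_interval \<Rightarrow> real" where "sg I = (if lower I \<in> P then 1 else -1)"
definition inner where "inner I = (if lower I \<in> P then lower I else upper I)"
definition FP where "FP = {(u, e). (\<forall>x. x \<notin> N \<longrightarrow> u x = (0::real)) \<and> e \<in> F_gamma}"
definition en where "en u z = (\<Sum>I\<in>E. D P u I * D P z I * wt I)"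

section \<open>Weights and Green's identity on one side\<close>

lemma P_grid: "P \<subseteq> grid_pts"
  using P_cases by (auto simp: pts_plus_def pts_minus_def)

lemma finite_N: "finite N" using P_grid finite_grid by (auto simp: N_def intro: finite_subset)

lemma cut_iff: "I \<in> intervals_cut \<longleftrightarrow>
    lower I \<in> P \<and> upper I \<in> grid_pts - P \<or> lower I \<in> grid_pts - P \<and> upper I \<in> P"
  using P_cases by (auto simp: intervals_cut_def pts_minus_eq pts_plus_def)

lemma E_iff: "I \<in> E \<longleftrightarrow> lower I \<in> grid_pts \<and> upper I \<in> grid_pts \<and> (lower I \<in> P \<or> upper I \<in> P)"
  using P_grid by (auto simp: E_def ivs_def cut_iff)

lemma finite_E: "finite E"
proof (rule finite_subset)
  show "E \<subseteq> grid_pts \<times> UNIV" by (auto simp: E_iff lower_def)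
qed (use finite_grid in auto)

lemma finite_cut: "finite intervals_cut"
  using finite_E by (auto simp: E_def)

lemma ivs_cut: "I \<in> ivs \<Longrightarrow> I \<notin> intervals_cut"
  by (auto simp: ivs_def cut_iff)

lemma wt_bounds: "I \<in> intervals_cut \<Longrightarrow> \<delta> \<le> wt I" "I \<in> intervals_cut \<Longrightarrow> wt I \<le> 1 - \<delta>"
  using frac_bounds[of I] ivs_cut[of I] by (auto simp: wt_def)

lemma wt_pos: "I \<in> E \<Longrightarrow> 0 < wt I"
  using wt_bounds(1)[of I] \<delta> by (auto simp: E_def wt_def)

lemma M_eq: "I \<in> intervals_cut \<Longrightarrow> M P z I = fst z (inner I) + sg I * wt I * h * D P z I"
  using h_pos ivs_cut[of I] by (auto simp: M_def cut_iff inner_def sg_def wt_def D_def end_value_def field_simps)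

lemma lap_eq:
  assumes "x \<in> P"
  shows "lap P u x = (\<Sum>\<nu>\<in>UNIV. D P u (x, \<nu>) - D P u (x - h *\<^sub>R axis \<nu> 1, \<nu>)) / h"
proof -
  have "h * D P u (x, \<nu>) - h * D P u (x - h *\<^sub>R axis \<nu> 1, \<nu>) = end_value P u (x, \<nu>) (x + h *\<^sub>R axis \<nu> 1)
     + end_value P u (x - h *\<^sub>R axis \<nu> 1, \<nu>) (x - h *\<^sub>R axis \<nu> 1) - 2 * fst u x" for \<nu>
    using h_pos assms by (simp add: D_def upper_def lower_def end_value_def)
  then have "lap P u x = (\<Sum>\<nu>\<in>UNIV. h * (D P u (x, \<nu>) - D P u (x - h *\<^sub>R axis \<nu> 1, \<nu>))) / h\<^sup>2"
    unfolding lap_def right_diff_distrib by presburger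
  then show ?thesis using h_pos by (simp add: sum_distrib_left[symmetric] power2_eq_square)
qed

text \<open>Summation by parts from which the extended values of \<open>z\<close> disappear: with
  the weight \<open>wt\<close>, a cut interval contributes exactly the interpolated value
  \<open>M P z I\<close> minus the value at its inner end, by \<open>M_eq\<close>. The weights in
  the inner product serve this purpose.\<close>

lemma green:
  assumes z: "z \<in> FP"
  shows "en u z = - (\<Sum>x\<in>N. lap P u x * fst z x) + (\<Sum>I\<in>intervals_cut. sg I * D P u I * M P z I) / h"
proof -
  define Z where "Z = fst z"
  have Z0: "Z x = 0" if "x \<notin> N" for x using z that by (auto simp: FP_def Z_def)
  \<comment> \<open>\<open>G1\<close> and \<open>G2\<close> are the contributions of the lower and
    the upper endpoint of an edge; an end with an extended value contributes nothing.\<close>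
  define G1 where "G1 I = D P u I * (if lower I \<in> P then Z (lower I) else 0)" for I
  define G2 where "G2 I = D P u I * (if upper I \<in> P then Z (upper I) else 0)" for I
  have NP: "x \<in> N \<Longrightarrow> x \<in> P" "x \<in> N \<Longrightarrow> x \<in> grid_pts - bdry_pts" for x using P_grid by (auto simp: N_def)
  have 1: "(\<Sum>x\<in>N. \<Sum>\<nu>\<in>UNIV. D P u (x, \<nu>) * Z x) = (\<Sum>I\<in>E. G1 I)"
  proof -
    have "(\<Sum>x\<in>N. \<Sum>\<nu>\<in>UNIV. D P u (x, \<nu>) * Z x) = (\<Sum>I\<in>N \<times> UNIV. G1 I)"
      using NP by (subst sum.cartesian_product) (auto intro!: sum.cong simp: G1_def lower_def)
    also have "\<dots> = (\<Sum>I\<in>E. G1 I)"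
    proof (rule sum.mono_neutral_left[OF finite_E])
      show "N \<times> UNIV \<subseteq> E" using NP neighbour_grid by (auto simp: E_iff lower_def upper_def)
      show "\<forall>I\<in>E - N \<times> UNIV. G1 I = 0"
      proof
        fix I :: "'n grid_interval" assume "I \<in> E - N \<times> UNIV"
        then have "lower I \<notin> N" by (cases I) (auto simp: lower_def)
        then show "G1 I = 0" using Z0 by (simp add: G1_def)
      qed
    qed
    finally show ?thesis .
  qed
  have 2: "(\<Sum>x\<in>N. \<Sum>\<nu>\<in>UNIV. D P u (x - h *\<^sub>R axis \<nu> 1, \<nu>) * Z x) = (\<Sum>I\<in>E. G2 I)"
  proof -
    define s :: "'n grid_interval \<Rightarrow> 'n grid_interval" where "s I = (fst I - h *\<^sub>R axis (snd I) 1, snd I)" for I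
    have inj: "inj_on s (N \<times> UNIV)" by (auto simp: inj_on_def s_def)
    have up: "upper (s I) = fst I" for I by (simp add: s_def upper_def)
    have "(\<Sum>x\<in>N. \<Sum>\<nu>\<in>UNIV. D P u (x - h *\<^sub>R axis \<nu> 1, \<nu>) * Z x) = (\<Sum>I\<in>N \<times> UNIV. G2 (s I))"
      using NP by (subst sum.cartesian_product) (auto intro!: sum.cong simp: G2_def up, auto simp: s_def)
    also have "\<dots> = (\<Sum>I\<in>s ` (N \<times> UNIV). G2 I)" by (simp add: sum.reindex[OF inj])
    also have "\<dots> = (\<Sum>I\<in>E. G2 I)"
    proof (rule sum.mono_neutral_left[OF finite_E])
      show "s ` (N \<times> UNIV) \<subseteq> E" using NP neighbour_grid by (auto simp: E_iff up) (auto simp: s_def lower_def)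
      show "\<forall>I\<in>E - s ` (N \<times> UNIV). G2 I = 0"
      proof
        fix I assume I: "I \<in> E - s ` (N \<times> UNIV)"
        have "I = s (upper I, snd I)" by (simp add: s_def upper_def)
        then have "upper I \<notin> N" using I by blast
        then show "G2 I = 0" using Z0 by (simp add: G2_def)
      qed
    qed
    finally show ?thesis .
  qed
  have "(\<Sum>x\<in>N. lap P u x * Z x) = (\<Sum>x\<in>N. (\<Sum>\<nu>\<in>UNIV. D P u (x, \<nu>) * Z x) - (\<Sum>\<nu>\<in>UNIV. D P u (x - h *\<^sub>R axis \<nu> 1, \<nu>) * Z x)) / h"
    using NP by (simp add: lap_eq sum_divide_distrib sum_distrib_right sum_subtractf[symmetric] left_diff_distrib)
  also have "\<dots> = ((\<Sum>I\<in>E. G1 I) - (\<Sum>I\<in>E. G2 I)) / h"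
    by (simp add: sum_subtractf 1 2)
  finally have L: "(\<Sum>x\<in>N. lap P u x * Z x) = (\<Sum>I\<in>E. (G1 I - G2 I) / h)"
    by (simp add: sum_subtractf sum_divide_distrib diff_divide_distrib)
  have "en u z = (\<Sum>I\<in>E. - ((G1 I - G2 I) / h) + (if I \<in> intervals_cut then sg I * D P u I * M P z I / h else 0))"
    unfolding en_def
  proof (rule sum.cong[OF refl])
    fix I assume I: "I \<in> E"
    show "D P u I * D P z I * wt I = - ((G1 I - G2 I) / h) + (if I \<in> intervals_cut then sg I * D P u I * M P z I / h else 0)"
    proof (cases "I \<in> intervals_cut")
      case True
      have "G1 I - G2 I = sg I * D P u I * Z (inner I)" "sg I * sg I = 1"
        using True by (auto simp: cut_iff G1_def G2_def sg_def inner_def)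
      then show ?thesis using True h_pos by (auto simp: M_eq Z_def field_simps)
    next
      case False
      then have i: "I \<in> ivs" using I by (auto simp: E_def)
      then have "D P z I = (Z (upper I) - Z (lower I)) / h"
        by (auto simp: ivs_def D_def end_value_def Z_def)
      moreover have "G1 I = D P u I * Z (lower I)" "G2 I = D P u I * Z (upper I)" "wt I = 1"
        using i by (auto simp: G1_def G2_def ivs_def wt_def)
      ultimately show ?thesis using False by (simp add: diff_divide_distrib right_diff_distrib)
    qed
  qed
  also have "\<dots> = - (\<Sum>I\<in>E. (G1 I - G2 I) / h) + (\<Sum>I\<in>E \<inter> intervals_cut. sg I * D P u I * M P z I / h)"
    unfolding sum.distrib sum_negf using finite_E by (simp add: sum.inter_restrict)
  also have "E \<inter> intervals_cut = intervals_cut" by (auto simp: E_def)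
  finally show ?thesis unfolding L[symmetric] by (simp add: Z_def sum_divide_distrib)
qed

lemma en_sym: "en u z = en z u"
  by (simp add: en_def mult_ac)

lemma summand_nonneg: "I \<in> E \<Longrightarrow> 0 \<le> D P u I * D P u I * wt I"
  by (intro mult_nonneg_nonneg zero_le_square less_imp_le wt_pos)

lemma en_nonneg: "0 \<le> en u u"
  unfolding en_def by (intro sum_nonneg summand_nonneg)

lemma en_comb: "en (comb c u w) z = c * en u z + en w z"
  by (simp add: en_def D_comb sum.distrib sum_distrib_left algebra_simps)

lemma en_zero_D:
  assumes "en u u = 0" "I \<in> E"
  shows "D P u I = 0"
proof -
  have "D P u I * D P u I * wt I = 0"
    using assms unfolding en_def
    by (subst (asm) sum_nonneg_eq_0_iff[OF finite_E])
      (blast intro: summand_nonneg)+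
  then show ?thesis using wt_pos[OF assms(2)] by simp
qed

lemma FP_comb: "u \<in> FP \<Longrightarrow> w \<in> FP \<Longrightarrow> comb c u w \<in> FP"
  by (auto simp: FP_def comb_def F_gamma_def)

section \<open>Solvability of the one-sided Dirichlet problem\<close>

definition solves where
  "solves \<psi> u \<longleftrightarrow> u \<in> FP \<and> (\<forall>x\<in>N. lap P u x = 0) \<and> M P u = \<psi>"

lemma solves_comb: "solves \<psi> u \<Longrightarrow> solves \<zeta> w \<Longrightarrow> solves (\<lambda>I. c * \<psi> I + \<zeta> I) (comb c u w)"
  by (auto simp: solves_def FP_comb lap_comb M_comb)

lemma solves_green: "solves \<psi> u \<Longrightarrow> z \<in> FP \<Longrightarrow> en u z = (\<Sum>I\<in>intervals_cut. sg I * D P u I * M P z I) / h"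
  by (simp add: green solves_def)

lemma D_zero_inner:
  assumes "D P u I = 0" "I \<in> intervals_cut"
  shows "fst u (inner I) = M P u I" "snd u I = M P u I"
  using assms h_pos M_eq[OF assms(2), of u] by (auto simp: cut_iff D_def end_value_def inner_def)

text \<open>Zero energy makes all differences vanish. Marching along a grid line, one meets either a
  cut interval, where the inner value equals the datum 0, or the boundary of the box.\<close>

lemma solves_zero:
  assumes "solves (\<lambda>_. 0) u"
  shows "u = (\<lambda>_. 0, \<lambda>_. 0)"
proof -
  have FP: "u \<in> FP" and M0: "M P u = (\<lambda>_. 0)" using assms by (auto simp: solves_def)
  have "en u u = 0" using solves_green[OF assms FP] M0 by simp
  then have D0: "D P u I = 0" if "I \<in> E" for I using en_zero_D that by blast
  have bd: "fst u x = 0" if "x \<notin> N" for x using FP that by (auto simp: FP_def)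
  have "x \<in> P \<longrightarrow> fst u x = 0" if "x \<in> grid_pts" for x
    using that
  proof (induction rule: march_induct)
    case (bdry x)
    then show ?case using bd by (auto simp: N_def)
  next
    case (step x)
    show ?case
    proof
      assume x: "x \<in> P"
      define I where "I = (x, undefined :: 'n)"
      have lu: "lower I = x" "upper I = x + h *\<^sub>R axis undefined 1" by (auto simp: I_def lower_def upper_def)
      have I: "I \<in> E" using x step P_grid by (auto simp: E_iff lu)
      show "fst u x = 0"
      proof (cases "upper I \<in> P")
        case True
        then show ?thesis using D0[OF I] step x h_pos by (simp add: D_def lu end_value_def)
      next
        case False
        then have "I \<in> intervals_cut" using I x by (auto simp: E_def ivs_def lu)
        from D_zero_inner(1)[OF D0[OF I] this] show ?thesis using M0 x by (simp add: inner_def lu)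
      qed
    qed
  qed
  then have "fst u x = 0" for x using bd[of x] P_grid by (auto simp: N_def)
  moreover have "snd u I = 0" for I
  proof (cases "I \<in> intervals_cut")
    case True
    then have "I \<in> E" by (simp add: E_def)
    from D_zero_inner(2)[OF D0[OF this] True] show ?thesis using M0 by simp
  next
    case False
    then show ?thesis using FP by (cases u, cases I) (auto simp: FP_def F_gamma_def)
  qed
  ultimately show ?thesis by (auto simp: prod_eq_iff)
qed

lemma solves_unique:
  assumes "solves \<psi> u" "solves \<psi> w"
  shows "u = w"
proof -
  have "solves (\<lambda>I. (-1) * \<psi> I + \<psi> I) (comb (-1) u w)" using assms by (rule solves_comb)
  then have "comb (-1) u w = (\<lambda>_. 0, \<lambda>_. 0)" by (intro solves_zero) simp
  then show ?thesis by (auto simp: comb_def prod_eq_iff fun_eq_iff)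
qed

text \<open>Unknowns and equations share one index set: a grid value and a Laplace equation for each
  point of \<open>N\<close>, an extended value and an interpolation condition for each cut interval.
  Uniqueness then gives existence.\<close>

lemma solves_exists:
  assumes "\<psi> \<in> F_gamma"
  shows "\<exists>u. solves \<psi> u"
proof -
  define enc :: "((real^'n) + 'n grid_interval \<Rightarrow> real) \<Rightarrow> 'n side_function"
    where "enc f = (\<lambda>x. f (Inl x), \<lambda>I. f (Inr I))" for f
  define T where "T f i = (case i of Inl x \<Rightarrow> lap P (enc f) x | Inr I \<Rightarrow> M P (enc f) I)" for f i
  have "\<exists>f. (\<forall>i. i \<notin> N <+> intervals_cut \<longrightarrow> f i = 0) \<and>
      (\<forall>i\<in>N <+> intervals_cut. T f i = (case i of Inl x \<Rightarrow> 0 | Inr I \<Rightarrow> \<psi> I))"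
  proof (rule finite_support_linear_surj)
    show "finite (N <+> intervals_cut)" using finite_N finite_cut by simp
    show "T (\<lambda>x. c * f x + g x) i = c * T f i + T g i" for c f g i
    proof -
      have "enc (\<lambda>x. c * f x + g x) = comb c (enc f) (enc g)" by (simp add: enc_def comb_def)
      then show ?thesis by (simp add: T_def lap_comb M_comb split: sum.split)
    qed
    fix f assume f: "\<And>i. i \<notin> N <+> intervals_cut \<Longrightarrow> f i = 0" "\<And>i. i \<in> N <+> intervals_cut \<Longrightarrow> T f i = 0"
    have "M P (enc f) I = 0" for I
      using f(2)[of "Inr I"] by (cases "I \<in> intervals_cut") (auto simp: T_def M_def)
    moreover have "lap P (enc f) x = 0" if "x \<in> N" for x
      using f(2)[of "Inl x"] that by (auto simp: T_def)
    moreover have "enc f \<in> FP" using f(1) by (auto simp: enc_def FP_def F_gamma_def)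
    ultimately have "enc f = (\<lambda>_. 0, \<lambda>_. 0)" by (intro solves_zero) (auto simp: solves_def)
    then have "f i = 0" for i by (cases i) (auto simp: enc_def fun_eq_iff)
    then show "f = (\<lambda>_. 0)" by blast
  qed
  then obtain f where f: "\<And>i. i \<notin> N <+> intervals_cut \<Longrightarrow> f i = 0"
    "\<And>i. i \<in> N <+> intervals_cut \<Longrightarrow> T f i = (case i of Inl x \<Rightarrow> 0 | Inr I \<Rightarrow> \<psi> I)" by blast
  have "M P (enc f) I = \<psi> I" for I
    using f(2)[of "Inr I"] assms by (cases I, cases "I \<in> intervals_cut") (auto simp: T_def M_def F_gamma_def)
  moreover have "lap P (enc f) x = 0" if "x \<in> N" for x
    using f(2)[of "Inl x"] that by (auto simp: T_def)
  moreover have "enc f \<in> FP" using f(1) by (auto simp: enc_def FP_def F_gamma_def)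
  ultimately have "solves \<psi> (enc f)" unfolding solves_def by blast
  then show ?thesis ..
qed

definition sol where "sol \<psi> = (THE u. solves \<psi> u)"

lemma solves_sol: "\<psi> \<in> F_gamma \<Longrightarrow> solves \<psi> (sol \<psi>)"
  unfolding sol_def using solves_exists solves_unique by (metis theI)

lemma sol_eq: "solves \<psi> u \<Longrightarrow> sol \<psi> = u"
  unfolding sol_def using solves_unique by blast

lemma sol_comb:
  "\<psi> \<in> F_gamma \<Longrightarrow> \<zeta> \<in> F_gamma \<Longrightarrow> sol (\<lambda>I. c * \<psi> I + \<zeta> I) = comb c (sol \<psi>) (sol \<zeta>)"
  by (intro sol_eq solves_comb solves_sol)

section \<open>Dirichlet-to-Neumann map and energy of traces\<close>

definition dtn where "dtn \<psi> I = sg I * D P (sol \<psi>) I"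

definition e where "e \<psi> \<zeta> = en (sol \<psi>) (sol \<zeta>)"

lemma dtn_comb:
  "\<psi> \<in> F_gamma \<Longrightarrow> \<zeta> \<in> F_gamma \<Longrightarrow> dtn (\<lambda>I. c * \<psi> I + \<zeta> I) I = c * dtn \<psi> I + dtn \<zeta> I"
  unfolding dtn_def sol_comb D_comb by (simp add: algebra_simps)

lemma e_green:
  assumes "\<psi> \<in> F_gamma" "\<zeta> \<in> F_gamma"
  shows "e \<psi> \<zeta> = (\<Sum>I\<in>intervals_cut. dtn \<psi> I * \<zeta> I) / h"
  using solves_green[OF solves_sol[OF assms(1)], of "sol \<zeta>"] solves_sol[OF assms(2)]
  by (simp add: e_def dtn_def solves_def)

lemma e_sym: "e \<psi> \<zeta> = e \<zeta> \<psi>" by (simp add: e_def en_sym)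

lemma e_nonneg: "0 \<le> e \<psi> \<psi>" by (simp add: e_def en_nonneg)

lemma e_comb: "\<psi> \<in> F_gamma \<Longrightarrow> \<zeta> \<in> F_gamma \<Longrightarrow> e (\<lambda>I. c * \<psi> I + \<zeta> I) \<eta> = c * e \<psi> \<eta> + e \<zeta> \<eta>"
  by (simp add: e_def sol_comb en_comb)

text \<open>The difference \<open>d\<close> between \<open>w\<close> and the solution has zero
  trace, so Green's identity makes it orthogonal to the solution and the energies add.\<close>

lemma dirichlet_principle:
  assumes "w \<in> FP" "M P w = \<psi>"
  shows "e \<psi> \<psi> \<le> en w w"
proof -
  have \<psi>: "\<psi> \<in> F_gamma" using assms(2) M_F_gamma by blast
  note s = solves_sol[OF \<psi>]
  define d where "d = comb (-1) (sol \<psi>) w"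
  have d: "d \<in> FP" "M P d = (\<lambda>_. 0)"
    using assms s by (auto simp: d_def FP_comb solves_def M_comb fun_eq_iff)
  have w: "w = comb 1 (sol \<psi>) d" by (simp add: d_def comb_def)
  have "en w w = en (sol \<psi>) w + en d w" by (subst w) (simp add: en_comb)
  also have "en (sol \<psi>) w = en (sol \<psi>) (sol \<psi>) + en (sol \<psi>) d"
    using en_comb[of 1 "sol \<psi>" d "sol \<psi>"] by (simp add: w[symmetric] en_sym)
  also have "en d w = en (sol \<psi>) d + en d d"
    using en_comb[of 1 "sol \<psi>" d d] by (simp add: w[symmetric] en_sym)
  finally have "en w w = en (sol \<psi>) (sol \<psi>) + 2 * en (sol \<psi>) d + en d d" by simp
  moreover have "en (sol \<psi>) d = 0" using solves_green[OF s d(1)] d(2) by simp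
  ultimately show ?thesis using en_nonneg[of d] by (simp add: e_def)
qed

end

section \<open>The layer operators\<close>

lemma nonneg_quadratic_discriminant:
  fixes A B C :: real
  assumes "\<And>t. 0 \<le> A * t\<^sup>2 + 2 * B * t + C"
  shows "B\<^sup>2 \<le> A * C"
proof (cases "A = 0")
  case True
  have "B = 0"
  proof (rule ccontr)
    assume "B \<noteq> 0"
    then show False using assms[of "- (C + 1) / (2 * B)"] True by (simp add: field_simps)
  qed
  then show ?thesis by (simp add: True)
next
  case False
  have "A > 0"
  proof (rule ccontr)
    assume "\<not> A > 0"
    then have "A < 0" using False by simp
    have "A * t\<^sup>2 + C \<ge> 0" for t using assms[of t] assms[of "-t"] by simp
    from this[of "sqrt ((C + 1) / (- A))"] this[of 0] show False
      using \<open>A < 0\<close> by (simp add: real_sqrt_pow2 divide_nonneg_neg field_simps)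
  qed
  have "0 \<le> A * (- B / A)\<^sup>2 + 2 * B * (- B / A) + C" by (rule assms)
  also have "\<dots> = C - B\<^sup>2 / A" using \<open>A > 0\<close> by (simp add: power2_eq_square field_simps)
  finally show ?thesis using \<open>A > 0\<close> by (simp add: field_simps)
qed

context interface_setup
begin

sublocale pl: one_side \<Omega> a b h X \<delta> pts_plus
  by unfold_locales auto

sublocale mi: one_side \<Omega> a b h X \<delta> pts_minus
  by unfold_locales auto

section \<open>The given definitions in terms of the two sides\<close>

lemma mem_minus: "x \<in> pts_minus \<longleftrightarrow> x \<in> grid_pts \<and> x \<notin> pts_plus"
  by (simp add: pts_minus_eq)

lemma pl_N: "pl.N = pts_plus"
  using plus_not_bdry by (auto simp: pl.N_def)

lemma pl_FP: "pl.FP = F_plus"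
  by (simp add: pl.FP_def F_plus_def pl_N)

lemma mi_FP: "mi.FP = F_minus"
  using bdry_minus by (auto simp: mi.FP_def F_minus_def mi.N_def)

lemma pl_ivs: "pl.ivs = intervals_plus"
  by (simp add: pl.ivs_def intervals_plus_def)

lemma mi_ivs: "mi.ivs = intervals_minus"
  by (simp add: mi.ivs_def intervals_minus_def)

lemma sg_minus: "I \<in> intervals_cut \<Longrightarrow> mi.sg I = - pl.sg I"
  by (auto simp: pl.sg_def mi.sg_def intervals_cut_def mem_minus)

lemma wt_plus: "I \<in> pl.E \<Longrightarrow> pl.wt I = xi I"
  by (auto simp: pl.wt_def xi_def pl.E_def pl_ivs intervals_minus_def intervals_cut_def mem_minus)

lemma wt_minus: "I \<in> mi.E \<Longrightarrow> mi.wt I = 1 - xi I"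
  by (auto simp: mi.wt_def xi_def mi.E_def mi_ivs intervals_minus_def intervals_plus_def intervals_cut_def mem_minus)

lemma harmonic_pair_iff:
  "discrete_harmonic_pair (u, v) \<longleftrightarrow> pl.solves (M pts_plus u) u \<and> mi.solves (M pts_minus v) v"
  by (auto simp: discrete_harmonic_pair_def pl.solves_def mi.solves_def pl_FP mi_FP pl_N mi.N_def)

lemma single_layer_iff: "is_single_layer \<psi> (u, v) \<longleftrightarrow> pl.solves \<psi> u \<and> mi.solves \<psi> v"
  by (auto simp: is_single_layer_def harmonic_pair_iff) (auto simp: pl.solves_def mi.solves_def)

lemma single_layer_unique:
  assumes "\<psi> \<in> F_gamma"
  shows "is_single_layer \<psi> p \<longleftrightarrow> p = (pl.sol \<psi>, mi.sol \<psi>)"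
proof -
  obtain u v where p: "p = (u, v)" by (cases p)
  show ?thesis unfolding p single_layer_iff
    using pl.solves_sol[OF assms] mi.solves_sol[OF assms] pl.sol_eq mi.sol_eq by blast
qed

lemma single_layer_eq: "\<psi> \<in> F_gamma \<Longrightarrow> single_layer \<psi> = (pl.sol \<psi>, mi.sol \<psi>)"
  unfolding single_layer_def by (rule the_equality) (simp_all add: single_layer_unique)

text \<open>The inner product without its factor \<open>h ^ CARD('n)\<close>, which cancels in all
  comparisons.\<close>

definition q where "q \<psi> \<zeta> = pl.e \<psi> \<zeta> + mi.e \<psi> \<zeta>"

lemma ip_eq:
  assumes "\<psi> \<in> F_gamma" "\<zeta> \<in> F_gamma"
  shows "ip \<psi> \<zeta> = h ^ CARD('n) * q \<psi> \<zeta>"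
proof -
  have 1: "(\<Sum>I\<in>intervals_plus \<union> intervals_cut. D pts_plus (pl.sol \<psi>) I * D pts_plus (pl.sol \<zeta>) I * xi I * h ^ CARD('n))
    = h ^ CARD('n) * pl.e \<psi> \<zeta>"
    unfolding pl.e_def pl.en_def sum_distrib_left pl_ivs[symmetric] pl.E_def[symmetric]
    by (intro sum.cong) (auto simp: wt_plus mult_ac)
  have 2: "(\<Sum>I\<in>intervals_minus \<union> intervals_cut. D pts_minus (mi.sol \<psi>) I * D pts_minus (mi.sol \<zeta>) I * (1 - xi I) * h ^ CARD('n))
    = h ^ CARD('n) * mi.e \<psi> \<zeta>"
    unfolding mi.e_def mi.en_def sum_distrib_left mi_ivs[symmetric] mi.E_def[symmetric]
    by (intro sum.cong) (auto simp: wt_minus mult_ac)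
  show ?thesis
    by (simp add: ip_def single_layer_eq assms 1 2 q_def) (simp add: algebra_simps)
qed

lemma q_sym: "q \<psi> \<zeta> = q \<zeta> \<psi>"
  by (simp add: q_def pl.e_sym[of \<psi>] mi.e_sym[of \<psi>])

lemma q_nonneg: "0 \<le> q \<psi> \<psi>" by (simp add: q_def pl.e_nonneg mi.e_nonneg)

lemma q_comb: "\<psi> \<in> F_gamma \<Longrightarrow> \<zeta> \<in> F_gamma \<Longrightarrow> q (\<lambda>I. c * \<psi> I + \<zeta> I) \<eta> = c * q \<psi> \<eta> + q \<zeta> \<eta>"
  by (simp add: q_def pl.e_comb mi.e_comb) (simp add: algebra_simps)

text \<open>The outward directions of the two sides are opposite, so up to sign this is the jump of
  the difference quotients of the single layer.\<close>

definition dtns where "dtns \<psi> I = pl.dtn \<psi> I + mi.dtn \<psi> I"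

lemma q_green:
  assumes "\<psi> \<in> F_gamma" "\<zeta> \<in> F_gamma"
  shows "q \<psi> \<zeta> = (\<Sum>I\<in>intervals_cut. dtns \<psi> I * \<zeta> I) / h"
  by (simp add: q_def pl.e_green[OF assms] mi.e_green[OF assms] dtns_def algebra_simps sum.distrib add_divide_distrib)

text \<open>Zero energy on both sides leaves no differences, and a cut interval links the sides
  because both of its ends carry \<open>\<psi> I\<close>. The glued function \<open>val\<close> is
  therefore constant along each grid line that is followed, and it vanishes on the boundary of the
  box.\<close>

lemma q_definite:
  assumes \<psi>: "\<psi> \<in> F_gamma" and q: "q \<psi> \<psi> = 0"
  shows "\<psi> = (\<lambda>_. 0)"
proof -
  have e0: "pl.en (pl.sol \<psi>) (pl.sol \<psi>) = 0" "mi.en (mi.sol \<psi>) (mi.sol \<psi>) = 0"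
    using q pl.e_nonneg[of \<psi>] mi.e_nonneg[of \<psi>] unfolding q_def pl.e_def mi.e_def by linarith+
  define u v where "u = pl.sol \<psi>" and "v = mi.sol \<psi>"
  have u: "M pts_plus u = \<psi>" "u \<in> pl.FP" and v: "M pts_minus v = \<psi>" "v \<in> mi.FP"
    using pl.solves_sol[OF \<psi>] mi.solves_sol[OF \<psi>] by (auto simp: u_def v_def pl.solves_def mi.solves_def)
  have Du: "D pts_plus u I = 0" if "I \<in> pl.E" for I using pl.en_zero_D[OF e0(1) that] by (simp add: u_def)
  have Dv: "D pts_minus v I = 0" if "I \<in> mi.E" for I using mi.en_zero_D[OF e0(2) that] by (simp add: v_def)
  have cut: "fst u (pl.inner I) = \<psi> I" "fst v (mi.inner I) = \<psi> I" if "I \<in> intervals_cut" for I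
    using pl.D_zero_inner(1)[OF Du that] mi.D_zero_inner(1)[OF Dv that] that u v
    by (auto simp: pl.E_def mi.E_def)
  define val where "val x = (if x \<in> pts_plus then fst u x else fst v x)" for x
  have val_cut: "val (lower I) = \<psi> I" "val (upper I) = \<psi> I" if "I \<in> intervals_cut" for I
    using cut[OF that] that by (auto simp: val_def pl.inner_def mi.inner_def intervals_cut_def mem_minus split: if_splits)
  have val: "val x = 0" if "x \<in> grid_pts" for x
    using that
  proof (induction rule: march_induct)
    case (bdry x)
    then show ?case using v(2) plus_not_bdry by (auto simp: val_def mi.FP_def mi.N_def)
  next
    case (step x)
    define I where "I = (x, undefined :: 'n)"
    have lu: "lower I = x" "upper I = x + h *\<^sub>R axis undefined 1" by (auto simp: I_def lower_def upper_def)
    have g: "lower I \<in> grid_pts" "upper I \<in> grid_pts" "val (upper I) = 0" using step by (auto simp: lu)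
    have "val (lower I) = 0"
    proof (cases "I \<in> intervals_cut")
      case True
      then show ?thesis using val_cut[OF True] g(3) by simp
    next
      case False
      show ?thesis
      proof (cases "lower I \<in> pts_plus")
        case True
        then have "upper I \<in> pts_plus" using False g by (auto simp: intervals_cut_def mem_minus)
        then show ?thesis using Du[of I] g True h_pos by (simp add: pl.E_iff D_def end_value_def val_def)
      next
        case f: False
        then have "upper I \<notin> pts_plus" "lower I \<in> pts_minus" "upper I \<in> pts_minus"
          using False g by (auto simp: intervals_cut_def mem_minus)
        then show ?thesis using Dv[of I] g f h_pos by (simp add: mi.E_iff D_def end_value_def val_def)
      qed
    qed
    then show ?case by (simp add: lu)
  qed
  have "\<psi> I = 0" for I
  proof (cases "I \<in> intervals_cut")
    case True
    then have "lower I \<in> grid_pts" by (auto simp: intervals_cut_def pts_minus_def pts_plus_def)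
    then show ?thesis using val val_cut(1)[OF True] by simp
  next
    case False
    then show ?thesis using \<psi> by (cases I) (auto simp: F_gamma_def)
  qed
  then show ?thesis by blast
qed

lemma dtns_comb: "\<psi> \<in> F_gamma \<Longrightarrow> \<zeta> \<in> F_gamma \<Longrightarrow> dtns (\<lambda>I. c * \<psi> I + \<zeta> I) I = c * dtns \<psi> I + dtns \<zeta> I"
  by (simp add: dtns_def pl.dtn_comb mi.dtn_comb) (simp add: algebra_simps)

text \<open>\<open>T\<close> is controlled on \<open>F_gamma\<close> only; composing it with the
  restriction \<open>res\<close> makes it linear on all functions, so that the finite-dimensional
  argument applies.\<close>

lemma F_gamma_surj:
  assumes maps: "\<And>\<psi>. \<psi> \<in> F_gamma \<Longrightarrow> T \<psi> \<in> F_gamma"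
    and lin: "\<And>c \<psi> \<zeta>. \<psi> \<in> F_gamma \<Longrightarrow> \<zeta> \<in> F_gamma \<Longrightarrow> T (\<lambda>I. c * \<psi> I + \<zeta> I) = (\<lambda>I. c * T \<psi> I + T \<zeta> I)"
    and inj: "\<And>\<psi>. \<psi> \<in> F_gamma \<Longrightarrow> T \<psi> = (\<lambda>_. 0) \<Longrightarrow> \<psi> = (\<lambda>_. 0)"
  shows "bij_betw T F_gamma F_gamma"
proof -
  define res :: "('n grid_interval \<Rightarrow> real) \<Rightarrow> 'n grid_interval \<Rightarrow> real"
    where "res f = (\<lambda>I. if I \<in> intervals_cut then f I else 0)" for f
  have res: "res f \<in> F_gamma" for f by (auto simp: res_def F_gamma_def)
  have res_id: "(\<And>I. I \<notin> intervals_cut \<Longrightarrow> f I = 0) \<Longrightarrow> res f = f" for f by (auto simp: res_def fun_eq_iff)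
  have out: "f I = 0" if "f \<in> F_gamma" "I \<notin> intervals_cut" for f I using that by (cases I) (auto simp: F_gamma_def)
  have surj: "\<exists>f\<in>F_gamma. T f = g" if g: "g \<in> F_gamma" for g
  proof -
    have "\<exists>f. (\<forall>i. i \<notin> intervals_cut \<longrightarrow> f i = 0) \<and> (\<forall>i\<in>intervals_cut. T (res f) i = g i)"
    proof (rule finite_support_linear_surj)
      show "finite intervals_cut" by (rule pl.finite_cut)
      show "T (res (\<lambda>x. c * f x + k x)) i = c * T (res f) i + T (res k) i" for c f k i
      proof -
        have "res (\<lambda>x. c * f x + k x) = (\<lambda>I. c * res f I + res k I)" by (auto simp: res_def fun_eq_iff)
        then show ?thesis using lin[OF res res] by simp
      qed
      fix f assume f: "\<And>i. i \<notin> intervals_cut \<Longrightarrow> f i = 0" "\<And>i. i \<in> intervals_cut \<Longrightarrow> T (res f) i = 0"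
      have "T (res f) i = 0" for i using f(2) out[OF maps[OF res]] by (cases "i \<in> intervals_cut") auto
      then have "T (res f) = (\<lambda>_. 0)" by blast
      then have "res f = (\<lambda>_. 0)" by (rule inj[OF res])
      then show "f = (\<lambda>_. 0)" using res_id f(1) by metis
    qed
    then obtain f where f: "\<And>i. i \<notin> intervals_cut \<Longrightarrow> f i = 0" "\<And>i. i \<in> intervals_cut \<Longrightarrow> T (res f) i = g i" by blast
    have "T (res f) i = g i" for i
      using f(2) out[OF maps[OF res]] out[OF g] by (cases "i \<in> intervals_cut") auto
    then show ?thesis using res by blast
  qed
  have "inj_on T F_gamma"
  proof (rule inj_onI)
    fix f g assume fg: "f \<in> F_gamma" "g \<in> F_gamma" "T f = T g"
    have "(\<lambda>I. (-1) * f I + g I) = (\<lambda>_. 0)"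
      by (rule inj[OF F_gamma_comb[OF fg(1,2)]]) (simp add: lin[OF fg(1,2), of "-1", simplified] fg(3))
    then show "f = g" by (auto simp: fun_eq_iff)
  qed
  then show ?thesis using surj maps unfolding bij_betw_def by blast
qed

lemma dtns_inj:
  assumes "\<beta> \<in> F_gamma" "\<And>I. I \<in> intervals_cut \<Longrightarrow> dtns \<beta> I = 0"
  shows "\<beta> = (\<lambda>_. 0)"
  by (rule q_definite[OF assms(1)]) (simp add: q_green assms)

lemma dtns_solve:
  shows "\<exists>!\<beta>. \<beta> \<in> F_gamma \<and> (\<forall>I\<in>intervals_cut. dtns \<beta> I = g I)"
proof -
  define T where "T \<psi> I = (if I \<in> intervals_cut then dtns \<psi> I else 0)" for \<psi> I
  define g' where "g' I = (if I \<in> intervals_cut then g I else 0)" for I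
  have "bij_betw T F_gamma F_gamma"
  proof (rule F_gamma_surj)
    show "T \<psi> \<in> F_gamma" for \<psi> by (auto simp: T_def F_gamma_def)
    show "T (\<lambda>I. c * \<psi> I + \<zeta> I) = (\<lambda>I. c * T \<psi> I + T \<zeta> I)" if "\<psi> \<in> F_gamma" "\<zeta> \<in> F_gamma" for c \<psi> \<zeta>
      using that by (auto simp: T_def dtns_comb fun_eq_iff)
    show "\<psi> = (\<lambda>_. 0)" if "\<psi> \<in> F_gamma" "T \<psi> = (\<lambda>_. 0)" for \<psi>
    proof (rule dtns_inj[OF that(1)])
      fix I assume "I \<in> intervals_cut"
      then show "dtns \<psi> I = 0" using fun_cong[OF that(2), of I] by (simp add: T_def)
    qed
  qed
  then have T: "inj_on T F_gamma" "T ` F_gamma = F_gamma" by (auto simp: bij_betw_def)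
  have "g' \<in> F_gamma" by (auto simp: g'_def F_gamma_def)
  then obtain \<beta>0 where \<beta>0: "\<beta>0 \<in> F_gamma" "T \<beta>0 = g'" using T(2) by (metis imageE)
  then have "\<exists>!\<beta>. \<beta> \<in> F_gamma \<and> T \<beta> = g'"
    using inj_onD[OF T(1)] by (intro ex1I[of _ \<beta>0]) auto
  moreover have "T \<beta> = g' \<longleftrightarrow> (\<forall>I\<in>intervals_cut. dtns \<beta> I = g I)" for \<beta>
    by (auto simp: T_def g'_def fun_eq_iff)
  ultimately show ?thesis by simp
qed

text \<open>With \<open>u\<^sup>- = S \<beta>\<close> and \<open>u\<^sup>+ = S (\<phi> + \<beta>)\<close>, continuity of the difference quotients across the
  interface is one linear equation for \<open>\<beta>\<close>.\<close>

definition jump_trace where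
  "jump_trace \<phi> = (THE \<beta>. \<beta> \<in> F_gamma \<and> (\<forall>I\<in>intervals_cut. dtns \<beta> I = - pl.dtn \<phi> I))"

lemma jump_trace: "jump_trace \<phi> \<in> F_gamma" "I \<in> intervals_cut \<Longrightarrow> dtns (jump_trace \<phi>) I = - pl.dtn \<phi> I"
  using theI'[OF dtns_solve[of "\<lambda>I. - pl.dtn \<phi> I"]] by (auto simp: jump_trace_def)

lemma jump_trace_eq: "\<beta> \<in> F_gamma \<Longrightarrow> (\<And>I. I \<in> intervals_cut \<Longrightarrow> dtns \<beta> I = - pl.dtn \<phi> I) \<Longrightarrow> \<beta> = jump_trace \<phi>"
  unfolding jump_trace_def by (rule the1_equality[OF dtns_solve, symmetric]) blast

lemma F_gamma_add: "\<psi> \<in> F_gamma \<Longrightarrow> \<zeta> \<in> F_gamma \<Longrightarrow> (\<lambda>I. \<psi> I + \<zeta> I) \<in> F_gamma"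
  using F_gamma_comb[of \<psi> \<zeta> 1] by simp

lemma dtn_jump:
  assumes "\<phi> \<in> F_gamma" "\<beta> \<in> F_gamma" "I \<in> intervals_cut"
  shows "D pts_plus (pl.sol (\<lambda>I. \<phi> I + \<beta> I)) I = D pts_minus (mi.sol \<beta>) I \<longleftrightarrow> dtns \<beta> I = - pl.dtn \<phi> I"
proof -
  have "dtns \<beta> I + pl.dtn \<phi> I = pl.dtn (\<lambda>I. \<phi> I + \<beta> I) I + mi.dtn \<beta> I"
    using pl.dtn_comb[OF assms(1,2), of 1 I] by (simp add: dtns_def)
  also have "\<dots> = pl.sg I * (D pts_plus (pl.sol (\<lambda>I. \<phi> I + \<beta> I)) I - D pts_minus (mi.sol \<beta>) I)"
    by (simp add: pl.dtn_def mi.dtn_def sg_minus[OF assms(3)] algebra_simps)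
  finally have "dtns \<beta> I = - pl.dtn \<phi> I \<longleftrightarrow> pl.sg I * (D pts_plus (pl.sol (\<lambda>I. \<phi> I + \<beta> I)) I - D pts_minus (mi.sol \<beta>) I) = 0"
    by linarith
  moreover have "pl.sg I \<noteq> 0" by (simp add: pl.sg_def)
  ultimately show ?thesis by auto
qed

text \<open>A double layer is determined by its outer trace \<beta>, since the inner trace must be
  \<open>\<phi> + \<beta>\<close>; the one condition left is the equation that defines
  \<open>jump_trace\<close>.\<close>

lemma double_layer_unique:
  assumes \<phi>: "\<phi> \<in> F_gamma"
  shows "is_double_layer \<phi> p \<longleftrightarrow> p = (pl.sol (\<lambda>I. \<phi> I + jump_trace \<phi> I), mi.sol (jump_trace \<phi>))"
proof
  obtain u v where p: "p = (u, v)" by (cases p)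
  assume "is_double_layer \<phi> p"
  then have d: "pl.solves (M pts_plus u) u" "mi.solves (M pts_minus v) v"
    "\<And>I. I \<in> intervals_cut \<Longrightarrow> M pts_plus u I - M pts_minus v I = \<phi> I"
    "\<And>I. I \<in> intervals_cut \<Longrightarrow> D pts_plus u I = D pts_minus v I"
    by (auto simp: p is_double_layer_def harmonic_pair_iff)
  define \<beta> where "\<beta> = M pts_minus v"
  have \<beta>: "\<beta> \<in> F_gamma" unfolding \<beta>_def by (rule M_F_gamma)
  have "M pts_plus u I = \<phi> I + \<beta> I" for I
  proof (cases "I \<in> intervals_cut")
    case True
    then show ?thesis using d(3)[OF True] by (simp add: \<beta>_def)
  next
    case False
    then show ?thesis using \<phi> by (cases I) (auto simp: \<beta>_def M_def F_gamma_def)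
  qed
  then have Mu: "M pts_plus u = (\<lambda>I. \<phi> I + \<beta> I)" by blast
  have u: "u = pl.sol (\<lambda>I. \<phi> I + \<beta> I)" and v: "v = mi.sol \<beta>"
    using pl.sol_eq[OF d(1)] mi.sol_eq[OF d(2)] Mu by (auto simp: \<beta>_def)
  have "\<beta> = jump_trace \<phi>"
    by (rule jump_trace_eq[OF \<beta>]) (use d(4) dtn_jump[OF \<phi> \<beta>] u v in blast)
  then show "p = (pl.sol (\<lambda>I. \<phi> I + jump_trace \<phi> I), mi.sol (jump_trace \<phi>))" using u v p by simp
next
  assume p: "p = (pl.sol (\<lambda>I. \<phi> I + jump_trace \<phi> I), mi.sol (jump_trace \<phi>))"
  note s = pl.solves_sol[OF F_gamma_add[OF \<phi> jump_trace(1)]] mi.solves_sol[OF jump_trace(1)]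
  then have M: "M pts_plus (pl.sol (\<lambda>I. \<phi> I + jump_trace \<phi> I)) = (\<lambda>I. \<phi> I + jump_trace \<phi> I)"
    "M pts_minus (mi.sol (jump_trace \<phi>)) = jump_trace \<phi>" by (auto simp: pl.solves_def mi.solves_def)
  show "is_double_layer \<phi> p"
    unfolding p is_double_layer_def using s dtn_jump[OF \<phi> jump_trace(1)] jump_trace(2)
    by (simp add: harmonic_pair_iff M)
qed

lemma
  assumes \<phi>: "\<phi> \<in> F_gamma"
  shows calB_eq: "calB \<phi> = jump_trace \<phi>" and calA_eq: "calA \<phi> = (\<lambda>I. \<phi> I + jump_trace \<phi> I)"
proof -
  have "double_layer \<phi> = (pl.sol (\<lambda>I. \<phi> I + jump_trace \<phi> I), mi.sol (jump_trace \<phi>))"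
    unfolding double_layer_def by (rule the_equality) (simp_all add: double_layer_unique[OF \<phi>])
  then show "calB \<phi> = jump_trace \<phi>" "calA \<phi> = (\<lambda>I. \<phi> I + jump_trace \<phi> I)"
    using pl.solves_sol[OF F_gamma_add[OF \<phi> jump_trace(1)]] mi.solves_sol[OF jump_trace(1)]
    by (auto simp: calA_def calB_def pl.solves_def mi.solves_def)
qed

lemma jump_trace_comb:
  assumes "\<phi> \<in> F_gamma" "\<zeta> \<in> F_gamma"
  shows "jump_trace (\<lambda>I. c * \<phi> I + \<zeta> I) = (\<lambda>I. c * jump_trace \<phi> I + jump_trace \<zeta> I)"
  by (rule jump_trace_eq[symmetric]) (simp_all add: F_gamma_comb jump_trace dtns_comb pl.dtn_comb assms)

lemma q_jump_trace:
  assumes "\<phi> \<in> F_gamma" "\<zeta> \<in> F_gamma"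
  shows "q (jump_trace \<phi>) \<zeta> = - pl.e \<phi> \<zeta>"
proof -
  have "q (jump_trace \<phi>) \<zeta> = (\<Sum>I\<in>intervals_cut. dtns (jump_trace \<phi>) I * \<zeta> I) / h"
    by (rule q_green[OF jump_trace(1) assms(2)])
  also have "\<dots> = (\<Sum>I\<in>intervals_cut. - (pl.dtn \<phi> I * \<zeta> I)) / h"
    by (simp add: jump_trace(2))
  also have "\<dots> = - pl.e \<phi> \<zeta>" by (simp add: pl.e_green[OF assms] sum_negf)
  finally show ?thesis .
qed

text \<open>Kept general because it is applied both to the interior energy, for the norm of
  \<open>calB\<close>, and to \<open>q\<close>, for the inverse of \<open>calA\<close>.\<close>

lemma form_cauchy_schwarz:
  fixes Q :: "('n grid_interval \<Rightarrow> real) \<Rightarrow> ('n grid_interval \<Rightarrow> real) \<Rightarrow> real"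
  assumes sym: "\<And>\<psi> \<zeta>. Q \<psi> \<zeta> = Q \<zeta> \<psi>" and nonneg: "\<And>\<psi>. 0 \<le> Q \<psi> \<psi>"
    and comb: "\<And>c \<psi> \<zeta> \<eta>. \<psi> \<in> F_gamma \<Longrightarrow> \<zeta> \<in> F_gamma \<Longrightarrow>
      Q (\<lambda>I. c * \<psi> I + \<zeta> I) \<eta> = c * Q \<psi> \<eta> + Q \<zeta> \<eta>"
    and F: "\<phi> \<in> F_gamma" "\<zeta> \<in> F_gamma"
  shows "(Q \<phi> \<zeta>)\<^sup>2 \<le> Q \<zeta> \<zeta> * Q \<phi> \<phi>"
proof (rule nonneg_quadratic_discriminant)
  fix t
  have "0 \<le> Q (\<lambda>I. t * \<zeta> I + \<phi> I) (\<lambda>I. t * \<zeta> I + \<phi> I)" by (rule nonneg)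
  also have "\<dots> = t * Q \<zeta> (\<lambda>I. t * \<zeta> I + \<phi> I) + Q \<phi> (\<lambda>I. t * \<zeta> I + \<phi> I)"
    by (rule comb[OF F(2,1)])
  also have "Q \<zeta> (\<lambda>I. t * \<zeta> I + \<phi> I) = t * Q \<zeta> \<zeta> + Q \<phi> \<zeta>"
    by (subst sym) (rule comb[OF F(2,1)])
  also have "Q \<phi> (\<lambda>I. t * \<zeta> I + \<phi> I) = t * Q \<phi> \<zeta> + Q \<phi> \<phi>"
    by (subst sym) (simp only: comb[OF F(2,1)] sym[of \<zeta> \<phi>])
  finally show "0 \<le> Q \<zeta> \<zeta> * t\<^sup>2 + 2 * Q \<phi> \<zeta> * t + Q \<phi> \<phi>"
    by (simp add: algebra_simps power2_eq_square)
qed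

section \<open>Norm bounds and spectrum\<close>

lemma nrm_eq: "\<psi> \<in> F_gamma \<Longrightarrow> nrm \<psi> = sqrt (h ^ CARD('n)) * sqrt (q \<psi> \<psi>)"
  by (simp add: nrm_def ip_eq real_sqrt_mult)

lemma nrm_le:
  assumes "\<psi> \<in> F_gamma" "\<zeta> \<in> F_gamma" "0 \<le> c" "q \<psi> \<psi> \<le> c\<^sup>2 * q \<zeta> \<zeta>"
  shows "nrm \<psi> \<le> c * nrm \<zeta>"
proof -
  have "sqrt (q \<psi> \<psi>) \<le> sqrt (c\<^sup>2 * q \<zeta> \<zeta>)" using assms(4) by (rule real_sqrt_le_mono)
  also have "\<dots> = c * sqrt (q \<zeta> \<zeta>)" using assms(3) by (simp add: real_sqrt_mult)
  finally have "sqrt (h ^ CARD('n)) * sqrt (q \<psi> \<psi>) \<le> sqrt (h ^ CARD('n)) * (c * sqrt (q \<zeta> \<zeta>))"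
    using h_pos by (intro mult_left_mono) auto
  then show ?thesis by (simp add: nrm_eq assms mult_ac)
qed

lemma op_norm_le:
  assumes "0 \<le> c" "\<And>\<psi>. \<psi> \<in> F_gamma \<Longrightarrow> nrm (T \<psi>) \<le> c * nrm \<psi>"
  shows "op_norm T \<le> ereal c"
  unfolding op_norm_def
proof (rule SUP_least)
  fix \<psi> assume "\<psi> \<in> {\<psi> \<in> F_gamma. nrm \<psi> \<le> 1}"
  then have "nrm (T \<psi>) \<le> c * nrm \<psi>" "c * nrm \<psi> \<le> c * 1"
    using assms mult_left_mono[of "nrm \<psi>" 1 c] by auto
  then show "ereal (nrm (T \<psi>)) \<le> ereal c" by simp
qed

text \<open>Testing with \<open>t = jump_trace \<phi>\<close> gives
  \<open>q t t = - pl.e \<phi> t\<close>. Cauchy-Schwarz for \<open>pl.e\<close> instead of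
  \<open>q\<close> allows \<open>bound\<close> to be used on both factors, which yields
  \<open>r\<^sup>2\<close> after division by \<open>q t t\<close>.\<close>

lemma q_jump_trace_le:
  assumes \<phi>: "\<phi> \<in> F_gamma" and r: "0 \<le> r" "r < 1"
    and bound: "\<And>\<psi>. \<psi> \<in> F_gamma \<Longrightarrow> pl.e \<psi> \<psi> \<le> r * q \<psi> \<psi>"
  shows "q (jump_trace \<phi>) (jump_trace \<phi>) \<le> r\<^sup>2 * q \<phi> \<phi>"
proof -
  define t where "t = jump_trace \<phi>"
  have t: "t \<in> F_gamma" by (simp add: t_def jump_trace)
  have "(q t t)\<^sup>2 = (pl.e \<phi> t)\<^sup>2" using q_jump_trace[OF \<phi> t] by (simp add: t_def)
  also have "\<dots> \<le> pl.e t t * pl.e \<phi> \<phi>"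
    by (rule form_cauchy_schwarz[OF pl.e_sym pl.e_nonneg pl.e_comb \<phi> t])
  also have "\<dots> = pl.e \<phi> \<phi> * pl.e t t" by (rule mult.commute)
  also have "\<dots> \<le> (r * q \<phi> \<phi>) * (r * q t t)"
    using bound[OF \<phi>] bound[OF t] r q_nonneg by (intro mult_mono) (auto simp: pl.e_nonneg)
  finally have "q t t * q t t \<le> (r\<^sup>2 * q \<phi> \<phi>) * q t t" by (simp add: power2_eq_square mult_ac)
  then show ?thesis
    using q_nonneg[of t] q_nonneg[of \<phi>] unfolding t_def[symmetric]
    by (cases "q t t = 0") auto
qed

lemma layer_operator_bounds:
  assumes r: "0 \<le> r" "r < 1" and bound: "\<And>\<psi>. \<psi> \<in> F_gamma \<Longrightarrow> pl.e \<psi> \<psi> \<le> r * q \<psi> \<psi>"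
  shows "\<forall>\<psi>\<in>F_gamma. \<exists>!p. is_single_layer \<psi> p" and "\<forall>\<phi>\<in>F_gamma. \<exists>!p. is_double_layer \<phi> p"
    and "symmetric_op calA" and "symmetric_op calB" and "op_norm calB \<le> ereal r"
    and "\<forall>\<phi>\<in>F_gamma. calA \<phi> = (\<lambda>I. \<phi> I + calB \<phi> I)" and "bij_betw calA F_gamma F_gamma"
    and "op_norm (inv_into F_gamma calA) \<le> ereal (inverse (1 - r))"
    and "op_spectrum calA \<subseteq> {1 - r..1}"
proof -
  show "\<forall>\<psi>\<in>F_gamma. \<exists>!p. is_single_layer \<psi> p" by (simp add: single_layer_unique)
  show "\<forall>\<phi>\<in>F_gamma. \<exists>!p. is_double_layer \<phi> p" by (simp add: double_layer_unique)
  show AB: "\<forall>\<phi>\<in>F_gamma. calA \<phi> = (\<lambda>I. \<phi> I + calB \<phi> I)" by (simp add: calA_eq calB_eq)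
  have qt_sym: "q (jump_trace \<psi>) \<zeta> = q \<psi> (jump_trace \<zeta>)" if "\<psi> \<in> F_gamma" "\<zeta> \<in> F_gamma" for \<psi> \<zeta>
    using q_jump_trace that pl.e_sym[of \<psi> \<zeta>] by (simp add: q_sym[of \<psi>])
  show "symmetric_op calB" unfolding symmetric_op_def
    by (simp add: calB_eq ip_eq jump_trace qt_sym)
  have A: "calA \<psi> \<in> F_gamma" if "\<psi> \<in> F_gamma" for \<psi> using that by (simp add: calA_eq F_gamma_add jump_trace)
  have qA: "q (calA \<psi>) \<zeta> = q \<psi> \<zeta> + q (jump_trace \<psi>) \<zeta>" if "\<psi> \<in> F_gamma" for \<psi> \<zeta>
    using q_comb[OF that jump_trace(1), of 1] by (simp add: calA_eq that)
  show "symmetric_op calA" unfolding symmetric_op_def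
  proof (intro ballI)
    fix \<psi> \<zeta> assume a: "\<psi> \<in> F_gamma" "\<zeta> \<in> F_gamma"
    show "ip (calA \<psi>) \<zeta> = ip \<psi> (calA \<zeta>)"
      using qA[OF a(1), of \<zeta>] qA[OF a(2), of \<psi>] qt_sym[OF a] q_sym[of \<psi>] by (simp add: ip_eq a A)
  qed
  show "op_norm calB \<le> ereal r"
    by (intro op_norm_le r) (simp add: calB_eq nrm_le jump_trace q_jump_trace_le r bound)
  \<comment> \<open>The quadratic form of \<open>calA\<close> is
    \<open>q \<psi> \<psi> - pl.e \<psi> \<psi>\<close>, that is, the exterior energy; its two
    bounds are the two ends of the spectrum.\<close>
  have lower: "(1 - r) * q \<psi> \<psi> \<le> q (calA \<psi>) \<psi>" and upper: "q (calA \<psi>) \<psi> \<le> q \<psi> \<psi>" if "\<psi> \<in> F_gamma" for \<psi>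
    using qA[OF that, of \<psi>] q_jump_trace[OF that that] bound[OF that] pl.e_nonneg[of \<psi>] by (auto simp: algebra_simps)
  \<comment> \<open>In finite dimension it suffices to exclude eigenvectors: the Rayleigh quotient
    of one would equal \<mu>, which lies outside the admissible interval.\<close>
  have shift_bij: "bij_betw (\<lambda>\<psi> I. calA \<psi> I - \<mu> * \<psi> I) F_gamma F_gamma" if \<mu>: "\<mu> \<notin> {1 - r..1}" for \<mu>
  proof (rule F_gamma_surj)
    show "(\<lambda>I. calA \<psi> I - \<mu> * \<psi> I) \<in> F_gamma" if "\<psi> \<in> F_gamma" for \<psi>
      using F_gamma_comb[OF that A[OF that], of "-\<mu>"] by (simp add: algebra_simps)
    show "(\<lambda>I. calA (\<lambda>I. c * \<psi> I + \<zeta> I) I - \<mu> * (c * \<psi> I + \<zeta> I)) =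
      (\<lambda>I. c * (calA \<psi> I - \<mu> * \<psi> I) + (calA \<zeta> I - \<mu> * \<zeta> I))" if "\<psi> \<in> F_gamma" "\<zeta> \<in> F_gamma" for c \<psi> \<zeta>
      using that by (simp add: calA_eq F_gamma_comb jump_trace_comb) (simp add: algebra_simps)
    fix \<psi> assume \<psi>: "\<psi> \<in> F_gamma" and z: "(\<lambda>I. calA \<psi> I - \<mu> * \<psi> I) = (\<lambda>_. 0)"
    have "calA \<psi> = (\<lambda>I. \<mu> * \<psi> I + 0)" using z by (auto simp: fun_eq_iff)
    then have "q (calA \<psi>) \<psi> = \<mu> * q \<psi> \<psi> + q (\<lambda>_. 0) \<psi>" using q_comb[OF \<psi> zero_F_gamma, of \<mu> \<psi>] by simp
    moreover have "q (\<lambda>_. 0) \<psi> = 0" using q_comb[OF zero_F_gamma zero_F_gamma, of 1 \<psi>] by simp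
    ultimately have "(1 - r) * q \<psi> \<psi> \<le> \<mu> * q \<psi> \<psi>" "\<mu> * q \<psi> \<psi> \<le> 1 * q \<psi> \<psi>"
      using lower[OF \<psi>] upper[OF \<psi>] by auto
    then have "q \<psi> \<psi> = 0"
      using \<mu> q_nonneg[of \<psi>] by (metis atLeastAtMost_iff mult_le_cancel_right order_le_less linorder_not_le)
    then show "\<psi> = (\<lambda>_. 0)" by (rule q_definite[OF \<psi>])
  qed
  show bij: "bij_betw calA F_gamma F_gamma" using shift_bij[of 0] r by simp
  show "op_spectrum calA \<subseteq> {1 - r..1}" using shift_bij unfolding op_spectrum_def by blast
  show "op_norm (inv_into F_gamma calA) \<le> ereal (inverse (1 - r))"
  proof (rule op_norm_le)
    show "0 \<le> inverse (1 - r)" using r by simp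
    fix \<psi> assume \<psi>: "\<psi> \<in> F_gamma"
    define \<phi> where "\<phi> = inv_into F_gamma calA \<psi>"
    have \<phi>: "\<phi> \<in> F_gamma" "calA \<phi> = \<psi>"
      using bij_betw_apply[OF bij_betw_inv_into[OF bij] \<psi>] bij_betw_inv_into_right[OF bij \<psi>]
      by (auto simp: \<phi>_def)
    \<comment> \<open>Coercivity of \<open>calA\<close> combined with Cauchy-Schwarz for
      \<open>q\<close> bounds the inverse.\<close>
    have "((1 - r) * q \<phi> \<phi>)\<^sup>2 \<le> (q \<psi> \<phi>)\<^sup>2"
      using lower[OF \<phi>(1)] \<phi>(2) r q_nonneg[of \<phi>] by (intro power_mono) auto
    also have "\<dots> \<le> q \<phi> \<phi> * q \<psi> \<psi>"
      by (rule form_cauchy_schwarz[OF q_sym q_nonneg q_comb \<psi> \<phi>(1)])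
    finally have "((1 - r) * q \<phi> \<phi>)\<^sup>2 \<le> q \<psi> \<psi> * q \<phi> \<phi>" by (simp add: mult.commute)
    then have "((1 - r)\<^sup>2 * q \<phi> \<phi>) * q \<phi> \<phi> \<le> q \<psi> \<psi> * q \<phi> \<phi>"
      by (simp add: power2_eq_square mult_ac)
    then have "(1 - r)\<^sup>2 * q \<phi> \<phi> \<le> q \<psi> \<psi>"
      using q_nonneg[of \<phi>] q_nonneg[of \<psi>] by (cases "q \<phi> \<phi> = 0") auto
    then have "q \<phi> \<phi> \<le> (inverse (1 - r))\<^sup>2 * q \<psi> \<psi>"
      using r by (simp add: field_simps)
    then show "nrm (inv_into F_gamma calA \<psi>) \<le> inverse (1 - r) * nrm \<psi>"
      unfolding \<phi>_def[symmetric] using \<phi>(1) \<psi> r by (intro nrm_le) auto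
  qed
qed

end

section \<open>Comparison of the two energies\<close>

context interface_setup
begin

text \<open>The lattice off \<Omega> continues beyond the box, but no energy arises there: an inner
  grid point has all its neighbours in the grid, so an edge that is not inside the grid has value
  zero at both ends. The remaining edges have full weight.\<close>

lemma energy_le_exterior:
  assumes \<psi>: "\<psi> \<in> F_gamma"
  shows "energy_le h (- \<Omega>) (fst (mi.sol \<psi>)) (h\<^sup>2 * mi.e \<psi> \<psi>)"
  unfolding energy_le_def
proof (intro allI impI)
  define v where "v = fst (mi.sol \<psi>)"
  have v0: "v x = 0" if "x \<notin> pts_minus - bdry_pts" for x
    using mi.solves_sol[OF \<psi>] that by (auto simp: mi.solves_def mi.FP_def mi.N_def v_def)
  fix J assume J: "finite J" "J \<subseteq> edges h (- \<Omega>)"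
  define Dv where "Dv = D pts_minus (mi.sol \<psi>)"
  have out: "dsq h v I = 0" if "I \<in> J" "I \<notin> mi.ivs" for I
  proof -
    have l: "lower I \<in> grid_lattice h - \<Omega>" "upper I \<in> grid_lattice h - \<Omega>"
      using J(2) that(1) grid_lattice_step(1)[of "lower I" h "snd I"]
      by (cases I, auto simp: edges_def lower_def upper_def)+
    have m: "x \<in> pts_minus \<longleftrightarrow> x \<in> cbox a b" if "x \<in> grid_lattice h - \<Omega>" for x
      using that by (auto simp: pts_minus_def grid_pts_eq)
    have "lower I \<notin> pts_minus \<or> upper I \<notin> pts_minus" using that(2) by (auto simp: mi.ivs_def)
    moreover have "upper I \<in> pts_minus" if "lower I \<in> pts_minus - bdry_pts"
      using that neighbour_grid(1)[of "lower I" "snd I"] m l(2) by (auto simp: mem_minus upper_lower grid_pts_eq)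
    moreover have "lower I \<in> pts_minus" if "upper I \<in> pts_minus - bdry_pts"
      using that neighbour_grid(2)[of "upper I" "snd I"] m l(1) by (auto simp: mem_minus upper_lower grid_pts_eq)
    ultimately have "v (lower I) = 0" "v (upper I) = 0" using v0 by blast+
    then show ?thesis by (simp add: dsq_def lower_def upper_def)
  qed
  have ins: "dsq h v I = h\<^sup>2 * (Dv I * Dv I * mi.wt I)" if "I \<in> mi.ivs" for I
    using that h_pos by (simp add: mi.ivs_def dsq_def Dv_def D_def end_value_def mi.wt_def v_def
      lower_def upper_def power2_eq_square)
  have "(\<Sum>I\<in>J. dsq h v I) = (\<Sum>I\<in>J \<inter> mi.ivs. dsq h v I)"
    using J(1) out by (intro sum.mono_neutral_right) auto
  also have "\<dots> = (\<Sum>I\<in>J \<inter> mi.ivs. h\<^sup>2 * (Dv I * Dv I * mi.wt I))"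
    by (intro sum.cong ins) auto
  also have "\<dots> \<le> (\<Sum>I\<in>mi.E. h\<^sup>2 * (Dv I * Dv I * mi.wt I))"
    unfolding Dv_def using mi.finite_E
    by (intro sum_mono2 mult_nonneg_nonneg[OF _ mi.summand_nonneg]) (auto simp: mi.E_def)
  also have "\<dots> = h\<^sup>2 * mi.e \<psi> \<psi>" by (simp add: mi.e_def mi.en_def Dv_def sum_distrib_left)
  finally show "(\<Sum>I\<in>J. dsq h (fst (mi.sol \<psi>)) I) \<le> h\<^sup>2 * mi.e \<psi> \<psi>" by (simp add: v_def)
qed

text \<open>The extension \<open>w\<close> yields a trial function for the Dirichlet principle. On a
  cut interval, \<psi> minus the inner value is the exterior slope up to the chosen point plus the
  difference of \<open>w\<close> along the edge; splitting this sum gives the factor 2, and dividing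
  by the weight costs \<open>1 / \<delta>\<close>.\<close>

lemma interior_energy_le:
  assumes \<psi>: "\<psi> \<in> F_gamma" and \<delta>1: "\<delta> \<le> 1"
    and w: "\<And>x. x \<in> pts_minus \<Longrightarrow> w x = fst (mi.sol \<psi>) x"
    and E: "energy_le h UNIV w (C * (h\<^sup>2 * mi.e \<psi> \<psi>))"
  shows "pl.e \<psi> \<psi> \<le> 2 / \<delta> * (1 + C) * mi.e \<psi> \<psi>"
proof -
  define v where "v = mi.sol \<psi>"
  have Mv: "M pts_minus v = \<psi>" using mi.solves_sol[OF \<psi>] by (simp add: v_def mi.solves_def)
  \<comment> \<open>The extended value continues the line from the inner end through the value
    \<open>\<psi> I\<close> at the chosen point, which is what the trace condition forces.\<close>
  define W :: "'n side_function" where "W = (\<lambda>x. if x \<in> pts_plus then w x else 0,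
    \<lambda>I. if I \<in> intervals_cut then w (pl.inner I) + (\<psi> I - w (pl.inner I)) / pl.wt I else 0)"
  have W: "W \<in> pl.FP" by (auto simp: pl.FP_def W_def pl_N F_gamma_def)
  have inner: "pl.inner I \<in> pts_plus" "mi.inner I \<in> pts_minus" if "I \<in> intervals_cut" for I
    using that by (auto simp: pl.inner_def mi.inner_def intervals_cut_def mem_minus)
  have wt: "\<delta> \<le> pl.wt I" "0 < pl.wt I" "0 < mi.wt I" "mi.wt I \<le> 1" if "I \<in> intervals_cut" for I
    using pl.wt_bounds[OF that] mi.wt_bounds[OF that] \<delta> by auto
  have DW: "D pts_plus W I = pl.sg I * (\<psi> I - w (pl.inner I)) / (pl.wt I * h)" if c: "I \<in> intervals_cut" for I
    using c wt(2)[OF c] h_pos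
    by (auto simp: D_def end_value_def W_def pl.inner_def pl.sg_def pl.cut_iff field_simps)
  have sg2: "pl.sg I * pl.sg I = 1" "mi.sg I * mi.sg I = 1" for I by (auto simp: pl.sg_def mi.sg_def)
  have "M pts_plus W I = \<psi> I" for I
  proof (cases "I \<in> intervals_cut")
    case True
    have "M pts_plus W I = w (pl.inner I) + (pl.sg I * pl.sg I) * (\<psi> I - w (pl.inner I))"
      using pl.M_eq[OF True, of W] DW[OF True] wt(2)[OF True] h_pos inner(1)[OF True]
      by (simp add: W_def)
    then show ?thesis by (simp add: sg2)
  next
    case False
    then show ?thesis using \<psi> by (cases I) (auto simp: M_def F_gamma_def)
  qed
  then have "M pts_plus W = \<psi>" by blast
  from pl.dirichlet_principle[OF W this] have le: "pl.e \<psi> \<psi> \<le> pl.en W W" .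
  define Dv where "Dv = D pts_minus v"
  define c where "c I = (if I \<in> intervals_cut then Dv I * Dv I * mi.wt I else 0)" for I
  have pointwise: "D pts_plus W I * D pts_plus W I * pl.wt I \<le> 2 / \<delta> * (c I + dsq h w I / h\<^sup>2)" if I: "I \<in> pl.E" for I
  proof (cases "I \<in> intervals_cut")
    case True
    note wt = wt[OF True]
    define i j where "i = pl.inner I" and "j = mi.inner I"
    have "\<psi> I = w j + mi.sg I * mi.wt I * h * Dv I"
      using mi.M_eq[OF True, of v] Mv w[OF inner(2)[OF True]] by (simp add: j_def v_def Dv_def)
    then have "(\<psi> I - w i)\<^sup>2 = (mi.sg I * mi.wt I * h * Dv I + (w j - w i))\<^sup>2" by (simp add: algebra_simps)
    also have "\<dots> \<le> 2 * (mi.sg I * mi.wt I * h * Dv I)\<^sup>2 + 2 * (w j - w i)\<^sup>2" by (rule sq_sum2_le)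
    also have "(w j - w i)\<^sup>2 = dsq h w I"
      using True by (auto simp: j_def i_def pl.inner_def mi.inner_def intervals_cut_def mem_minus
        dsq_def lower_def upper_def power2_commute)
    also have "(mi.sg I * mi.wt I * h * Dv I)\<^sup>2 = (mi.sg I * mi.sg I) * (mi.wt I * (h\<^sup>2 * (Dv I * Dv I * mi.wt I)))"
      by (simp add: power2_eq_square)
    also have "\<dots> \<le> 1 * (1 * (h\<^sup>2 * (Dv I * Dv I * mi.wt I)))"
    proof -
      have "0 \<le> Dv I * Dv I * mi.wt I" using wt(3) by (intro mult_nonneg_nonneg zero_le_square) auto
      then have "0 \<le> h\<^sup>2 * (Dv I * Dv I * mi.wt I)" by (rule mult_nonneg_nonneg[rotated]) simp
      then show ?thesis unfolding sg2 using wt by (intro mult_left_mono mult_right_mono) auto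
    qed
    finally have num: "(\<psi> I - w i)\<^sup>2 \<le> 2 * (h\<^sup>2 * c I) + 2 * dsq h w I" using True by (simp add: c_def)
    have "D pts_plus W I * D pts_plus W I * pl.wt I = (pl.sg I * pl.sg I) * ((\<psi> I - w i)\<^sup>2 / (h\<^sup>2 * pl.wt I))"
      using wt h_pos by (simp add: DW[OF True] i_def power2_eq_square field_simps)
    also have "\<dots> = (\<psi> I - w i)\<^sup>2 / (h\<^sup>2 * pl.wt I)" by (simp add: sg2)
    also have "\<dots> \<le> (\<psi> I - w i)\<^sup>2 / (h\<^sup>2 * \<delta>)"
      using wt h_pos \<delta> by (intro divide_left_mono mult_left_mono mult_pos_pos) auto
    also have "\<dots> \<le> (2 * (h\<^sup>2 * c I) + 2 * dsq h w I) / (h\<^sup>2 * \<delta>)"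
      using num h_pos \<delta> by (intro divide_right_mono) auto
    also have "\<dots> = 2 / \<delta> * (c I + dsq h w I / h\<^sup>2)"
      using h_pos \<delta> by (simp add: field_simps)
    finally show ?thesis .
  next
    case False
    then have i: "I \<in> pl.ivs" using I by (auto simp: pl.E_def)
    have "D pts_plus W I * D pts_plus W I * pl.wt I = dsq h w I / h\<^sup>2"
      using i by (simp add: pl.ivs_def D_def end_value_def pl.wt_def W_def dsq_def lower_def upper_def
        power2_eq_square)
    also have "\<dots> \<le> 2 / \<delta> * (dsq h w I / h\<^sup>2)"
      using \<delta> \<delta>1 mult_right_mono[of 1 "2 / \<delta>" "dsq h w I / h\<^sup>2"] by simp
    finally show ?thesis using False by (simp add: c_def)
  qed
  have "pl.en W W \<le> (\<Sum>I\<in>pl.E. 2 / \<delta> * (c I + dsq h w I / h\<^sup>2))"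
    unfolding pl.en_def by (intro sum_mono pointwise)
  also have "\<dots> = 2 / \<delta> * ((\<Sum>I\<in>pl.E. c I) + (\<Sum>I\<in>pl.E. dsq h w I) / h\<^sup>2)"
    by (simp only: sum_distrib_left[symmetric] sum.distrib sum_divide_distrib[symmetric])
  also have "\<dots> \<le> 2 / \<delta> * (mi.e \<psi> \<psi> + C * (h\<^sup>2 * mi.e \<psi> \<psi>) / h\<^sup>2)"
  proof (intro mult_left_mono add_mono divide_right_mono)
    have "(\<Sum>I\<in>pl.E. c I) = (\<Sum>I\<in>pl.E \<inter> intervals_cut. Dv I * Dv I * mi.wt I)"
      using pl.finite_E by (simp add: c_def sum.inter_restrict)
    also have "\<dots> \<le> (\<Sum>I\<in>mi.E. Dv I * Dv I * mi.wt I)"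
      unfolding Dv_def using mi.finite_E
      by (intro sum_mono2 mi.summand_nonneg) (auto simp: mi.E_def)
    also have "\<dots> = mi.e \<psi> \<psi>" by (simp add: mi.e_def mi.en_def Dv_def v_def)
    finally show "(\<Sum>I\<in>pl.E. c I) \<le> mi.e \<psi> \<psi>" .
    show "(\<Sum>I\<in>pl.E. dsq h w I) \<le> C * (h\<^sup>2 * mi.e \<psi> \<psi>)"
      by (rule energy_leD[OF E pl.finite_E]) (auto simp: pl.E_iff edges_def lower_def grid_pts_eq)
  qed (use \<delta> in auto)
  also have "\<dots> = 2 / \<delta> * (1 + C) * mi.e \<psi> \<psi>" using h_pos by (simp add: distrib_right distrib_left)
  finally show ?thesis using le by simp
qed

end

theorem theorem2p7:
  fixes \<Omega> :: "(real^'n) set" and a b :: "real^'n" and \<delta> :: real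
    and X :: "real \<Rightarrow> 'n grid_interval \<Rightarrow> real^'n"
  assumes "CARD('n) \<in> {2, 3}"
    and "open \<Omega>" "connected \<Omega>" "\<Omega> \<noteq> {}" "bounded \<Omega>" "C2_boundary \<Omega>"
    and "connected (- closure \<Omega>)"
    and "closure \<Omega> \<subseteq> box a b"
    and "0 < \<delta>" "\<delta> \<le> 1/2"
    and "\<And>h. admissible_grid_size a b h \<Longrightarrow>
           interface_grid.chosen_points_ok \<Omega> (box a b) h (X h) \<delta>"
  shows "\<exists>h0>0. \<exists>r<1. \<forall>h. admissible_grid_size a b h \<and> h \<le> h0 \<longrightarrow>
    (let F = interface_grid.F_gamma \<Omega> (box a b) h;
         A = interface_grid.calA \<Omega> (box a b) h (X h);
         B = interface_grid.calB \<Omega> (box a b) h (X h);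
         opnorm = interface_grid.op_norm \<Omega> (box a b) h (X h)
     in (\<forall>\<psi>\<in>F. \<exists>!p. interface_grid.is_single_layer \<Omega> (box a b) h (X h) \<psi> p) \<and>
        (\<forall>\<phi>\<in>F. \<exists>!p. interface_grid.is_double_layer \<Omega> (box a b) h (X h) \<phi> p) \<and>
        interface_grid.symmetric_op \<Omega> (box a b) h (X h) A \<and>
        interface_grid.symmetric_op \<Omega> (box a b) h (X h) B \<and>
        opnorm B \<le> ereal r \<and>
        (\<forall>\<phi>\<in>F. A \<phi> = (\<lambda>I. \<phi> I + B \<phi> I)) \<and>
        bij_betw A F F \<and>
        opnorm (inv_into F A) \<le> ereal (inverse (1 - r)) \<and>
        interface_grid.op_spectrum \<Omega> (box a b) h A \<subseteq> {1 - r..1})"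
proof -
  have sub: "closure \<Omega> \<subseteq> cbox a b" using assms(8) box_subset_cbox by blast
  obtain C h0 where C: "C \<ge> 0" "h0 > 0"
    and ext: "\<And>h v K. 0 < h \<Longrightarrow> h \<le> h0 \<Longrightarrow> (\<forall>x. x \<notin> cbox a b \<longrightarrow> v x = 0) \<Longrightarrow> energy_le h (- \<Omega>) v K \<Longrightarrow>
     (\<exists>w. (\<forall>x\<in>grid_lattice h - \<Omega>. w x = v x) \<and> energy_le h UNIV w (C * K))"
    using discrete_extension[OF assms(2,6,7) sub compact_cbox] by blast
  define c where "c = 2 / \<delta> * (1 + C)"
  \<comment> \<open>Adding \<open>c * pl.e\<close> to both sides of
    \<open>pl.e \<le> c * mi.e\<close> gives \<open>pl.e \<le> c / (1 + c) * q\<close>. The constant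
    \<open>c\<close> depends on \<delta> and on the extension constant, not on
    \<open>h\<close>.\<close>
  define r where "r = c / (1 + c)"
  have c: "c \<ge> 0" using C(1) assms(9) by (simp add: c_def)
  have r: "0 \<le> r" "r < 1" using c by (auto simp: r_def)
  show ?thesis
  proof (rule exI[of _ h0], rule conjI[OF C(2)], rule exI[of _ r], rule conjI[OF r(2)],
      intro allI impI)
    fix h assume h: "admissible_grid_size a b h \<and> h \<le> h0"
    interpret interface_setup \<Omega> a b h "X h" \<delta>
      by unfold_locales (use h assms closure_subset[of \<Omega>] in auto)
    have bound: "pl.e \<psi> \<psi> \<le> r * q \<psi> \<psi>" if \<psi>: "\<psi> \<in> F_gamma" for \<psi>
    proof -
      define v where "v = fst (mi.sol \<psi>)"
      have "\<forall>x. x \<notin> cbox a b \<longrightarrow> v x = 0"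
        using mi.solves_sol[OF \<psi>] by (auto simp: mi.solves_def mi.FP_def mi.N_def v_def mem_minus grid_pts_eq)
      then obtain w where w: "\<forall>x\<in>grid_lattice h - \<Omega>. w x = v x" "energy_le h UNIV w (C * (h\<^sup>2 * mi.e \<psi> \<psi>))"
        using ext[OF h_pos _ _ energy_le_exterior[OF \<psi>]] h unfolding v_def by blast
      have "pl.e \<psi> \<psi> \<le> c * mi.e \<psi> \<psi>"
        unfolding c_def using w assms(10)
        by (intro interior_energy_le[OF \<psi> _ _ w(2)]) (auto simp: v_def mem_minus pts_plus_def grid_pts_eq)
      then have "(1 + c) * pl.e \<psi> \<psi> \<le> c * q \<psi> \<psi>" by (simp add: q_def algebra_simps)
      then show ?thesis using c by (simp add: r_def field_simps)
    qed
    note concl = layer_operator_bounds[OF r bound]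
    show "let F = interface_grid.F_gamma \<Omega> (box a b) h;
         A = interface_grid.calA \<Omega> (box a b) h (X h);
         B = interface_grid.calB \<Omega> (box a b) h (X h);
         opnorm = interface_grid.op_norm \<Omega> (box a b) h (X h)
     in (\<forall>\<psi>\<in>F. \<exists>!p. interface_grid.is_single_layer \<Omega> (box a b) h (X h) \<psi> p) \<and>
        (\<forall>\<phi>\<in>F. \<exists>!p. interface_grid.is_double_layer \<Omega> (box a b) h (X h) \<phi> p) \<and>
        interface_grid.symmetric_op \<Omega> (box a b) h (X h) A \<and>
        interface_grid.symmetric_op \<Omega> (box a b) h (X h) B \<and>
        opnorm B \<le> ereal r \<and>
        (\<forall>\<phi>\<in>F. A \<phi> = (\<lambda>I. \<phi> I + B \<phi> I)) \<and>
        bij_betw A F F \<and>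
        opnorm (inv_into F A) \<le> ereal (inverse (1 - r)) \<and>
        interface_grid.op_spectrum \<Omega> (box a b) h A \<subseteq> {1 - r..1}"
      unfolding Let_def using concl by simp
  qed
qed

end
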